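(* Consider the excited random walk with Markovian cookie stacks described in the context, fix an arbitrary initial distribution $\eta$ on $\mathcal R$, and assume $\bar p=\mu\cdot\mathbf p=1/2$. Let $\delta,\tilde\delta$ be the parameters defined in the context. Then $\delta+\tilde\delta<1$, and: - if $\delta>1$ then $P_\eta(\lim_{n\to\infty}X_n=\infty)=1$; - if $\tilde\delta>1$ then $P_\eta(\lim_{n\to\infty}X_n=-\infty)=1$; - if $\delta\le1$ and $\tilde\delta\le1$ then $P_\eta(\liminf_{n\to\infty}X_n=-\infty,\ \limsup_{n\to\infty}X_n=\infty)=1$.
   Context: Let $\mathcal R=\{1,\dots,N\}$ and let $K$ be a stochastic matrix on $\mathcal R$ such that the Markov chain with transition matrix $K$ has a unique closed irreducible subset $\mathcal R_0\subseteq\mathcal R$; let $\mu$ (a row vector) be its unique stationary distribution. Fix $p:\mathcal R\to(0,1)$ and write $\mathbf p=(p(1),\dots,p(N))^t$, $\mathbf 1$ for the all-ones column vector, $I$ for the identity matrix, $D_p$ for the diagonal matrix with $i$-th diagonal entry $p(i)$, $D_{1-p}=I-D_p$, and $\bar p=\mu\cdot\mathbf p$. For a probability distribution $\eta$ on $\mathcal R$, $\mathbb P_\eta$ denotes the law of an i.i.d. family $\{(R^x_j)_{j\ge1}\}_{x\in\mathbb Z}$ of Markov chains with transition matrix $K$ and $R^x_1\sim\eta$; the cookie environment is $\omega_x(j)=p(R^x_j)$. Given $\omega$, the excited random walk $(X_n)_{n\ge0}$ has quenched law $P_\omega$ with $X_0=0$ and $P_\omega(X_{n+1}=X_n+1\mid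 X_0,\dots,X_n)=1-P_\omega(X_{n+1}=X_n-1\mid X_0,\dots,X_n)=\omega_{X_n}(\#\{k\le n:X_k=X_n\})$; the averaged law is $P_\eta(\cdot)=\mathbb E_\eta[P_\omega(\cdot)]$. When $\bar p=1/2$ define the column vectors $\mathbf r=(I-K+2(\mathbf 1-\mathbf p)\mu D_{1-p}K)^{-1}\mathbf p-\mathbf 1$ and $\tilde{\mathbf r}=(I-K+2\mathbf p\,\mu D_pK)^{-1}(\mathbf 1-\mathbf p)-\mathbf 1$, the scalars $\nu=2+4\mu D_pK\mathbf r$ and $\tilde\nu=2+4\mu D_{1-p}K\tilde{\mathbf r}$, and $\delta=2\,\eta\cdot\mathbf r/\nu$, $\tilde\delta=2\,\eta\cdot\tilde{\mathbf r}/\tilde\nu$. *)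

theory Defs
  imports "HOL-Probability.Probability"
begin

text \<open>State space: an arbitrary finite type 's (playing the role of R = {1..N}).
  Matrices are real^'s^'s, column vectors real^'s; a row vector (mu, eta) is also
  an element of real^'s, and mu v* A is the row vector mu A.\<close>

definition diagm :: "real^'n \<Rightarrow> real^'n^'n" where
  "diagm v = (\<chi> i j. if i = j then v$i else 0)"

definition outerp :: "real^'n \<Rightarrow> real^'n \<Rightarrow> real^'n^'n" where
  "outerp a b = (\<chi> i j. a$i * b$j)"

definition stochastic_matrix :: "real^'n^'n \<Rightarrow> bool" where
  "stochastic_matrix K \<longleftrightarrow> (\<forall>i j. K$i$j \<ge> 0) \<and> (\<forall>i. (\<Sum>j\<in>UNIV. K$i$j) = 1)"

definition prob_vector :: "real^'n \<Rightarrow> bool" where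
  "prob_vector v \<longleftrightarrow> (\<forall>i. v$i \<ge> 0) \<and> (\<Sum>i\<in>UNIV. v$i) = 1"

text \<open>One-step transition relation of the chain.\<close>
definition trans_rel :: "real^'n^'n \<Rightarrow> ('n \<times> 'n) set" where
  "trans_rel K = {(i, j). K$i$j > 0}"

definition closed_set :: "real^'n^'n \<Rightarrow> 'n set \<Rightarrow> bool" where
  "closed_set K C \<longleftrightarrow> C \<noteq> {} \<and> (\<forall>i\<in>C. \<forall>j. K$i$j > 0 \<longrightarrow> j \<in> C)"

definition irreducible_set :: "real^'n^'n \<Rightarrow> 'n set \<Rightarrow> bool" where
  "irreducible_set K C \<longleftrightarrow> (\<forall>i\<in>C. \<forall>j\<in>C. (i, j) \<in> (trans_rel K)\<^sup>*)"

definition stationary_dist :: "real^'n^'n \<Rightarrow> real^'n \<Rightarrow> bool" where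
  "stationary_dist K mu \<longleftrightarrow> prob_vector mu \<and> mu v* K = mu"

text \<open>The vectors r, r~ and scalars nu, nu~, delta, delta~ of the paper.\<close>
definition r_vec :: "real^'n^'n \<Rightarrow> real^'n \<Rightarrow> real^'n \<Rightarrow> real^'n" where
  "r_vec K p mu = matrix_inv (mat 1 - K + 2 *\<^sub>R outerp (vec 1 - p) (mu v* (diagm (vec 1 - p) ** K)))
                   *v p - vec 1"

definition rt_vec :: "real^'n^'n \<Rightarrow> real^'n \<Rightarrow> real^'n \<Rightarrow> real^'n" where
  "rt_vec K p mu = matrix_inv (mat 1 - K + 2 *\<^sub>R outerp p (mu v* (diagm p ** K)))
                   *v (vec 1 - p) - vec 1"

definition nu_val :: "real^'n^'n \<Rightarrow> real^'n \<Rightarrow> real^'n \<Rightarrow> real" where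
  "nu_val K p mu = 2 + 4 * ((mu v* (diagm p ** K)) \<bullet> r_vec K p mu)"

definition nut_val :: "real^'n^'n \<Rightarrow> real^'n \<Rightarrow> real^'n \<Rightarrow> real" where
  "nut_val K p mu = 2 + 4 * ((mu v* (diagm (vec 1 - p) ** K)) \<bullet> rt_vec K p mu)"

definition delta_val :: "real^'n^'n \<Rightarrow> real^'n \<Rightarrow> real^'n \<Rightarrow> real^'n \<Rightarrow> real" where
  "delta_val K p mu eta = 2 * (eta \<bullet> r_vec K p mu) / nu_val K p mu"

definition deltat_val :: "real^'n^'n \<Rightarrow> real^'n \<Rightarrow> real^'n \<Rightarrow> real^'n \<Rightarrow> real" where
  "deltat_val K p mu eta = 2 * (eta \<bullet> rt_vec K p mu) / nut_val K p mu"

text \<open>The model on a probability space M.  R x j (j \<ge> 1) is the j-th state of the cookie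
  stack at site x; the value R x 0 is irrelevant.\<close>

definition env_measure :: "(int \<Rightarrow> nat \<Rightarrow> 'n) measure" where
  "env_measure = Pi\<^sub>M UNIV (\<lambda>x. Pi\<^sub>M UNIV (\<lambda>j. count_space UNIV))"

text \<open>(R x) is, for every site x, a Markov chain (R x 1, R x 2, ...) with transition matrix K
  and R x 1 distributed as eta; the chains at different sites are independent.\<close>
definition iid_markov_env ::
  "'a measure \<Rightarrow> real^'n^'n \<Rightarrow> real^'n \<Rightarrow> (int \<Rightarrow> nat \<Rightarrow> 'a \<Rightarrow> 'n) \<Rightarrow> bool" where
  "iid_markov_env M K eta R \<longleftrightarrow>
     (\<forall>x. (\<lambda>w. \<lambda>j. R x j w) \<in> measurable M (Pi\<^sub>M UNIV (\<lambda>j. count_space UNIV))) \<and>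
     (\<forall>x n (s :: nat \<Rightarrow> 'n). n \<ge> 1 \<longrightarrow>
        measure M {w \<in> space M. \<forall>j\<in>{1..n}. R x j w = s j}
          = eta $ s 1 * (\<Prod>j\<in>{1..<n}. K $ s j $ s (Suc j))) \<and>
     prob_space.indep_vars M (\<lambda>_. Pi\<^sub>M UNIV (\<lambda>j. count_space UNIV)) (\<lambda>x w. \<lambda>j. R x j w) UNIV"

text \<open>Number of visits to the current site up to time n: #{k \<le> n. X_k = X_n}.\<close>
definition visits :: "(nat \<Rightarrow> int) \<Rightarrow> nat \<Rightarrow> nat" where
  "visits h n = card {k. k \<le> n \<and> h k = h n}"

text \<open>X is an excited random walk in the cookie environment omega_x(j) = p(R x j):
  X_0 = 0, nearest-neighbour steps, and, conditionally on the whole environment and on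
  X_0..X_n, the walk steps right with probability omega_{X_n}(#{k \<le> n. X_k = X_n}).
  The conditional statement is written in integrated form over all environment events E
  and all histories h.\<close>
definition excited_walk ::
  "'a measure \<Rightarrow> ('n \<Rightarrow> real) \<Rightarrow> (int \<Rightarrow> nat \<Rightarrow> 'a \<Rightarrow> 'n) \<Rightarrow> (nat \<Rightarrow> 'a \<Rightarrow> int) \<Rightarrow> bool" where
  "excited_walk M p R X \<longleftrightarrow>
     (\<forall>n. X n \<in> measurable M (count_space UNIV)) \<and>
     (\<forall>w\<in>space M. X 0 w = 0) \<and>
     (\<forall>w\<in>space M. \<forall>n. \<bar>X (Suc n) w - X n w\<bar> = 1) \<and>
     (\<forall>n (h :: nat \<Rightarrow> int) E. E \<in> sets env_measure \<longrightarrow>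
        measure M {w \<in> space M. (\<lambda>x j. R x j w) \<in> E \<and> (\<forall>k\<le>n. X k w = h k)
                                   \<and> X (Suc n) w = X n w + 1}
        = (\<integral>w. indicator {w \<in> space M. (\<lambda>x j. R x j w) \<in> E \<and> (\<forall>k\<le>n. X k w = h k)} w
                   * p (R (h n) (visits h n) w) \<partial>M))"

end

theory Submission
  imports Defs "HOL-Real_Asymp.Real_Asymp"
begin

text \<open>
  Conditionally on the cookies the walk is driven by independent coins; after averaging, the coin
  columns at different sites are i.i.d. For a fixed array of coins, the numbers of right steps from
  the sites to the right of a given level, counted until the walk first falls below that level,
  follow the recursion \<open>m \<mapsto>\<close> (number of right coins before the \<open>m\<close>-th left coin). So the walk
  falls below the level iff this branching process becomes extinct.

  The vector \<open>r\<close> solves the Poisson equation \<open>(I - K) r = 2 p - 1\<close> with \<open>mu D\<^bsub>1-p\<^esub> K r = 0\<close>. Hence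
  the coin sum plus \<open>r\<close> of the current cookie state is a martingale, and one generation of the
  branching process started from \<open>m\<close> has mean increment \<open>eta \<bullet> r + o(1)\<close> and variance
  \<open>nu m + O(sqrt m)\<close>. The functions \<open>ln m - m powr (-1/4)\<close> (for \<open>delta \<le> 1\<close>, including the critical
  case) and \<open>m powr (-\<alpha>)\<close> (for \<open>delta > 1\<close>) are then superharmonic for large \<open>m\<close>, which decides
  extinction. In the transient case the levels below which the walk never falls again occur
  infinitely often by Kolmogorov's 0-1 law. Finally \<open>nu\<close> is an asymptotic variance, hence positive, and
  the reflected vector is \<open>c - r\<close> with \<open>nu = 2 + 2 c\<close>, whence \<open>delta + deltat = 1 - 2 / nu < 1\<close>.
\<close>

section \<open>Poisson equation of the cookie chain\<close>

text \<open>The number of coins flipped at a site is unbounded, and the cookie state after the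
  \<open>m\<close>-th left step depends on the past. Moments of one generation are therefore
  computed by optional stopping in discrete form: a function of left steps outstanding, right steps
  made and cookie state that is superharmonic for one coin flip bounds the expectation at the
  stopping time, by induction over the recursion \<open>T\<close>. The linear martingale gives the
  mean \<open>r i\<close> minus the expectation of \<open>r\<close> at the final state. The
  normalisation \<open>pifail r = 0\<close> makes the latter decay, because
  \<open>2 * pifail\<close> is the stationary law of the cookie state seen after left steps.
  Counting left steps instead of coins turns the variance \<open>nu / 2\<close> per coin into
  \<open>nu\<close> per left step. Taylor expansion of the test functions leaves a cubic remainder,
  split between second and fourth powers; hence a fourth moment bound of order \<open>m^2\<close> is
  also required. The walk of the theorem is known only through its law; its finite path
  probabilities are matched with those of a walk driven by i.i.d. coin columns, for which the
  combinatorics is deterministic.\<close>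

lemma sum_UNIV_pos:
  fixes f :: "'a::finite \<Rightarrow> real"
  assumes "\<And>i. f i \<ge> 0" "f j > 0"
  shows "(\<Sum>i\<in>UNIV. f i) > 0"
  using assms by (meson UNIV_I finite sum_pos2)

text \<open>A closed subset of least cardinality works: the set reachable from any of its points is
  closed and contained in it, hence equal to it.\<close>

lemma closed_set_contains_irreducible:
  fixes K :: "real^'s::finite^'s"
  assumes "closed_set K C"
  shows "\<exists>D\<subseteq>C. closed_set K D \<and> irreducible_set K D"
proof -
  obtain D where D: "closed_set K D" "D \<subseteq> C"
    and min: "\<And>E. closed_set K E \<and> E \<subseteq> C \<Longrightarrow> card D \<le> card E"
    using ex_has_least_nat[of "\<lambda>E. closed_set K E \<and> E \<subseteq> C" C card] assms by auto
  have reach: "{j. (i, j) \<in> (trans_rel K)\<^sup>*} = D" if "i \<in> D" for i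
  proof -
    let ?E = "{j. (i, j) \<in> (trans_rel K)\<^sup>*}"
    have sub: "?E \<subseteq> D"
    proof
      fix j assume "j \<in> ?E"
      then have "(i, j) \<in> (trans_rel K)\<^sup>*" by simp
      then show "j \<in> D"
        by induction (use that D in \<open>auto simp: closed_set_def trans_rel_def\<close>)
    qed
    have "closed_set K ?E"
      unfolding closed_set_def trans_rel_def by (auto intro: rtrancl_into_rtrancl)
    with sub D(2) min have "card D \<le> card ?E" by blast
    then show ?thesis using sub by (meson card_seteq finite)
  qed
  have "irreducible_set K D" unfolding irreducible_set_def using reach by blast
  with D show ?thesis by blast
qed

text \<open>At a maximiser the average over the successors equals the maximum, so every successor of
  positive weight is again a maximiser.\<close>

lemma argmax_closed:
  fixes K :: "real^'s::finite^'s"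
  assumes st: "stochastic_matrix K" and h: "\<And>i. (\<Sum>j\<in>UNIV. K$i$j * x j) = x i"
  shows "closed_set K {i. \<forall>j. x j \<le> x i}"
proof -
  have "\<exists>i. \<forall>j. x j \<le> x i"
    using Max_in[of "range x"] Max_ge[of "range x"]
    by (metis UNIV_not_empty finite finite_imageI image_iff image_is_empty rangeI)
  moreover have "x k \<le> x j" if i: "\<forall>j. x j \<le> x i" and K: "K$i$j > 0" for i j k
  proof -
    have "(\<Sum>j\<in>UNIV. K$i$j * (x i - x j)) = x i * (\<Sum>j\<in>UNIV. K$i$j) - (\<Sum>j\<in>UNIV. K$i$j * x j)"
      by (simp add: algebra_simps sum_subtractf sum_distrib_left)
    also have "\<dots> = 0" using st h by (simp add: stochastic_matrix_def)
    finally have "K$i$j * (x i - x j) = 0"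
      by (subst (asm) sum_nonneg_eq_0_iff) (use st i in \<open>auto simp: stochastic_matrix_def\<close>)
    then show ?thesis using K i by auto
  qed
  ultimately show ?thesis unfolding closed_set_def by blast
qed

locale cookie_chain =
  fixes K :: "real^'s::finite^'s" and p mu :: "real^'s"
  assumes K_stoch: "stochastic_matrix K"
    and unique_class: "\<exists>!C. closed_set K C \<and> irreducible_set K C"
    and mu_stat: "stationary_dist K mu"
    and p_range: "\<And>i. 0 < p$i \<and> p$i < 1"
    and pbar: "mu \<bullet> p = 1/2"
begin

lemma K_nonneg: "K$i$j \<ge> 0" and K_row: "(\<Sum>j\<in>UNIV. K$i$j) = 1"
  using K_stoch by (auto simp: stochastic_matrix_def)

lemma p_pos: "p$i > 0" and p_less: "p$i < 1" using p_range by auto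

lemma mu_nonneg: "mu$i \<ge> 0" and mu_sum: "(\<Sum>i\<in>UNIV. mu$i) = 1"
  using mu_stat by (auto simp: stationary_dist_def prob_vector_def)

lemma mu_p: "(\<Sum>i\<in>UNIV. mu$i * p$i) = 1/2"
  using pbar by (simp add: inner_vec_def)

definition Kf :: "('s \<Rightarrow> real) \<Rightarrow> 's \<Rightarrow> real" where
  "Kf h i = (\<Sum>j\<in>UNIV. K$i$j * h j)"

lemma Kf_add: "Kf (\<lambda>i. f i + g i) i = Kf f i + Kf g i"
  and Kf_diff: "Kf (\<lambda>i. f i - g i) i = Kf f i - Kf g i"
  and Kf_cmult: "Kf (\<lambda>i. c * f i) i = c * Kf f i"
  and Kf_const: "Kf (\<lambda>i. c) i = c"
  using K_row[of i]
  by (simp_all add: Kf_def algebra_simps sum.distrib sum_subtractf sum_distrib_left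
      flip: sum_distrib_left)

lemma Kf_mono: "(\<And>j. f j \<le> g j) \<Longrightarrow> Kf f i \<le> Kf g i"
  unfolding Kf_def by (intro sum_mono mult_left_mono K_nonneg) auto

lemma Kf_nonneg: "(\<And>j. f j \<ge> 0) \<Longrightarrow> Kf f i \<ge> 0"
  using Kf_mono[of "\<lambda>_. 0" f i] by (simp add: Kf_const)

lemma mu_Kf: "(\<Sum>i\<in>UNIV. mu$i * Kf h i) = (\<Sum>i\<in>UNIV. mu$i * h i)"
proof -
  have *: "mu$j = (\<Sum>i\<in>UNIV. mu$i * K$i$j)" for j
  proof -
    have "mu$j = (mu v* K)$j" using mu_stat by (simp add: stationary_dist_def)
    then show ?thesis by (simp add: vector_matrix_mult_def mult.commute)
  qed
  have "(\<Sum>i\<in>UNIV. mu$i * Kf h i) = (\<Sum>j\<in>UNIV. \<Sum>i\<in>UNIV. mu$i * K$i$j * h j)"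
    by (subst sum.swap) (simp add: Kf_def sum_distrib_left mult.assoc)
  also have "\<dots> = (\<Sum>j\<in>UNIV. mu$j * h j)"
    by (subst *) (simp add: sum_distrib_right)
  finally show ?thesis .
qed

text \<open>The law of the cookie state following a left step, up to the factor 2.\<close>
definition pifail :: "('s \<Rightarrow> real) \<Rightarrow> real" where
  "pifail h = (\<Sum>i\<in>UNIV. mu$i * (1 - p$i) * Kf h i)"

lemma pifail_const: "pifail (\<lambda>_. c) = c / 2"
  using mu_p by (simp add: pifail_def Kf_const algebra_simps sum_subtractf mu_sum flip: sum_distrib_right sum_distrib_left)

text \<open>The maximisers and the minimisers form closed sets. Each contains a closed irreducible
  set, and uniqueness of that set forces maximum and minimum to coincide.\<close>

lemma harmonic_const:
  assumes h: "\<And>i. Kf x i = x i"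
  shows "x i = x j"
proof -
  obtain C where C: "\<And>D. closed_set K D \<and> irreducible_set K D \<Longrightarrow> D = C"
    using unique_class by blast
  have 1: "closed_set K {i. \<forall>j. x j \<le> x i}"
    by (rule argmax_closed[OF K_stoch]) (use h in \<open>simp add: Kf_def\<close>)
  have 2: "closed_set K {i. \<forall>j. - x j \<le> - x i}"
    by (rule argmax_closed[OF K_stoch]) (use h in \<open>simp add: Kf_def sum_negf\<close>)
  obtain D1 where D1: "D1 \<subseteq> {i. \<forall>j. x j \<le> x i}" "closed_set K D1" "irreducible_set K D1"
    using closed_set_contains_irreducible[OF 1] by blast
  obtain D2 where D2: "D2 \<subseteq> {i. \<forall>j. - x j \<le> - x i}" "closed_set K D2" "irreducible_set K D2"
    using closed_set_contains_irreducible[OF 2] by blast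
  have "D1 = D2" using C D1 D2 by metis
  moreover obtain k where "k \<in> D1" using D1 by (auto simp: closed_set_def)
  ultimately have "\<forall>j. x j \<le> x k" "\<forall>j. x k \<le> x j" using D1 D2 by auto
  then show ?thesis by (meson antisym order_trans)
qed

text \<open>Every state of the unique class is reachable from everywhere. One transition is
  prepended so that the path is never empty, as the minorisation at left steps requires.\<close>

lemma ex_attracting_state: "\<exists>j. \<forall>i. (i, j) \<in> (trans_rel K)\<^sup>+"
proof -
  obtain C where C: "closed_set K C" and uniq: "\<And>D. closed_set K D \<and> irreducible_set K D \<Longrightarrow> D = C"
    using unique_class by blast
  obtain j where j: "j \<in> C" using C by (auto simp: closed_set_def)
  have reach: "(i, j) \<in> (trans_rel K)\<^sup>*" for i
  proof -
    have "closed_set K {j. (i, j) \<in> (trans_rel K)\<^sup>*}"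
      unfolding closed_set_def trans_rel_def by (auto intro: rtrancl_into_rtrancl)
    from closed_set_contains_irreducible[OF this] uniq j show ?thesis by blast
  qed
  have "(i, j) \<in> (trans_rel K)\<^sup>+" for i
  proof -
    have "\<exists>l. K$i$l > 0"
      using K_row[of i] K_nonneg[of i] by (metis less_le sum.neutral zero_neq_one)
    then obtain l where "(i, l) \<in> trans_rel K" by (auto simp: trans_rel_def)
    with reach[of l] show ?thesis by (meson rtrancl_into_trancl2)
  qed
  then show ?thesis by blast
qed

text \<open>\<open>mat 1 - K\<close> is singular on constants; the rank-one term restores
  invertibility by adding a multiple of \<open>pifail\<close>.\<close>

definition Pmat :: "real^'s^'s" where
  "Pmat = mat 1 - K + 2 *\<^sub>R outerp (vec 1 - p) (mu v* (diagm (vec 1 - p) ** K))"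

lemma row_diagm_K: "mu v* (diagm a ** K) = (\<chi> j. \<Sum>i\<in>UNIV. mu$i * a$i * K$i$j)"
proof -
  have "(diagm a ** K)$i$j = a$i * K$i$j" for i j
    by (simp add: matrix_matrix_mult_def diagm_def if_distrib[of "\<lambda>x. x * _"] cong: if_cong)
  then show ?thesis
    by (simp add: vec_eq_iff vector_matrix_mult_def mult_ac)
qed

lemma row_diagm_K_inner:
  "(mu v* (diagm a ** K)) \<bullet> x = (\<Sum>i\<in>UNIV. mu$i * a$i * Kf (($) x) i)"
proof -
  have "(mu v* (diagm a ** K)) \<bullet> x = (\<Sum>j\<in>UNIV. \<Sum>i\<in>UNIV. mu$i * a$i * K$i$j * x$j)"
    by (simp add: row_diagm_K inner_vec_def sum_distrib_right)
  then show ?thesis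
    by (subst (asm) sum.swap) (simp add: Kf_def sum_distrib_left mult.assoc)
qed

lemma Pmat_mult: "(Pmat *v x)$i = x$i - Kf (($) x) i + 2 * (1 - p$i) * pifail (($) x)"
proof -
  have "outerp a b *v x = (\<chi> i. a$i * (b \<bullet> x))" for a b :: "real^'s"
    by (simp add: outerp_def vec_eq_iff matrix_vector_mult_def inner_vec_def sum_distrib_left mult.assoc)
  then show ?thesis
    unfolding Pmat_def
    by (simp add: matrix_vector_mult_add_rdistrib matrix_vector_mult_diff_rdistrib
        scaleR_matrix_vector_assoc[symmetric] row_diagm_K_inner pifail_def)
       (simp add: matrix_vector_mult_def Kf_def)
qed

text \<open>Stationarity kills the \<open>mat 1 - K\<close> part, and \<open>1 - p\<close> has
  \<open>mu\<close>-mean 1/2, which the factor 2 compensates. So the \<open>mu\<close>-mean of a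
  right-hand side reads off \<open>pifail\<close> of the solution.\<close>

lemma Pmat_pifail: "(\<Sum>i\<in>UNIV. mu$i * (Pmat *v x)$i) = pifail (($) x)"
proof -
  have "(\<Sum>i\<in>UNIV. mu$i * (Pmat *v x)$i)
     = (\<Sum>i\<in>UNIV. mu$i * x$i) - (\<Sum>i\<in>UNIV. mu$i * Kf (($) x) i)
       + 2 * pifail (($) x) * ((\<Sum>i\<in>UNIV. mu$i) - (\<Sum>i\<in>UNIV. mu$i * p$i))"
    by (simp add: Pmat_mult right_diff_distrib distrib_left sum.distrib sum_subtractf sum_distrib_left
        sum_distrib_right mult_ac left_diff_distrib distrib_right)
  then show ?thesis by (simp add: mu_Kf mu_sum mu_p)
qed

text \<open>On the kernel \<open>pifail\<close> vanishes, so a kernel vector is harmonic for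
  \<open>K\<close>, hence a constant \<open>c\<close>; then \<open>pifail\<close> equals
  \<open>c / 2\<close>, and \<open>c = 0\<close>.\<close>

lemma Pmat_invertible: "invertible Pmat"
proof -
  have "x = 0" if x: "Pmat *v x = 0" for x
  proof -
    have pf: "pifail (($) x) = 0" using Pmat_pifail[of x] x by simp
    then have "Kf (($) x) i = x$i" for i using Pmat_mult[of x i] x by simp
    then have "x$i = x$j" for i j by (rule harmonic_const)
    then have c: "($) x = (\<lambda>_. x$undefined)" by auto
    then have "x$undefined / 2 = 0" using pf pifail_const[of "x$undefined"] by simp
    with c show ?thesis by (simp add: vec_eq_iff fun_eq_iff)
  qed
  then show ?thesis
    using matrix_left_invertible_ker invertible_left_inverse by blast
qed

lemma Pmat_inv: "Pmat *v (matrix_inv Pmat *v x) = x"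
proof -
  have "Pmat ** matrix_inv Pmat = mat 1"
    using someI_ex[OF Pmat_invertible[unfolded invertible_def]] by (simp add: matrix_inv_def)
  then show ?thesis by (simp add: matrix_vector_mul_assoc)
qed

lemma poisson_solvable:
  assumes "(\<Sum>i\<in>UNIV. mu$i * w i) = 0"
  obtains x where "\<And>i. x i - Kf x i = w i" "pifail x = 0"
proof
  let ?x = "matrix_inv Pmat *v (\<chi> i. w i)"
  have x: "Pmat *v ?x = (\<chi> i. w i)" by (rule Pmat_inv)
  show "pifail (($) ?x) = 0" using Pmat_pifail[of ?x] assms by (simp add: x)
  then show "?x$i - Kf (($) ?x) i = w i" for i using Pmat_mult[of ?x i] by (simp add: x)
qed

definition r :: "'s \<Rightarrow> real" where "r i = r_vec K p mu $ i"

lemma r_vec_eq: "r_vec K p mu = matrix_inv Pmat *v p - vec 1"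
  by (simp add: r_vec_def Pmat_def)

text \<open>\<open>Pmat\<close> maps the all-ones vector to \<open>1 - p\<close>, so subtracting
  that vector changes the right-hand side \<open>p\<close> into \<open>2 p - 1\<close>, whose
  \<open>mu\<close>-mean is 0.\<close>

lemma r_poisson: "r i - Kf r i = 2 * p$i - 1" and r_pifail: "pifail r = 0"
proof -
  have rv: "($) (r_vec K p mu) = r" by (auto simp: r_def)
  have v1: "($) (vec 1 :: real^'s) = (\<lambda>_. 1)" by auto
  have "(Pmat *v vec 1)$i = 1 - p$i" for i
    unfolding Pmat_mult v1 by (simp add: Kf_const pifail_const)
  then have "Pmat *v vec 1 = vec 1 - p" by (simp add: vec_eq_iff)
  then have P: "Pmat *v r_vec K p mu = p - (vec 1 - p)"
    by (simp add: r_vec_eq matrix_vector_mult_diff_distrib Pmat_inv)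
  have "(\<Sum>i\<in>UNIV. mu$i * (p - (vec 1 - p))$i) = 2 * (\<Sum>i\<in>UNIV. mu$i * p$i) - (\<Sum>i\<in>UNIV. mu$i)"
    by (simp add: algebra_simps sum.distrib sum_subtractf sum_distrib_left)
  then show pf: "pifail r = 0"
    using Pmat_pifail[of "r_vec K p mu"] by (simp add: P rv mu_p mu_sum)
  show "r i - Kf r i = 2 * p$i - 1"
    using Pmat_mult[of "r_vec K p mu" i] by (simp add: P rv pf r_def[symmetric])
qed

definition nu :: real where "nu = nu_val K p mu"

lemma nu_eq: "nu = 2 + 4 * (\<Sum>i\<in>UNIV. mu$i * p$i * Kf r i)"
proof -
  have rv: "($) (r_vec K p mu) = r" by (auto simp: r_def)
  show ?thesis by (simp add: nu_def nu_val_def row_diagm_K_inner rv)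
qed

text \<open>Conditional variance of one increment of the martingale formed by the coin sum plus
  \<open>r\<close> of the current cookie state.\<close>
definition increment_var :: "'s \<Rightarrow> real" where
  "increment_var i = p$i * Kf (\<lambda>j. (1 + r j - r i)\<^sup>2) i + (1 - p$i) * Kf (\<lambda>j. (-1 + r j - r i)\<^sup>2) i"

text \<open>By the Poisson equation the conditional variance is
  \<open>1 - r^2 + K r^2 + 2 (2 p - 1) K r\<close>. Under \<open>mu\<close> the squares cancel, and
  \<open>pifail r = 0\<close> lets \<open>K r\<close> be weighted by \<open>p\<close> alone.\<close>

lemma mu_increment_var: "(\<Sum>i\<in>UNIV. mu$i * increment_var i) = nu / 2"
proof -
  have e1: "Kf (\<lambda>j. (c + r j - r i)\<^sup>2) i = (c - r i)\<^sup>2 + 2 * (c - r i) * Kf r i + Kf (\<lambda>j. (r j)\<^sup>2) i" for c i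
  proof -
    have "Kf (\<lambda>j. (c + r j - r i)\<^sup>2) i = Kf (\<lambda>j. (c - r i)\<^sup>2 + (2 * (c - r i) * r j + (r j)\<^sup>2)) i"
      by (rule arg_cong[of _ _ "\<lambda>f. Kf f i"]) (auto simp: power2_eq_square algebra_simps)
    then show ?thesis by (simp only: Kf_add Kf_const Kf_cmult)
  qed
  have e2: "increment_var i = 1 - (r i)\<^sup>2 + Kf (\<lambda>j. (r j)\<^sup>2) i + 2 * (2 * p$i - 1) * Kf r i" for i
  proof -
    have "increment_var i = 1 - 2 * r i * (2 * p$i - 1) + (r i)\<^sup>2 - 2 * r i * Kf r i
        + Kf (\<lambda>j. (r j)\<^sup>2) i + 2 * (2 * p$i - 1) * Kf r i"
      unfolding increment_var_def e1 by (simp add: power2_eq_square algebra_simps)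
    also have "1 - 2 * r i * (2 * p$i - 1) + (r i)\<^sup>2 - 2 * r i * Kf r i = 1 - (r i)\<^sup>2"
      unfolding r_poisson[of i, symmetric] by (simp add: power2_eq_square algebra_simps)
    finally show ?thesis by simp
  qed
  have rr: "(\<Sum>i\<in>UNIV. mu$i * p$i * Kf r i) = (\<Sum>i\<in>UNIV. mu$i * Kf r i)"
    using r_pifail by (simp add: pifail_def algebra_simps sum_subtractf)
  have "(\<Sum>i\<in>UNIV. mu$i * increment_var i) = (\<Sum>i\<in>UNIV. mu$i) - (\<Sum>i\<in>UNIV. mu$i * (r i)\<^sup>2)
      + (\<Sum>i\<in>UNIV. mu$i * Kf (\<lambda>j. (r j)\<^sup>2) i)
      + 4 * (\<Sum>i\<in>UNIV. mu$i * p$i * Kf r i) - 2 * (\<Sum>i\<in>UNIV. mu$i * Kf r i)"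
    by (simp add: e2 algebra_simps sum.distrib sum_subtractf sum_distrib_left)
  also have "\<dots> = nu / 2"
    by (simp add: mu_Kf[of "\<lambda>j. (r j)\<^sup>2"] mu_sum nu_eq rr)
  finally show ?thesis .
qed

lemma increment_var_nonneg: "increment_var i \<ge> 0"
  unfolding increment_var_def using p_range[of i] by (intro add_nonneg_nonneg mult_nonneg_nonneg Kf_nonneg) auto

text \<open>The two possible coin values differ by 2, so no value of \<open>r j - r i\<close> can
  cancel both: the two squares add up to at least 2.\<close>

lemma increment_var_pos: "increment_var i > 0"
proof (rule ccontr)
  assume "\<not> increment_var i > 0"
  then have 0: "increment_var i = 0" using increment_var_nonneg[of i] by simp
  let ?f = "\<lambda>j. (1 + r j - r i)\<^sup>2" and ?g = "\<lambda>j. (-1 + r j - r i)\<^sup>2"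
  have "p$i * Kf ?f i \<ge> 0" "(1 - p$i) * Kf ?g i \<ge> 0"
    using p_range[of i] by (intro mult_nonneg_nonneg Kf_nonneg; auto)+
  with 0 have "p$i * Kf ?f i = 0" "(1 - p$i) * Kf ?g i = 0"
    unfolding increment_var_def by linarith+
  then have "Kf ?f i = 0" "Kf ?g i = 0" using p_range[of i] by auto
  then have "Kf (\<lambda>j. ?f j + ?g j) i = 0" by (simp only: Kf_add)
  moreover have "Kf (\<lambda>j. 2) i \<le> Kf (\<lambda>j. ?f j + ?g j) i"
  proof (rule Kf_mono)
    fix j
    have "?f j + ?g j = 2 + 2 * (r j - r i)\<^sup>2" by (simp add: power2_eq_square algebra_simps)
    then show "2 \<le> ?f j + ?g j" by simp
  qed
  ultimately show False by (simp add: Kf_const)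
qed

lemma nu_pos: "nu > 0"
proof -
  obtain i where "mu$i > 0" using mu_sum mu_nonneg
    by (metis less_le sum.neutral zero_neq_one)
  then have "(\<Sum>i\<in>UNIV. mu$i * increment_var i) > 0"
    by (intro sum_UNIV_pos[of _ i]) (use mu_nonneg increment_var_pos in \<open>auto intro: mult_nonneg_nonneg less_imp_le\<close>)
  then show ?thesis using mu_increment_var by simp
qed

lemma mirror: "cookie_chain K (1 - p) mu"
proof
  show "mu \<bullet> (1 - p) = 1/2"
    using mu_sum mu_p by (simp add: inner_vec_def algebra_simps sum_subtractf)
qed (use K_stoch unique_class mu_stat p_range in \<open>auto simp: algebra_simps\<close>)

end

lemma deltat_val_mirror: "deltat_val K p mu eta = delta_val K (1 - p) mu eta"
  by (simp add: deltat_val_def delta_val_def rt_vec_def r_vec_def nut_val_def nu_val_def)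

lemma (in cookie_chain) delta_sum_less:
  assumes eta: "prob_vector eta"
  shows "delta_val K p mu eta + delta_val K (1 - p) mu eta < 1"
proof -
  interpret m: cookie_chain K "1 - p" mu by (rule mirror)
  let ?s = "\<lambda>i. r i + m.r i"
  \<comment> \<open>The sources \<open>2 p - 1\<close> and \<open>1 - 2 p\<close> of the two Poisson
    equations cancel, so the sum is harmonic and therefore constant.\<close>
  have "Kf ?s i = ?s i" for i
    using r_poisson[of i] m.r_poisson[of i] by (simp add: Kf_add)
  then have "?s i = ?s j" for i j by (rule harmonic_const)
  then obtain c where c: "\<And>i. ?s i = c" by metis
  then have "m.r i = c - r i" for i by (metis add_diff_cancel_left')
  then have mrf: "m.r = (\<lambda>i. c - r i)" by auto
  \<comment> \<open>The mirrored normalisation averages with \<open>p\<close> instead of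
    \<open>1 - p\<close>, which is the average occurring in \<open>nu\<close>; this identifies
    \<open>c\<close>.\<close>
  have "m.pifail m.r = 0" by (rule m.r_pifail)
  then have "0 = (\<Sum>i\<in>UNIV. mu$i * p$i * Kf m.r i)" by (simp add: m.pifail_def)
  also have "\<dots> = (\<Sum>i\<in>UNIV. mu$i * p$i) * c - (\<Sum>i\<in>UNIV. mu$i * p$i * Kf r i)"
    unfolding mrf by (simp add: Kf_diff Kf_const right_diff_distrib sum_subtractf sum_distrib_right)
  finally have "c / 2 = (\<Sum>i\<in>UNIV. mu$i * p$i * Kf r i)" using mu_p by simp
  then have nu: "nu = 2 + 2 * c" by (simp add: nu_eq)
  have "(\<Sum>i\<in>UNIV. mu$i * (1 - p$i) * Kf m.r i) = c / 2"
    using r_pifail pifail_const[of c] by (simp add: mrf Kf_diff Kf_const pifail_def right_diff_distrib sum_subtractf)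
  then have mnu: "m.nu = nu" by (simp add: m.nu_eq nu)
  have d: "delta_val K p mu eta = 2 * (\<Sum>i\<in>UNIV. eta$i * r i) / nu"
    by (simp add: delta_val_def nu_def r_def inner_vec_def)
  have md: "delta_val K (1 - p) mu eta = 2 * (\<Sum>i\<in>UNIV. eta$i * m.r i) / nu"
    using mnu by (simp add: delta_val_def m.nu_def m.r_def inner_vec_def)
  have "(\<Sum>i\<in>UNIV. eta$i * m.r i) = c - (\<Sum>i\<in>UNIV. eta$i * r i)"
    using eta by (simp add: mrf algebra_simps sum_subtractf prob_vector_def flip: sum_distrib_right sum_distrib_left)
  then have "delta_val K p mu eta + delta_val K (1 - p) mu eta = 2 * c / nu"
    unfolding d md by (simp add: diff_divide_distrib right_diff_distrib)
  also have "\<dots> < 1" using nu_pos nu by (simp add: field_simps)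
  finally show ?thesis .
qed

section \<open>Right steps before a given number of left steps\<close>

context cookie_chain
begin

text \<open>\<open>T a b h i\<close>: expectation of \<open>h\<close> of the cookie state after the \<open>a\<close>-th left step, on the event
  that exactly \<open>b\<close> right steps precede it, for a cookie stack in initial state \<open>i\<close>.\<close>
fun T :: "nat \<Rightarrow> nat \<Rightarrow> ('s \<Rightarrow> real) \<Rightarrow> 's \<Rightarrow> real" where
  "T 0 0 h = h"
| "T 0 (Suc b) h = (\<lambda>i. 0)"
| "T (Suc a) 0 h = (\<lambda>i. (1 - p$i) * Kf (T a 0 h) i)"
| "T (Suc a) (Suc b) h = (\<lambda>i. (1 - p$i) * Kf (T a (Suc b) h) i + p$i * Kf (T (Suc a) b h) i)"

definition ph :: "nat \<Rightarrow> nat \<Rightarrow> 's \<Rightarrow> real" where "ph a b = T a b (\<lambda>_. 1)"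

lemma T_mono: "(\<And>j. f j \<le> g j) \<Longrightarrow> T a b f i \<le> T a b g i"
  by (induction a b f arbitrary: i rule: T.induct)
     (auto intro!: add_mono mult_left_mono Kf_mono simp: p_pos p_less less_imp_le)

lemma T_cmult: "T a b (\<lambda>j. c * f j) i = c * T a b f i"
proof (induction a b f arbitrary: i rule: T.induct)
  case (3 a h)
  have "T a 0 (\<lambda>j. c * h j) = (\<lambda>i. c * T a 0 h i)" using 3 by auto
  then show ?case by (simp add: Kf_cmult)
next
  case (4 a b h)
  have "T a (Suc b) (\<lambda>j. c * h j) = (\<lambda>i. c * T a (Suc b) h i)"
    "T (Suc a) b (\<lambda>j. c * h j) = (\<lambda>i. c * T (Suc a) b h i)" using 4 by blast+
  then show ?case by (simp add: Kf_cmult algebra_simps)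
qed auto

lemma T_const: "T a b (\<lambda>_. c) i = ph a b i * c"
  using T_cmult[of a b c "\<lambda>_. 1" i] by (simp add: ph_def)

lemma ph_nonneg: "ph a b i \<ge> 0"
  using T_mono[of "\<lambda>_. 0" "\<lambda>_. 1" a b i] T_const[of a b 0 i] by (simp add: ph_def)

lemma ph_0: "ph 0 b i = (if b = 0 then 1 else 0)"
  by (cases b) (auto simp: ph_def)

lemma Kf_pos: "(\<And>j. f j > 0) \<Longrightarrow> Kf f i > 0"
proof -
  assume f: "\<And>j. f j > 0"
  obtain j where "K$i$j > 0" using K_row[of i] K_nonneg[of i] by (metis less_le sum.neutral zero_neq_one)
  then show "Kf f i > 0" unfolding Kf_def using f K_nonneg
    by (intro sum_UNIV_pos[of _ j]) (auto intro: mult_nonneg_nonneg less_imp_le)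
qed

lemma ph_m0_pos: "ph a 0 i > 0"
  unfolding ph_def by (induction a arbitrary: i) (auto intro!: mult_pos_pos Kf_pos simp: p_less)

lemma ph_1_pos: "ph 1 b i > 0"
proof (induction b arbitrary: i)
  case 0 show ?case by (rule ph_m0_pos)
next
  case (Suc b)
  have "Kf (T (Suc 0) b (\<lambda>_. 1)) i > 0" using Suc by (intro Kf_pos) (simp add: ph_def)
  then show ?case using p_pos[of i] by (simp add: ph_def Kf_const)
qed

text \<open>Here \<open>a\<close> left steps are still outstanding and \<open>b\<close> right steps
  have already been made, whereas the second argument of \<open>T\<close> counts right steps to
  come. A left coin lowers \<open>a\<close>, a right coin raises \<open>b\<close>.\<close>

definition superharmonic :: "(nat \<Rightarrow> nat \<Rightarrow> 's \<Rightarrow> real) \<Rightarrow> bool" where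
  "superharmonic W \<longleftrightarrow> (\<forall>a b i. (1 - p$i) * Kf (W a b) i + p$i * Kf (W (Suc a) (Suc b)) i \<le> W (Suc a) b i)"

definition harmonic :: "(nat \<Rightarrow> nat \<Rightarrow> 's \<Rightarrow> real) \<Rightarrow> bool" where
  "harmonic W \<longleftrightarrow> (\<forall>a b i. (1 - p$i) * Kf (W a b) i + p$i * Kf (W (Suc a) (Suc b)) i = W (Suc a) b i)"

lemma harm_imp_super: "harmonic W \<Longrightarrow> superharmonic W"
  by (auto simp: harmonic_def superharmonic_def)

lemma harm_const: "harmonic (\<lambda>a b i. c)"
  by (auto simp: harmonic_def Kf_const algebra_simps)

lemma harm_cmult: "harmonic W \<Longrightarrow> harmonic (\<lambda>a b i. c * W a b i)"
proof -
  assume *: "harmonic W"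
  show ?thesis unfolding harmonic_def
  proof (intro allI)
    fix a b i
    have "c * ((1 - p$i) * Kf (W a b) i + p$i * Kf (W (Suc a) (Suc b)) i) = c * W (Suc a) b i"
      using * by (simp add: harmonic_def)
    then show "(1 - p$i) * Kf (\<lambda>i. c * W a b i) i + p$i * Kf (\<lambda>i. c * W (Suc a) (Suc b) i) i = c * W (Suc a) b i"
      by (simp only: Kf_cmult) (simp add: algebra_simps)
  qed
qed

lemma super_cmult: "superharmonic W \<Longrightarrow> c \<ge> 0 \<Longrightarrow> superharmonic (\<lambda>a b i. c * W a b i)"
proof -
  assume *: "superharmonic W" "c \<ge> 0"
  show ?thesis unfolding superharmonic_def
  proof (intro allI)
    fix a b i
    have "c * ((1 - p$i) * Kf (W a b) i + p$i * Kf (W (Suc a) (Suc b)) i) \<le> c * W (Suc a) b i"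
      using * by (intro mult_left_mono) (simp_all add: superharmonic_def)
    then show "(1 - p$i) * Kf (\<lambda>i. c * W a b i) i + p$i * Kf (\<lambda>i. c * W (Suc a) (Suc b) i) i \<le> c * W (Suc a) b i"
      by (simp only: Kf_cmult) (simp add: algebra_simps)
  qed
qed

lemma super_add: "superharmonic V \<Longrightarrow> superharmonic W \<Longrightarrow> superharmonic (\<lambda>a b i. V a b i + W a b i)"
  unfolding superharmonic_def Kf_add
proof (intro allI)
  fix a b i
  assume "\<forall>a b i. (1 - p$i) * Kf (V a b) i + p$i * Kf (V (Suc a) (Suc b)) i \<le> V (Suc a) b i"
    "\<forall>a b i. (1 - p$i) * Kf (W a b) i + p$i * Kf (W (Suc a) (Suc b)) i \<le> W (Suc a) b i"
  from add_mono[OF this[rule_format, of i a b]]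
  show "(1 - p$i) * (Kf (V a b) i + Kf (W a b) i)
     + p$i * (Kf (V (Suc a) (Suc b)) i + Kf (W (Suc a) (Suc b)) i) \<le> V (Suc a) b i + W (Suc a) b i"
    by (simp add: algebra_simps)
qed

lemma Kf_sum: "Kf (\<lambda>i. \<Sum>x\<in>X. f x i) i = (\<Sum>x\<in>X. Kf (f x) i)"
  unfolding Kf_def sum_distrib_left by (rule sum.swap)

text \<open>Conditioning on the first coin: after a left coin the window of admissible totals is
  kept, after a right coin it starts one later and is one shorter.\<close>

lemma sum_T_Suc:
  "(\<Sum>b<Suc n. T (Suc a) b (H (b0 + b)) i) =
     (1 - p$i) * Kf (\<lambda>i. \<Sum>b<Suc n. T a b (H (b0 + b)) i) i
     + p$i * Kf (\<lambda>i. \<Sum>b<n. T (Suc a) b (H (Suc b0 + b)) i) i"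
  unfolding sum.lessThan_Suc_shift Kf_add Kf_sum
  by (simp add: sum.distrib sum_distrib_left distrib_left)

text \<open>Discrete optional stopping, with the process also stopped on reaching \<open>N\<close>
  right steps. The value of \<open>W\<close> at that barrier is nonnegative and is dropped.\<close>

lemma sum_T_le_super:
  assumes W: "superharmonic W" and pos: "\<And>a i. a \<le> m \<Longrightarrow> W a N i \<ge> 0"
  shows "a \<le> m \<Longrightarrow> b0 + n = N \<Longrightarrow> (\<Sum>b<n. T a b (W 0 (b0 + b)) i) \<le> W a b0 i"
proof (induction a arbitrary: n b0 i)
  case 0
  show ?case
  proof (cases n)
    case (Suc n')
    show ?thesis unfolding Suc sum.lessThan_Suc_shift by simp
  qed (use pos[of 0] 0 in auto)
next
  case (Suc a)
  note IHa = Suc.IH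
  \<comment> \<open>The recursion of \<open>T\<close> lowers either \<open>a\<close> or the window
    length, hence the nested induction.\<close>
  show ?case using Suc.prems(2)
  proof (induction n arbitrary: b0 i)
    case 0
    then show ?case using pos[of "Suc a"] Suc.prems by simp
  next
    case (Suc n)
    have "(\<Sum>b<Suc n. T (Suc a) b (W 0 (b0 + b)) i)
      \<le> (1 - p$i) * Kf (W a b0) i + p$i * Kf (W (Suc a) (Suc b0)) i"
      unfolding sum_T_Suc
      using p_pos[of i] p_less[of i] \<open>Suc a \<le> m\<close> Suc.prems
      by (intro add_mono mult_left_mono Kf_mono Suc.IH IHa) auto
    also have "\<dots> \<le> W (Suc a) b0 i" using W by (simp add: superharmonic_def)
    finally show ?case .
  qed
qed

lemma ph_super:
  assumes W: "superharmonic W" and pos: "\<And>a b i. a \<le> m \<Longrightarrow> b \<ge> N \<Longrightarrow> W a b i \<ge> 0"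
    and f: "\<And>b j. f b \<le> W 0 b j" and f0: "\<And>b. f b \<ge> 0"
  shows "summable (\<lambda>b. ph m b i * f b) \<and> (\<Sum>b. ph m b i * f b) \<le> W m 0 i"
proof -
  have *: "(\<Sum>b<n. ph m b i * f b) \<le> W m 0 i" if "n \<ge> N" for n
  proof -
    have "(\<Sum>b<n. ph m b i * f b) \<le> (\<Sum>b<n. T m b (W 0 (0 + b)) i)"
      by (intro sum_mono) (auto simp: T_const[symmetric] intro!: T_mono f)
    also have "\<dots> \<le> W m 0 i"
      by (rule sum_T_le_super[OF W, of m n]) (use pos that in auto)
    finally show ?thesis .
  qed
  have **: "(\<Sum>b<n. ph m b i * f b) \<le> W m 0 i" for n
  proof -
    have "(\<Sum>b<n. ph m b i * f b) \<le> (\<Sum>b<max n N. ph m b i * f b)"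
      by (intro sum_mono2) (auto intro: mult_nonneg_nonneg ph_nonneg f0)
    also have "\<dots> \<le> W m 0 i" by (rule *) simp
    finally show ?thesis .
  qed
  have s: "summable (\<lambda>b. ph m b i * f b)"
  proof (rule bounded_imp_summable)
    show "(\<Sum>b\<le>n. ph m b i * f b) \<le> W m 0 i" for n
      using **[of "Suc n"] by (simp only: lessThan_Suc_atMost)
  qed (intro mult_nonneg_nonneg ph_nonneg f0)
  then show ?thesis using suminf_le_const[OF s] ** by blast
qed

section \<open>Martingales of the coin sum\<close>

definition r_bound :: real where "r_bound = 1 + Max (range (\<lambda>i. \<bar>r i\<bar>))"

lemma r_bound: "\<bar>r i\<bar> \<le> r_bound" "r_bound \<ge> 1"
proof -
  have "\<bar>r i\<bar> \<le> Max (range (\<lambda>i. \<bar>r i\<bar>))" for i by (rule Max_ge) auto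
  from this[of i] show "\<bar>r i\<bar> \<le> r_bound" "r_bound \<ge> 1" unfolding r_bound_def by linarith+
qed

text \<open>This is the Poisson equation for \<open>r\<close>: coin plus change of \<open>r\<close>
  has conditional mean 0, also after scaling and shifting.\<close>

lemma exp_increment:
  "(1 - p$i) * Kf (\<lambda>j. c + L * (-1 + r j - r i)) i + p$i * Kf (\<lambda>j. c + L * (1 + r j - r i)) i = c"
proof -
  have e: "Kf (\<lambda>j. c + L * (x + r j - r i)) i = c + L * (x - r i) + L * Kf r i" for x
  proof -
    have "Kf (\<lambda>j. c + L * (x + r j - r i)) i = Kf (\<lambda>j. (c + L * (x - r i)) + L * r j) i"
      by (rule arg_cong[of _ _ "\<lambda>f. Kf f i"]) (auto simp: algebra_simps)
    then show ?thesis by (simp only: Kf_add Kf_const Kf_cmult)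
  qed
  have Kr: "Kf r i = r i - 2 * p$i + 1" using r_poisson[of i] by simp
  show ?thesis unfolding e Kr by (simp add: algebra_simps)
qed

text \<open>With \<open>a\<close> of \<open>m\<close> left steps outstanding, \<open>m - a\<close>
  have been made, so this is right steps minus left steps plus \<open>r\<close> of the current
  state. At \<open>a = 0\<close> it equals \<open>b - m + r\<close>.\<close>

definition Y :: "nat \<Rightarrow> nat \<Rightarrow> nat \<Rightarrow> 's \<Rightarrow> real" where
  "Y m a b i = real a + real b - real m + r i"

lemma Y_step: "Y m a b j = Y m (Suc a) b i + (-1 + r j - r i)"
  "Y m (Suc a) (Suc b) j = Y m (Suc a) b i + (1 + r j - r i)"
  by (auto simp: Y_def)

lemma harm_Y: "harmonic (Y m)"
  unfolding harmonic_def
proof (intro allI)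
  fix a b i
  have "Y m a b = (\<lambda>j. Y m (Suc a) b i + 1 * (-1 + r j - r i))"
    "Y m (Suc a) (Suc b) = (\<lambda>j. Y m (Suc a) b i + 1 * (1 + r j - r i))"
    using Y_step by auto
  then show "(1 - p$i) * Kf (Y m a b) i + p$i * Kf (Y m (Suc a) (Suc b)) i = Y m (Suc a) b i"
    by (simp only: exp_increment)
qed

text \<open>Both terms on the right have \<open>mu\<close>-mean \<open>nu / 2\<close>: the first by
  \<open>mu_increment_var\<close>, the second since \<open>1 - p\<close> has mean 1/2. The corrector
  converts variance per coin into variance per left step.\<close>

lemma ex_variance_corrector:
  obtains g where "\<And>i. g i - Kf g i = increment_var i - nu * (1 - p$i)"
proof -
  have "(\<Sum>i\<in>UNIV. mu$i * (1 - p$i)) = 1 / 2"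
    by (simp add: right_diff_distrib sum_subtractf mu_sum mu_p)
  moreover have "mu$i * (increment_var i - nu * (1 - p$i)) = mu$i * increment_var i - nu * (mu$i * (1 - p$i))" for i
    by (simp add: algebra_simps)
  ultimately have 0: "(\<Sum>i\<in>UNIV. mu$i * (increment_var i - nu * (1 - p$i))) = 0"
    by (simp only: sum_subtractf sum_distrib_left[symmetric] mu_increment_var)
  show ?thesis
  proof (rule poisson_solvable[OF 0])
    fix x assume "\<And>i. x i - Kf x i = increment_var i - nu * (1 - p$i)"
    then show ?thesis by (rule that)
  qed
qed

text \<open>A coin adds \<open>increment_var i\<close> to the square on average and removes
  \<open>nu\<close> from \<open>nu * a\<close> with probability \<open>1 - p\<close>; the drift of
  \<open>g\<close> balances the difference.\<close>

lemma harm_Y2: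
  assumes g: "\<And>i. g i - Kf g i = increment_var i - nu * (1 - p$i)"
  shows "harmonic (\<lambda>a b i. (Y m a b i)\<^sup>2 + nu * real a + g i)"
  unfolding harmonic_def
proof (intro allI)
  fix a b i
  define y where "y = Y m (Suc a) b i"
  have Y1: "Y m a b j = y + (-1 + r j - r i)" and Y2: "Y m (Suc a) (Suc b) j = y + (1 + r j - r i)" for j
    unfolding y_def by (rule Y_step)+
  have e: "Kf (\<lambda>j. (y + (x + r j - r i))\<^sup>2 + c + g j) i
     = Kf (\<lambda>j. (y\<^sup>2 + c) + (2 * y) * (x + r j - r i)) i + Kf (\<lambda>j. (x + r j - r i)\<^sup>2) i + Kf g i" for x c
    unfolding Kf_add[symmetric]
    by (rule arg_cong[of _ _ "\<lambda>f. Kf f i"]) (auto simp: power2_eq_square algebra_simps)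
  have i: "Kf (\<lambda>j. c + L * (x + r j - r i)) i = c + Kf (\<lambda>j. L * (x + r j - r i)) i" for c L x
    by (simp only: Kf_add Kf_const)
  have "(1 - p$i) * Kf (\<lambda>i. (Y m a b i)\<^sup>2 + nu * real a + g i) i
      + p$i * Kf (\<lambda>i. (Y m (Suc a) (Suc b) i)\<^sup>2 + nu * real (Suc a) + g i) i
    = ((1 - p$i) * Kf (\<lambda>j. 0 + (2 * y) * (-1 + r j - r i)) i + p$i * Kf (\<lambda>j. 0 + (2 * y) * (1 + r j - r i)) i)
      + y\<^sup>2 + nu * real (Suc a) - nu * (1 - p$i) + increment_var i + Kf g i"
    unfolding Y1 Y2 e i[of "y\<^sup>2 + _"] increment_var_def by (simp add: algebra_simps)
  also have "\<dots> = y\<^sup>2 + nu * real (Suc a) + g i"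
    unfolding exp_increment using g[of i] by simp
  finally show "(1 - p$i) * Kf (\<lambda>i. (Y m a b i)\<^sup>2 + nu * real a + g i) i
      + p$i * Kf (\<lambda>i. (Y m (Suc a) (Suc b) i)\<^sup>2 + nu * real (Suc a) + g i) i
    = (Y m (Suc a) b i)\<^sup>2 + nu * real (Suc a) + g i" by (simp only: y_def)
qed

lemma quartic_increment:
  fixes y d B :: real
  assumes "\<bar>d\<bar> \<le> B" "B \<ge> 0"
  shows "(y + d)^4 \<le> y^4 + 4 * y^3 * d + (6 * B\<^sup>2 + 2 * B^3 + B^4) * (y\<^sup>2 + 1)"
proof -
  have d2: "d\<^sup>2 \<le> B\<^sup>2" using assms by (simp add: abs_le_square_iff[symmetric])
  have d3: "\<bar>d\<bar>^3 \<le> B^3" using assms by (intro power_mono) auto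
  have d4: "d^4 \<le> B^4" using power_mono[OF assms(1), of 4] by simp
  have "y * d^3 \<le> \<bar>y\<bar> * \<bar>d\<bar>^3" by (metis abs_ge_self abs_mult power_abs)
  also have "\<dots> \<le> \<bar>y\<bar> * B^3" using d3 by (intro mult_left_mono) auto
  also have "\<dots> \<le> ((y\<^sup>2 + 1) / 2) * B^3"
    using assms(2) sum_squares_ge_zero[of "\<bar>y\<bar> - 1" 0]
    by (intro mult_right_mono) (auto simp: power2_eq_square algebra_simps abs_mult_self_eq)
  finally have 3: "4 * (y * d^3) \<le> 2 * B^3 * (y\<^sup>2 + 1)" by (simp add: algebra_simps)
  have 2: "6 * (y\<^sup>2 * d\<^sup>2) \<le> 6 * B\<^sup>2 * (y\<^sup>2 + 1)"
  proof -
    have "y\<^sup>2 * d\<^sup>2 \<le> (y\<^sup>2 + 1) * B\<^sup>2" using d2 by (intro mult_mono) auto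
    then show ?thesis by (simp add: algebra_simps)
  qed
  have 4: "d^4 \<le> B^4 * (y\<^sup>2 + 1)"
  proof -
    have "B^4 * 1 \<le> B^4 * (y\<^sup>2 + 1)" using assms(2) by (intro mult_left_mono) auto
    with d4 show ?thesis by simp
  qed
  have "(y + d)^4 = y^4 + 4 * y^3 * d + 6 * (y\<^sup>2 * d\<^sup>2) + 4 * (y * d^3) + d^4"
    by (simp add: power4_eq_xxxx power2_eq_square power3_eq_cube algebra_simps)
  with 2 3 4 show ?thesis by (simp add: algebra_simps)
qed

text \<open>The fourth power gains at most order \<open>y^2 + 1\<close> per coin. Each coin is left
  with probability at least \<open>eps\<close> and then lowers \<open>a\<close>, so the loss of
  \<open>a * Y^2\<close> pays for \<open>y^2\<close>, and the loss of \<open>a^2\<close> pays for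
  what remains, which is linear in \<open>a\<close>. At the start the value is of order
  \<open>m^2\<close>.\<close>

lemma ex_quartic_super:
  obtains C1 C2 where "C1 \<ge> 0" "C2 \<ge> 0"
    "\<And>m. superharmonic (\<lambda>a b i. (Y m a b i)^4 + C1 * (real a * (Y m a b i)\<^sup>2) + C2 * (real a)\<^sup>2)"
proof -
  define B where "B = 1 + 2 * r_bound"
  define c where "c = 6 * B\<^sup>2 + 2 * B^3 + B^4"
  define eps where "eps = Min (range (\<lambda>i. 1 - p$i))"
  \<comment> \<open>\<open>C1\<close> is chosen so that half of \<open>eps * C1 * y^2\<close>
    offsets \<open>c * y^2\<close>, and \<open>C2\<close> so that \<open>eps * C2 * A\<close>
    offsets \<open>c + C1 * B^2\<close> together with \<open>C1 * A * B^2\<close>, where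
    \<open>A \<ge> 1\<close>.\<close>
  define C1 where "C1 = 2 * c / eps"
  define C2 where "C2 = (c + 2 * C1 * B\<^sup>2) / eps"
  have B0: "B \<ge> 0" using r_bound(2) by (simp add: B_def)
  have c0: "c \<ge> 0" using B0 by (simp add: c_def)
  have eps: "eps \<le> 1 - p$i" for i unfolding eps_def by (rule Min_le) auto
  have eps0: "eps > 0" unfolding eps_def by (subst Min_gr_iff) (auto simp: p_less)
  have C1: "C1 \<ge> 0" "eps * C1 = 2 * c" using c0 eps0 by (auto simp: C1_def)
  have C2: "C2 \<ge> 0" "eps * C2 = c + 2 * C1 * B\<^sup>2" using c0 eps0 C1 by (auto simp: C2_def)
  have dB: "\<bar>x + r j - r i\<bar> \<le> B" if "\<bar>x\<bar> = 1" for x i j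
    using r_bound(1)[of i] r_bound(1)[of j] that unfolding B_def by linarith
  have "superharmonic (\<lambda>a b i. (Y m a b i)^4 + C1 * (real a * (Y m a b i)\<^sup>2) + C2 * (real a)\<^sup>2)" for m
    unfolding superharmonic_def
  proof (intro allI)
    fix a b i
    define y where "y = Y m (Suc a) b i"
    have Y1: "Y m a b j = y + (-1 + r j - r i)" and Y2: "Y m (Suc a) (Suc b) j = y + (1 + r j - r i)" for j
      unfolding y_def by (rule Y_step)+
    define A where "A = real a + 1"
    have A: "A \<ge> 1" by (simp add: A_def)
    define L where "L = 4 * y^3 + 2 * C1 * A * y"
    define Q where "Q = y^4 + c * (y\<^sup>2 + 1) + C1 * A * (y\<^sup>2 + B\<^sup>2) + C2 * A\<^sup>2"
    have succ: "(y + d)^4 + C1 * (A * (y + d)\<^sup>2) + C2 * A\<^sup>2 \<le> Q + L * d" if d: "\<bar>d\<bar> \<le> B" for d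
    proof -
      have d2: "d\<^sup>2 \<le> B\<^sup>2" using d B0 by (simp add: abs_le_square_iff[symmetric])
      have "(C1 * A) * (y + d)\<^sup>2 \<le> (C1 * A) * (y\<^sup>2 + 2 * y * d + B\<^sup>2)"
        using C1 A d2 by (intro mult_left_mono) (auto simp: power2_sum)
      with quartic_increment[OF d B0, of y] show ?thesis
        unfolding Q_def L_def c_def[symmetric] by (simp add: algebra_simps)
    qed
    have fail: "(y + d)^4 + C1 * (real a * (y + d)\<^sup>2) + C2 * (real a)\<^sup>2
        \<le> (Q + C1 * B\<^sup>2 - C1 * y\<^sup>2 / 2 - C2 * A) + L * d" if d: "\<bar>d\<bar> \<le> B" for d
    proof -
      have d2: "d\<^sup>2 \<le> B\<^sup>2" using d B0 by (simp add: abs_le_square_iff[symmetric])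
      have "0 \<le> (y / 2 + d)\<^sup>2 * 2" by simp
      also have "\<dots> = (y + d)\<^sup>2 - y\<^sup>2 / 2 + d\<^sup>2" by (simp add: power2_eq_square algebra_simps)
      finally have "y\<^sup>2 / 2 - B\<^sup>2 \<le> (y + d)\<^sup>2" using d2 by linarith
      then have "C1 * (y\<^sup>2 / 2 - B\<^sup>2) \<le> C1 * (y + d)\<^sup>2" using C1 by (intro mult_left_mono) auto
      moreover have "C2 * (real a)\<^sup>2 \<le> C2 * (A\<^sup>2 - A)"
        using C2 by (intro mult_left_mono) (auto simp: A_def power2_eq_square algebra_simps)
      moreover have "C1 * (real a * (y + d)\<^sup>2) = C1 * (A * (y + d)\<^sup>2) - C1 * (y + d)\<^sup>2"
        by (simp add: A_def algebra_simps)
      ultimately show ?thesis using succ[OF d] by (simp add: algebra_simps)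
    qed
    let ?q = "1 - p$i"
    have q: "0 \<le> ?q" "?q \<le> 1" "eps \<le> ?q" using p_pos[of i] p_less[of i] eps[of i] by auto
    let ?Z = "Q + C1 * B\<^sup>2 - C1 * y\<^sup>2 / 2 - C2 * A"
    have K1: "Kf (\<lambda>j. (y + (-1 + r j - r i))^4 + C1 * (real a * (y + (-1 + r j - r i))\<^sup>2) + C2 * (real a)\<^sup>2) i
      \<le> Kf (\<lambda>j. ?Z + L * (-1 + r j - r i)) i"
      by (intro Kf_mono fail dB) simp
    have K2: "Kf (\<lambda>j. (y + (1 + r j - r i))^4 + C1 * (real (Suc a) * (y + (1 + r j - r i))\<^sup>2) + C2 * (real (Suc a))\<^sup>2) i
      \<le> Kf (\<lambda>j. Q + L * (1 + r j - r i)) i"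
    proof (intro Kf_mono)
      fix j
      have "real (Suc a) = A" by (simp add: A_def)
      then show "(y + (1 + r j - r i))^4 + C1 * (real (Suc a) * (y + (1 + r j - r i))\<^sup>2) + C2 * (real (Suc a))\<^sup>2
        \<le> Q + L * (1 + r j - r i)" using succ[OF dB, of 1 j i] by simp
    qed
    have "?q * Kf (\<lambda>i. (Y m a b i)^4 + C1 * (real a * (Y m a b i)\<^sup>2) + C2 * (real a)\<^sup>2) i
      + p$i * Kf (\<lambda>i. (Y m (Suc a) (Suc b) i)^4 + C1 * (real (Suc a) * (Y m (Suc a) (Suc b) i)\<^sup>2) + C2 * (real (Suc a))\<^sup>2) i
      \<le> ?q * Kf (\<lambda>j. ?Z + L * (-1 + r j - r i)) i + p$i * Kf (\<lambda>j. Q + L * (1 + r j - r i)) i"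
      unfolding Y1 Y2
      using p_pos[of i] p_less[of i]
      by (intro add_mono mult_left_mono K1 K2) auto
    also have "\<dots> = (?q * Kf (\<lambda>j. 0 + L * (-1 + r j - r i)) i + p$i * Kf (\<lambda>j. 0 + L * (1 + r j - r i)) i)
        + Q + ?q * (C1 * B\<^sup>2 - C1 * y\<^sup>2 / 2 - C2 * A)"
      unfolding Kf_add Kf_const by (simp add: algebra_simps)
    also have "\<dots> = Q + ?q * (C1 * B\<^sup>2) - ?q * (C1 * y\<^sup>2 / 2 + C2 * A)"
      unfolding exp_increment by (simp add: algebra_simps)
    also have "\<dots> \<le> Q + C1 * B\<^sup>2 - eps * (C1 * y\<^sup>2 / 2 + C2 * A)"
    proof -
      have "?q * (C1 * B\<^sup>2) \<le> 1 * (C1 * B\<^sup>2)" using q C1 by (intro mult_right_mono) auto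
      moreover have "eps * (C1 * y\<^sup>2 / 2 + C2 * A) \<le> ?q * (C1 * y\<^sup>2 / 2 + C2 * A)"
        using q C1 C2 A by (intro mult_right_mono) auto
      ultimately show ?thesis by simp
    qed
    also have "eps * (C1 * y\<^sup>2 / 2 + C2 * A) = (eps * C1) * y\<^sup>2 / 2 + (eps * C2) * A"
      by (simp add: algebra_simps)
    also have "\<dots> = c * y\<^sup>2 + (c + 2 * C1 * B\<^sup>2) * A" unfolding C1(2) C2(2) by simp
    also have "Q + C1 * B\<^sup>2 - \<dots> \<le> y^4 + C1 * (real (Suc a) * y\<^sup>2) + C2 * (real (Suc a))\<^sup>2"
    proof -
      have "(c + C1 * B\<^sup>2) * 1 \<le> (c + C1 * B\<^sup>2) * A"
        using c0 C1 A by (intro mult_left_mono) auto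
      then show ?thesis unfolding Q_def by (simp add: A_def algebra_simps)
    qed
    finally show "?q * Kf (\<lambda>i. (Y m a b i)^4 + C1 * (real a * (Y m a b i)\<^sup>2) + C2 * (real a)\<^sup>2) i
      + p$i * Kf (\<lambda>i. (Y m (Suc a) (Suc b) i)^4 + C1 * (real (Suc a) * (Y m (Suc a) (Suc b) i)\<^sup>2) + C2 * (real (Suc a))\<^sup>2) i
      \<le> (Y m (Suc a) b i)^4 + C1 * (real (Suc a) * (Y m (Suc a) b i)\<^sup>2) + C2 * (real (Suc a))\<^sup>2"
      by (simp add: y_def)
  qed
  with C1(1) C2(1) show ?thesis by (rule that)
qed

section \<open>The cookie chain observed at left steps\<close>

lemma Kf_max_principle:
  assumes "\<And>i. x i \<le> p$i * Kf x i + (1 - p$i) * c"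
  shows "x i \<le> c"
proof -
  obtain k where k: "\<And>j. x j \<le> x k"
    using Max_in[of "range x"] Max_ge[of "range x"]
    by (metis UNIV_not_empty finite finite_imageI image_iff image_is_empty rangeI)
  have "Kf x k \<le> x k" using Kf_mono[of x "\<lambda>_. x k" k] k by (simp add: Kf_const)
  then have "p$k * Kf x k \<le> p$k * x k" using p_pos[of k] by simp
  with assms[of k] have "(1 - p$k) * x k \<le> (1 - p$k) * c" by (simp add: algebra_simps)
  then have "x k \<le> c" using p_less[of k] by simp
  with k[of i] show ?thesis by simp
qed

text \<open>\<open>after_left h i\<close> is the expectation of \<open>h\<close> of the cookie state after the first left step.\<close>
lemma ex_after_left: "\<exists>x. \<forall>i. x i = p$i * Kf x i + (1 - p$i) * Kf h i"
proof -
  define L :: "real^'s \<Rightarrow> real^'s" where "L x = (\<chi> i. x$i - p$i * Kf (($) x) i)" for x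
  have lin: "linear L"
  proof (rule linearI)
    fix x y :: "real^'s" and c :: real
    have "($) (x + y) = (\<lambda>i. x$i + y$i)" "($) (c *\<^sub>R x) = (\<lambda>i. c * x$i)" by auto
    then show "L (x + y) = L x + L y" "L (c *\<^sub>R x) = c *\<^sub>R L x"
      by (auto simp: L_def vec_eq_iff Kf_add Kf_cmult algebra_simps)
  qed
  \<comment> \<open>The maximum principle with \<open>c = 0\<close>, applied to \<open>x\<close> and
    \<open>- x\<close>, leaves only the zero vector in the kernel; in finite dimension this gives
    solvability.\<close>
  moreover have "inj L"
  proof (rule linear_injective_0[OF lin, THEN iffD2], intro allI impI)
    fix x :: "real^'s" assume "L x = 0"
    then have e: "x$i = p$i * Kf (($) x) i" for i by (simp add: L_def vec_eq_iff)
    have "x$i \<le> 0" for i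
    proof (rule Kf_max_principle)
      show "x$i \<le> p$i * Kf (($) x) i + (1 - p$i) * 0" for i using e[of i] by simp
    qed
    moreover have "- x$i \<le> 0" for i
    proof (rule Kf_max_principle[of "\<lambda>i. - x$i"])
      fix i
      have "Kf (\<lambda>i. - x$i) i = - Kf (($) x) i" using Kf_cmult[of "-1" "($) x" i] by simp
      then show "- x$i \<le> p$i * Kf (\<lambda>i. - x$i) i + (1 - p$i) * 0" using e[of i] by simp
    qed
    ultimately show "x = 0" by (simp add: vec_eq_iff order_antisym)
  qed
  ultimately have "surj L" by (rule linear_inj_imp_surj)
  then obtain x where "L x = (\<chi> i. (1 - p$i) * Kf h i)" by (metis surjD)
  then have "x$i = p$i * Kf (($) x) i + (1 - p$i) * Kf h i" for i
    by (simp add: L_def vec_eq_iff algebra_simps)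
  then show ?thesis by blast
qed

definition after_left :: "('s \<Rightarrow> real) \<Rightarrow> 's \<Rightarrow> real" where
  "after_left h = (SOME x. \<forall>i. x i = p$i * Kf x i + (1 - p$i) * Kf h i)"

lemma after_left: "after_left h i = p$i * Kf (after_left h) i + (1 - p$i) * Kf h i"
  using someI_ex[OF ex_after_left[of h]] unfolding after_left_def by blast

lemma after_left_le:
  assumes h: "\<And>i. h i \<le> c + b * e i"
  shows "after_left h i \<le> c + b * after_left e i"
proof -
  have "after_left h i - b * after_left e i \<le> c"
  proof (rule Kf_max_principle[of "\<lambda>i. after_left h i - b * after_left e i"])
    fix i
    have "Kf h i \<le> c + b * Kf e i"
      using Kf_mono[of h "\<lambda>i. c + b * e i" i] h by (simp add: Kf_add Kf_cmult Kf_const)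
    then have "(1 - p$i) * Kf h i \<le> (1 - p$i) * (c + b * Kf e i)"
      using p_less[of i] by simp
    moreover have "b * after_left e i = b * (p$i * Kf (after_left e) i + (1 - p$i) * Kf e i)"
      using after_left[of e i] by (rule arg_cong)
    ultimately show "after_left h i - b * after_left e i \<le> p$i * Kf (\<lambda>i. after_left h i - b * after_left e i) i + (1 - p$i) * c"
      unfolding Kf_diff Kf_cmult using after_left[of h i] by (simp add: algebra_simps)
  qed
  then show ?thesis by simp
qed

lemma after_left_ge:
  assumes h: "\<And>i. c + b * e i \<le> h i"
  shows "c + b * after_left e i \<le> after_left h i"
proof -
  have "b * after_left e i - after_left h i \<le> - c"
  proof (rule Kf_max_principle[of "\<lambda>i. b * after_left e i - after_left h i"])
    fix i
    have "c + b * Kf e i \<le> Kf h i"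
      using Kf_mono[of "\<lambda>i. c + b * e i" h i] h by (simp add: Kf_add Kf_cmult Kf_const)
    then have "(1 - p$i) * (c + b * Kf e i) \<le> (1 - p$i) * Kf h i"
      using p_less[of i] by simp
    moreover have "b * after_left e i = b * (p$i * Kf (after_left e) i + (1 - p$i) * Kf e i)"
      using after_left[of e i] by (rule arg_cong)
    ultimately show "b * after_left e i - after_left h i \<le> p$i * Kf (\<lambda>i. b * after_left e i - after_left h i) i + (1 - p$i) * (- c)"
      unfolding Kf_diff Kf_cmult using after_left[of h i] by (simp add: algebra_simps)
  qed
  then show ?thesis by simp
qed

text \<open>A Doeblin minorisation. Along a path from \<open>i\<close> to an attracting state let
  all coins be right except the last one; this has positive probability and makes that state the one
  following the first left step.\<close>

lemma ex_after_left_indicator_pos: "\<exists>j0 eps. 0 < eps \<and> eps < 1 \<and> (\<forall>i. eps \<le> after_left (\<lambda>j. if j = j0 then 1 else 0) i)"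
proof -
  obtain j0 where j0: "\<And>i. (i, j0) \<in> (trans_rel K)\<^sup>+" using ex_attracting_state by blast
  let ?e = "\<lambda>j. if j = j0 then 1 else 0 :: real"
  have nn: "after_left ?e i \<ge> 0" for i using after_left_ge[of 0 0 ?e ?e i] by simp
  have le: "K$i$l * h l \<le> Kf h i" if "\<And>j. h j \<ge> 0" for h i l
    unfolding Kf_def by (rule member_le_sum[of l UNIV "\<lambda>j. K$i$j * h j"]) (use that K_nonneg in auto)
  have "after_left ?e i > 0" for i
    using j0[of i]
  proof (induction rule: converse_trancl_induct)
    case (base i)
    then have "0 < K$i$j0" by (simp add: trans_rel_def)
    also have "\<dots> \<le> Kf ?e i" using le[of ?e i j0] by simp
    finally have "0 < (1 - p$i) * Kf ?e i" using p_less[of i] by simp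
    moreover have "0 \<le> p$i * Kf (after_left ?e) i" using p_pos[of i] nn by (simp add: Kf_nonneg)
    ultimately show ?case by (subst after_left) linarith
  next
    case (step i l)
    then have "0 < K$i$l * after_left ?e l" by (simp add: trans_rel_def)
    also have "\<dots> \<le> Kf (after_left ?e) i" using le[of "after_left ?e" i l] nn by simp
    finally have "0 < p$i * Kf (after_left ?e) i" using p_pos[of i] by simp
    moreover have "0 \<le> (1 - p$i) * Kf ?e i" using p_less[of i] by (simp add: Kf_nonneg)
    ultimately show ?case by (subst after_left) linarith
  qed
  then have "Min (range (after_left ?e)) > 0" by (subst Min_gr_iff) auto
  then have "0 < min (1/2) (Min (range (after_left ?e)))" "min (1/2) (Min (range (after_left ?e))) < 1"
    "\<forall>i. min (1/2) (Min (range (after_left ?e))) \<le> after_left ?e i"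
    by (auto intro!: min.coboundedI2 Min_le)
  then show ?thesis by blast
qed

text \<open>The expectation of \<open>r\<close> at the cookie state following the
  \<open>a\<close>-th left step: the harmonic function with boundary values \<open>r\<close> at
  \<open>a = 0\<close>.\<close>

definition u :: "nat \<Rightarrow> 's \<Rightarrow> real" where "u a = (after_left ^^ a) r"

lemma u_0: "u 0 = r" and u_Suc: "u (Suc a) = after_left (u a)" by (simp_all add: u_def)

lemma harm_u: "harmonic (\<lambda>a b. u a)"
  unfolding harmonic_def using after_left by (simp add: u_Suc algebra_simps)

text \<open>\<open>2 * pifail\<close> is the stationary law of the cookie state observed after left
  steps, so averages under it are invariant under \<open>after_left\<close>.\<close>

lemma pifail_u: "pifail (u a) = 0"
proof (induction a)
  case (Suc a)
  have "(\<Sum>i\<in>UNIV. mu$i * u (Suc a) i) = (\<Sum>i\<in>UNIV. mu$i * (p$i * Kf (u (Suc a)) i + (1 - p$i) * Kf (u a) i))"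
    unfolding u_Suc by (subst after_left) simp
  also have "\<dots> = (\<Sum>i\<in>UNIV. mu$i * Kf (u (Suc a)) i) - pifail (u (Suc a)) + pifail (u a)"
    unfolding pifail_def by (simp add: algebra_simps sum.distrib sum_subtractf)
  finally show ?case using Suc by (simp add: mu_Kf)
qed (simp add: u_0 r_pifail)

lemma pifail_mono: "(\<And>i. f i \<le> g i) \<Longrightarrow> pifail f \<le> pifail g"
  unfolding pifail_def
  by (intro sum_mono mult_left_mono Kf_mono) (auto intro!: mult_nonneg_nonneg mu_nonneg simp: p_less less_imp_le)

text \<open>The minorisation shrinks an interval containing all values of \<open>u a\<close> by the
  factor \<open>1 - eps\<close> per left step; \<open>pifail_u\<close> places 0 inside that
  interval.\<close>

lemma u_exponential: "\<exists>lam R. 0 \<le> lam \<and> lam < 1 \<and> 0 \<le> R \<and> (\<forall>a i. \<bar>u a i\<bar> \<le> R * lam ^ a)"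
proof -
  obtain j0 eps where eps: "0 < eps" "eps < 1" and e: "\<And>i. eps \<le> after_left (\<lambda>j. if j = j0 then 1 else 0) i"
    using ex_after_left_indicator_pos by blast
  let ?e = "\<lambda>j. if j = j0 then 1 else 0 :: real"
  have "\<exists>lo hi. (\<forall>i. lo \<le> u a i \<and> u a i \<le> hi) \<and> hi - lo \<le> 2 * r_bound * (1 - eps) ^ a" for a
  proof (induction a)
    case 0
    show ?case
    proof (intro exI conjI allI)
      show "- r_bound \<le> u 0 i" "u 0 i \<le> r_bound" for i using r_bound(1)[of i] by (auto simp: u_0)
    qed simp
  next
    case (Suc a)
    then obtain lo hi where b: "\<And>i. lo \<le> u a i" "\<And>i. u a i \<le> hi" and d: "hi - lo \<le> 2 * r_bound * (1 - eps) ^ a"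
      by blast
    \<comment> \<open>The state \<open>j0\<close> carries weight at least \<open>eps\<close> from
      everywhere, so both endpoints move towards the value there.\<close>
    let ?h = "u a j0"
    show ?case
    proof (intro exI conjI allI)
      fix i
      have "u (Suc a) i \<le> hi + (?h - hi) * after_left ?e i"
        unfolding u_Suc by (rule after_left_le) (use b in auto)
      also have "\<dots> \<le> hi + (?h - hi) * eps"
        using b[of j0] e[of i] by (intro add_mono mult_left_mono_neg) auto
      finally show "u (Suc a) i \<le> hi + (?h - hi) * eps" .
      have "lo + (?h - lo) * eps \<le> lo + (?h - lo) * after_left ?e i"
        using b[of j0] e[of i] by (intro add_mono mult_left_mono) auto
      also have "\<dots> \<le> u (Suc a) i"
        unfolding u_Suc by (rule after_left_ge) (use b in auto)
      finally show "lo + (?h - lo) * eps \<le> u (Suc a) i" .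
      have "hi + (?h - hi) * eps - (lo + (?h - lo) * eps) = (1 - eps) * (hi - lo)"
        by (simp add: algebra_simps)
      also have "\<dots> \<le> (1 - eps) * (2 * r_bound * (1 - eps) ^ a)"
        using eps d by (intro mult_left_mono) auto
      finally show "hi + (?h - hi) * eps - (lo + (?h - lo) * eps) \<le> 2 * r_bound * (1 - eps) ^ Suc a"
        by (simp add: algebra_simps)
    qed
  qed
  then have "\<bar>u a i\<bar> \<le> 2 * r_bound * (1 - eps) ^ a" for a i
  proof -
    obtain lo hi where b: "\<And>i. lo \<le> u a i" "\<And>i. u a i \<le> hi" and d: "hi - lo \<le> 2 * r_bound * (1 - eps) ^ a"
      using \<open>\<And>a. \<exists>lo hi. (\<forall>i. lo \<le> u a i \<and> u a i \<le> hi) \<and> hi - lo \<le> 2 * r_bound * (1 - eps) ^ a\<close> by blast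
    have "lo / 2 \<le> 0" "0 \<le> hi / 2"
      using pifail_mono[of "\<lambda>_. lo" "u a"] pifail_mono[of "u a" "\<lambda>_. hi"] b
      by (auto simp: pifail_const pifail_u)
    with b[of i] d show ?thesis by simp
  qed
  then show ?thesis using eps r_bound(2)
    by (intro exI[of _ "1 - eps"] exI[of _ "2 * r_bound"]) auto
qed

text \<open>The exponential decay is traded for the scale \<open>1 / sqrt a\<close>, on which the
  other errors of the moment bound live.\<close>

lemma ex_u_sqrt_bound: "\<exists>C\<ge>0. \<forall>a\<ge>1. \<forall>i. \<bar>u a i\<bar> \<le> C / sqrt (real a)"
proof -
  obtain lam R where lam: "0 \<le> lam" "lam < 1" "0 \<le> R" and b: "\<And>a i. \<bar>u a i\<bar> \<le> R * lam ^ a"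
    using u_exponential by blast
  have "\<bar>u a i\<bar> \<le> (R / (1 - lam)) / sqrt (real a)" if a: "a \<ge> 1" for a i
  proof -
    have "sqrt (real a) \<le> real a" using a by (simp add: real_le_lsqrt self_le_power)
    then have "sqrt (real a) * lam ^ a \<le> real a * lam ^ a"
      using lam by (intro mult_right_mono) auto
    also have "\<dots> = (\<Sum>k<a. lam ^ a)" by simp
    also have "\<dots> \<le> (\<Sum>k<a. lam ^ k)" using lam by (intro sum_mono power_decreasing) auto
    also have "\<dots> = (1 - lam ^ a) / (1 - lam)" using lam by (simp add: sum_gp_strict)
    also have "\<dots> \<le> 1 / (1 - lam)" using lam by (intro divide_right_mono) auto
    finally have "lam ^ a \<le> 1 / (1 - lam) / sqrt (real a)"
      by (subst pos_le_divide_eq) (use a in \<open>auto simp: mult.commute\<close>)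
    then have "R * lam ^ a \<le> R * (1 / (1 - lam) / sqrt (real a))" using lam by (intro mult_left_mono)
    then show ?thesis using b[of a i] by simp
  qed
  moreover have "R / (1 - lam) \<ge> 0" using lam by simp
  ultimately show ?thesis by blast
qed

text \<open>Optional stopping for one combination \<open>W\<close> of the linear, quadratic and
  quartic functions, chosen to dominate \<open>f\<close> at \<open>a = 0\<close>. The main terms are
  the mean \<open>r i\<close> and the variance \<open>nu * m\<close>; replacing \<open>b - m\<close>
  by \<open>Y\<close>, which differs from it by \<open>r\<close> at the final state, costs only the
  bracket after \<open>C\<close>.\<close>

lemma ex_moment_bound:
  "\<exists>C\<ge>0. \<forall>m\<ge>1. \<forall>c0 c1 c2 c4 f i. c4 > 0 \<longrightarrow> (\<forall>b. 0 \<le> f b) \<longrightarrow>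
     (\<forall>b. f b \<le> c0 + c1 * (real b - real m) + c2 * (real b - real m)\<^sup>2 + c4 * (real b - real m)^4) \<longrightarrow>
     summable (\<lambda>b. ph m b i * f b) \<and>
     (\<Sum>b. ph m b i * f b) \<le> c0 + c1 * r i + c2 * (nu * real m)
        + C * (\<bar>c1\<bar> / sqrt (real m) + \<bar>c2\<bar> * sqrt (real m) + c4 * (real m)\<^sup>2)"
proof -
  obtain Cu where Cu: "Cu \<ge> 0" "\<And>a i. a \<ge> 1 \<Longrightarrow> \<bar>u a i\<bar> \<le> Cu / sqrt (real a)" using ex_u_sqrt_bound by blast
  obtain g where g: "\<And>i. g i - Kf g i = increment_var i - nu * (1 - p$i)" using ex_variance_corrector by blast
  obtain C1 C2 where C12: "C1 \<ge> 0" "C2 \<ge> 0"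
    and S: "\<And>m. superharmonic (\<lambda>a b i. (Y m a b i)^4 + C1 * (real a * (Y m a b i)\<^sup>2) + C2 * (real a)\<^sup>2)"
    using ex_quartic_super by blast
  define G where "G = Max (range (\<lambda>i. \<bar>g i\<bar>))"
  have G: "\<bar>g i\<bar> \<le> G" for i unfolding G_def by (rule Max_ge) auto
  have G0: "G \<ge> 0" using G[of undefined] by linarith
  obtain lam R where lam: "0 \<le> lam" "lam < 1" "0 \<le> R" and ub: "\<And>a i. \<bar>u a i\<bar> \<le> R * lam ^ a"
    using u_exponential by blast
  have uR: "\<bar>u a i\<bar> \<le> R" for a i
  proof -
    have "R * lam ^ a \<le> R * 1" using lam by (intro mult_left_mono power_le_one) auto
    with ub[of a i] show ?thesis by simp
  qed
  define B where "B = r_bound"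
  have B: "\<bar>r i\<bar> \<le> B" "B \<ge> 1" for i using r_bound by (auto simp: B_def)
  define c where "c = G + B\<^sup>2 + (G + B\<^sup>2 + B) + B * (B\<^sup>2 + nu + 2 * G)"
  define C where "C = Cu + c + 8 * (2 * B^4 + C1 * B\<^sup>2 + C2)"
  have c0: "c \<ge> 0" unfolding c_def using G0 B(2) nu_pos by (intro add_nonneg_nonneg mult_nonneg_nonneg) auto
  have d0: "8 * (2 * B^4 + C1 * B\<^sup>2 + C2) \<ge> 0"
    using C12 by (intro add_nonneg_nonneg mult_nonneg_nonneg) auto
  show ?thesis
  proof (intro exI[of _ C] conjI allI impI)
    show "C \<ge> 0" unfolding C_def using Cu(1) c0 d0 by linarith
    fix m :: nat and c0' c1 c2 c4 :: real and f :: "nat \<Rightarrow> real" and i :: 's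
    assume m: "1 \<le> m" and c4: "c4 > 0" and f0: "\<forall>b. 0 \<le> f b"
      and f: "\<forall>b. f b \<le> c0' + c1 * (real b - real m) + c2 * (real b - real m)\<^sup>2 + c4 * (real b - real m)^4"
    define s where "s = sqrt (real m)"
    have s: "s \<ge> 1" "s * s = real m" using m by (auto simp: s_def)
    define V2 where "V2 = (\<lambda>a b i. (Y m a b i)\<^sup>2 + nu * real a + g i)"
    define S4 where "S4 = (\<lambda>a b i. (Y m a b i)^4 + C1 * (real a * (Y m a b i)\<^sup>2) + C2 * (real a)\<^sup>2)"
    \<comment> \<open>\<open>(b - m)^2\<close> and \<open>Y^2\<close> differ by multiples of
      \<open>r^2\<close> and \<open>r * Y\<close>. The product is split at scale \<open>s\<close>
      into a constant of order \<open>s\<close> and a term of order \<open>Y^2 / s\<close>; the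
      former enters \<open>Q\<close>, the latter perturbs the coefficient \<open>k\<close> of
      \<open>V2\<close>.\<close>
    define Q where "Q = \<bar>c2\<bar> * (G + B\<^sup>2 + B * s + B / s * G)"
    define k where "k = c2 + \<bar>c2\<bar> * (B / s)"
    \<comment> \<open>\<open>Y - u\<close> equals \<open>b - m\<close> exactly at
      \<open>a = 0\<close>, since \<open>u 0 = r\<close>. The harmonic functions may carry
      coefficients of either sign; the superharmonic \<open>S4\<close> carries
      \<open>8 * c4 > 0\<close>, where 8 comes from
      \<open>(y - r)^4 \<le> 8 * (y^4 + r^4)\<close>.\<close>
    define W where "W = (\<lambda>a b i. (((c0' + Q + 8 * c4 * B^4) + c1 * Y m a b i) + (- c1) * u a i)
        + (k * V2 a b i + (8 * c4) * S4 a b i))"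
    have W: "superharmonic W" unfolding W_def
    proof (intro super_add)
      show "superharmonic (\<lambda>a b i. k * V2 a b i)" unfolding V2_def
        by (intro harm_imp_super harm_cmult harm_Y2 g)
      show "superharmonic (\<lambda>a b i. (8 * c4) * S4 a b i)" unfolding S4_def
        using c4 by (intro super_cmult S) auto
    qed (intro harm_imp_super harm_cmult harm_const harm_Y harm_u)+
    have S4Y: "S4 a b i \<ge> (Y m a b i)^4" for a b i
      using C12 by (simp add: S4_def)
    have fW: "f b \<le> W 0 b j" for b j
    proof -
      define y where "y = Y m 0 b j"
      define d where "d = real b - real m"
      have yd: "y = d + r j" by (simp add: y_def d_def Y_def)
      have rj: "\<bar>r j\<bar> \<le> B" "B \<ge> 1" by (rule B)+
      have rj2: "(r j)\<^sup>2 \<le> B\<^sup>2" using rj by (simp add: abs_le_square_iff[symmetric])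
      have ab: "\<bar>y\<bar> \<le> s / 2 + y\<^sup>2 / (2 * s)"
      proof -
        have "0 \<le> (\<bar>y\<bar> - s)\<^sup>2 / (2 * s)" using s by simp
        also have "\<dots> = y\<^sup>2 / (2 * s) - \<bar>y\<bar> + s / 2"
          using s by (simp add: power2_eq_square field_simps)
        finally show ?thesis by simp
      qed
      have y2: "y\<^sup>2 = V2 0 b j - g j" by (simp add: V2_def y_def)
      have "\<bar>d\<^sup>2 - y\<^sup>2\<bar> = \<bar>(r j)\<^sup>2 - 2 * r j * y\<bar>" by (simp add: yd power2_eq_square algebra_simps)
      also have "\<dots> \<le> (r j)\<^sup>2 + \<bar>2 * r j * y\<bar>" using zero_le_power2[of "r j"] by linarith
      also have "\<dots> \<le> B\<^sup>2 + 2 * (B * (s / 2 + y\<^sup>2 / (2 * s)))"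
      proof -
        have "\<bar>2 * r j * y\<bar> = 2 * (\<bar>r j\<bar> * \<bar>y\<bar>)" by (simp add: abs_mult)
        also have "\<dots> \<le> 2 * (B * (s / 2 + y\<^sup>2 / (2 * s)))"
          using rj ab by (intro mult_left_mono mult_mono) auto
        finally show ?thesis using rj2 by linarith
      qed
      also have "\<dots> = B\<^sup>2 + B * s + B / s * y\<^sup>2" using s by (simp add: field_simps)
      also have "\<dots> \<le> B\<^sup>2 + B * s + B / s * (V2 0 b j + G)"
        using y2 G[of j] rj s by (intro add_mono mult_left_mono) auto
      finally have d2: "\<bar>d\<^sup>2 - y\<^sup>2\<bar> \<le> B\<^sup>2 + B * s + B / s * (V2 0 b j + G)" .
      have "c2 * d\<^sup>2 = c2 * V2 0 b j + c2 * (d\<^sup>2 - y\<^sup>2) - c2 * g j" by (simp add: y2 algebra_simps)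
      also have "\<dots> \<le> c2 * V2 0 b j + \<bar>c2\<bar> * \<bar>d\<^sup>2 - y\<^sup>2\<bar> + \<bar>c2\<bar> * \<bar>g j\<bar>"
      proof -
        have "x * z \<le> \<bar>x\<bar> * \<bar>z\<bar>" "- (x * z) \<le> \<bar>x\<bar> * \<bar>z\<bar>" for x z :: real
          by (metis abs_ge_self abs_mult) (metis abs_ge_minus_self abs_mult)
        from add_mono[OF this(1)[of c2 "d\<^sup>2 - y\<^sup>2"] this(2)[of c2 "g j"]] show ?thesis by simp
      qed
      also have "\<dots> \<le> c2 * V2 0 b j + \<bar>c2\<bar> * (B\<^sup>2 + B * s + B / s * (V2 0 b j + G)) + \<bar>c2\<bar> * G"
        using d2 G[of j] by (intro add_mono order_refl mult_left_mono) auto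
      finally have q2: "c2 * d\<^sup>2 \<le> k * V2 0 b j + Q" by (simp add: k_def Q_def algebra_simps)
      have "d^4 \<le> 8 * (y^4 + (r j)^4)"
      proof -
        have sq: "(a - b)\<^sup>2 \<le> 2 * (a\<^sup>2 + b\<^sup>2)" "(a + b)\<^sup>2 \<le> 2 * (a\<^sup>2 + b\<^sup>2)" for a b :: real
          using zero_le_power2[of "a + b"] zero_le_power2[of "a - b"]
          by (simp_all add: power2_eq_square algebra_simps)
        have "(d\<^sup>2)\<^sup>2 \<le> (2 * (y\<^sup>2 + (r j)\<^sup>2))\<^sup>2"
          using sq(1)[of y "r j"] yd by (intro power_mono) auto
        also have "\<dots> = 4 * (y\<^sup>2 + (r j)\<^sup>2)\<^sup>2" by (simp only: power_mult_distrib) simp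
        also have "\<dots> \<le> 4 * (2 * ((y\<^sup>2)\<^sup>2 + ((r j)\<^sup>2)\<^sup>2))" using sq(2)[of "y\<^sup>2" "(r j)\<^sup>2"] by simp
        finally show ?thesis by (simp flip: power_mult)
      qed
      moreover have "(r j)^4 \<le> B^4" using power_mono[OF rj(1), of 4] by simp
      ultimately have "d^4 \<le> 8 * (S4 0 b j + B^4)" using S4Y[of 0 b j] by (simp add: y_def)
      then have "c4 * d^4 \<le> c4 * (8 * (S4 0 b j + B^4))" using c4 by (intro mult_left_mono) auto
      with q2 f[rule_format, of b] show ?thesis
        unfolding W_def d_def[symmetric] by (simp add: u_0 yd[unfolded y_def] algebra_simps)
    qed
    \<comment> \<open>While \<open>a \<le> m\<close>, the terms other than the quartic one have size
      at most \<open>kk * (1 + y^2)\<close>; for \<open>y \<ge> t\<close> the quartic term outweighs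
      them, so \<open>W\<close> is nonnegative there.\<close>
    define kk where "kk = \<bar>c0' + Q + 8 * c4 * B^4\<bar> + \<bar>c1\<bar> * (1 + R) + \<bar>k\<bar> * (1 + nu * real m + G)"
    define t where "t = kk / (4 * c4) + 1"
    have kk0: "kk \<ge> 0" unfolding kk_def using lam(3) G0 nu_pos by (intro add_nonneg_nonneg mult_nonneg_nonneg) auto
    have t1: "t \<ge> 1" using kk0 c4 by (simp add: t_def)
    have pos: "W a b i \<ge> 0" if a: "a \<le> m" and b: "b \<ge> m + nat \<lceil>B + t\<rceil>" for a b i
    proof -
      define y where "y = Y m a b i"
      have "B + t \<le> real (nat \<lceil>B + t\<rceil>)" by (rule real_nat_ceiling_ge)
      then have "real b - real m \<ge> B + t" using b by linarith
      then have "y \<ge> t" using B(1)[of i] unfolding y_def Y_def by linarith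
      then have y2: "y\<^sup>2 \<ge> t" using t1 by (smt (verit) mult_left_mono mult_cancel_left2 power2_eq_square)
      have y1: "\<bar>y\<bar> \<le> 1 + y\<^sup>2" using zero_le_power2[of "\<bar>y\<bar> - 1"] by (simp add: power2_diff)
      have l1: "- (\<bar>c1\<bar> * ((1 + R) * (1 + y\<^sup>2))) \<le> c1 * y + (- c1) * u a i"
      proof -
        have "\<bar>c1 * y + (- c1) * u a i\<bar> = \<bar>c1\<bar> * \<bar>y - u a i\<bar>" by (simp add: abs_mult[symmetric] algebra_simps)
        also have "\<dots> \<le> \<bar>c1\<bar> * ((1 + R) * (1 + y\<^sup>2))"
        proof (intro mult_left_mono)
          have "\<bar>y - u a i\<bar> \<le> (1 + y\<^sup>2) + R * 1" using y1 uR[of a i] by linarith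
          also have "\<dots> \<le> (1 + y\<^sup>2) + R * (1 + y\<^sup>2)" using lam by (intro add_mono mult_left_mono) auto
          finally show "\<bar>y - u a i\<bar> \<le> (1 + R) * (1 + y\<^sup>2)" by (simp add: algebra_simps)
        qed simp
        finally show ?thesis by linarith
      qed
      have l2: "- (\<bar>k\<bar> * ((1 + nu * real m + G) * (1 + y\<^sup>2))) \<le> k * V2 a b i"
      proof -
        have "\<bar>V2 a b i\<bar> \<le> y\<^sup>2 + nu * real a + G"
          using G[of i] nu_pos by (auto simp: V2_def y_def abs_le_iff intro!: add_mono)
             (smt (verit) mult_nonneg_nonneg of_nat_0_le_iff zero_le_power2)
        also have "\<dots> \<le> y\<^sup>2 + (nu * real m + G) * 1" using a nu_pos by simp
        also have "\<dots> \<le> (1 + y\<^sup>2) + (nu * real m + G) * (1 + y\<^sup>2)"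
          using nu_pos G0 by (intro add_mono mult_left_mono) auto
        finally have "\<bar>V2 a b i\<bar> \<le> (1 + nu * real m + G) * (1 + y\<^sup>2)" by (simp add: algebra_simps)
        then have "\<bar>k\<bar> * \<bar>V2 a b i\<bar> \<le> \<bar>k\<bar> * ((1 + nu * real m + G) * (1 + y\<^sup>2))" by (rule mult_left_mono) simp
        then have "\<bar>k * V2 a b i\<bar> \<le> \<bar>k\<bar> * ((1 + nu * real m + G) * (1 + y\<^sup>2))" by (simp only: abs_mult)
        then show ?thesis by linarith
      qed
      have l0: "- (\<bar>c0' + Q + 8 * c4 * B^4\<bar> * (1 + y\<^sup>2)) \<le> c0' + Q + 8 * c4 * B^4"
      proof -
        have "\<bar>c0' + Q + 8 * c4 * B^4\<bar> * 1 \<le> \<bar>c0' + Q + 8 * c4 * B^4\<bar> * (1 + y\<^sup>2)"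
          by (intro mult_left_mono) auto
        then have "\<bar>c0' + Q + 8 * c4 * B^4\<bar> \<le> \<bar>c0' + Q + 8 * c4 * B^4\<bar> * (1 + y\<^sup>2)" by (simp only: mult_1_right)
        then show ?thesis by (meson abs_le_D2 minus_le_iff)
      qed
      have "kk * (1 + y\<^sup>2) \<le> kk * (2 * y\<^sup>2)" using kk0 y2 t1 by (intro mult_left_mono) auto
      also have "\<dots> \<le> (8 * c4 * t) * y\<^sup>2"
      proof -
        have "2 * kk \<le> 8 * c4 * t" using c4 by (simp add: t_def field_simps)
        from mult_right_mono[OF this, of "y\<^sup>2"] show ?thesis by simp
      qed
      also have "\<dots> \<le> (8 * c4) * y^4"
      proof -
        have "t * y\<^sup>2 \<le> y\<^sup>2 * y\<^sup>2" using y2 by (intro mult_right_mono) auto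
        also have "\<dots> = y^4" by (simp add: power4_eq_xxxx power2_eq_square)
        finally show ?thesis using c4 by simp
      qed
      also have "\<dots> \<le> (8 * c4) * S4 a b i" using c4 S4Y[of a b i] by (simp add: y_def)
      finally have "kk * (1 + y\<^sup>2) \<le> (8 * c4) * S4 a b i" .
      with l0 l1 l2 show ?thesis unfolding W_def y_def[symmetric] kk_def
        by (simp add: algebra_simps)
    qed
    have main: "summable (\<lambda>b. ph m b i * f b) \<and> (\<Sum>b. ph m b i * f b) \<le> W m 0 i"
      by (rule ph_super[OF W pos]) (use fW f0 in auto)
    \<comment> \<open>At the start \<open>Y\<close> equals \<open>r i\<close>, so all its powers are
      bounded; growth in \<open>m\<close> comes from \<open>nu * m\<close> in \<open>V2\<close>,
      from \<open>S4\<close>, and from the scale \<open>s\<close>.\<close>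
    have "W m 0 i \<le> c0' + c1 * r i + c2 * (nu * real m)
        + C * (\<bar>c1\<bar> / s + \<bar>c2\<bar> * s + c4 * (real m)\<^sup>2)"
    proof -
      have Y0: "Y m m 0 i = r i" by (simp add: Y_def)
      have r2: "(r i)\<^sup>2 \<le> B\<^sup>2" using B(1)[of i] B(2) by (simp add: abs_le_square_iff[symmetric])
      have r4: "(r i)^4 \<le> B^4" using power_mono[OF B(1)[of i], of 4] by simp
      have m2: "real m \<le> (real m)\<^sup>2" "1 \<le> (real m)\<^sup>2" using m by (auto intro: self_le_power one_le_power)
      have t1: "- c1 * u m i \<le> Cu * (\<bar>c1\<bar> / s)"
      proof -
        have "- c1 * u m i \<le> \<bar>c1\<bar> * \<bar>u m i\<bar>" by (metis abs_ge_self abs_minus_cancel abs_mult)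
        also have "\<dots> \<le> \<bar>c1\<bar> * (Cu / s)" using Cu(2)[OF m] by (intro mult_left_mono) (auto simp: s_def)
        finally show ?thesis by (simp add: mult.commute)
      qed
      have V: "V2 m 0 i = nu * real m + ((r i)\<^sup>2 + g i)" by (simp add: V2_def Y0)
      have v: "\<bar>(r i)\<^sup>2 + g i\<bar> \<le> B\<^sup>2 + G" using r2 G[of i] by (smt (verit) zero_le_power2)
      have t2: "k * V2 m 0 i + Q \<le> c2 * (nu * real m) + c * (\<bar>c2\<bar> * s)"
      proof -
        have "c2 * ((r i)\<^sup>2 + g i) \<le> \<bar>c2\<bar> * (B\<^sup>2 + G)"
          using v by (metis abs_ge_self abs_ge_zero abs_mult mult_left_mono order_trans)
        also have "\<dots> \<le> \<bar>c2\<bar> * ((B\<^sup>2 + G) * s)"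
        proof (intro mult_left_mono)
          have "(B\<^sup>2 + G) * 1 \<le> (B\<^sup>2 + G) * s" using s G0 by (intro mult_left_mono) auto
          then show "B\<^sup>2 + G \<le> (B\<^sup>2 + G) * s" by simp
        qed simp
        finally have a1: "c2 * ((r i)\<^sup>2 + g i) \<le> \<bar>c2\<bar> * ((B\<^sup>2 + G) * s)" .
        have "B / s * V2 m 0 i = B * nu * s + B / s * ((r i)\<^sup>2 + g i)"
          unfolding V s(2)[symmetric] using s by (simp add: field_simps)
        also have "\<dots> \<le> B * nu * s + B * s * (B\<^sup>2 + G)"
        proof -
          have "B / s * ((r i)\<^sup>2 + g i) \<le> B / s * (B\<^sup>2 + G)" using v s B(2) by (intro mult_left_mono) auto
          also have "\<dots> \<le> B * s * (B\<^sup>2 + G)"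
          proof (intro mult_right_mono)
            have "B / s \<le> B / 1" using s B(2) by (intro divide_left_mono) auto
            also have "\<dots> \<le> B * s" using s B(2) by simp
            finally show "B / s \<le> B * s" .
          qed (use G0 in auto)
          finally show ?thesis by simp
        qed
        finally have a2: "B / s * V2 m 0 i \<le> B * nu * s + B * s * (B\<^sup>2 + G)" .
        have a3: "G + B\<^sup>2 + B * s + B / s * G \<le> (G + B\<^sup>2 + B) * s + B * G * s"
        proof -
          have "(G + B\<^sup>2) * 1 \<le> (G + B\<^sup>2) * s" using s G0 by (intro mult_left_mono) auto
          moreover have "B * G / s \<le> B * G / 1" using s B(2) G0 by (intro divide_left_mono) auto
          moreover have "(B * G) * 1 \<le> (B * G) * s" using s G0 B(2) by (intro mult_left_mono) auto
          ultimately show ?thesis by (simp add: algebra_simps)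
        qed
        have "k * V2 m 0 i + Q = c2 * (nu * real m) + c2 * ((r i)\<^sup>2 + g i)
            + \<bar>c2\<bar> * (B / s * V2 m 0 i + (G + B\<^sup>2 + B * s + B / s * G))"
          by (simp add: k_def Q_def V algebra_simps)
        also have "\<dots> \<le> c2 * (nu * real m) + \<bar>c2\<bar> * ((B\<^sup>2 + G) * s)
            + \<bar>c2\<bar> * ((B * nu * s + B * s * (B\<^sup>2 + G)) + ((G + B\<^sup>2 + B) * s + B * G * s))"
        proof -
          have "\<bar>c2\<bar> * (B / s * V2 m 0 i + (G + B\<^sup>2 + B * s + B / s * G))
            \<le> \<bar>c2\<bar> * ((B * nu * s + B * s * (B\<^sup>2 + G)) + ((G + B\<^sup>2 + B) * s + B * G * s))"
            by (rule mult_left_mono[OF add_mono[OF a2 a3]]) simp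
          with a1 show ?thesis by linarith
        qed
        also have "\<dots> = c2 * (nu * real m) + c * (\<bar>c2\<bar> * s)"
          by (simp add: c_def algebra_simps power2_eq_square)
        finally show ?thesis .
      qed
      have t4: "8 * c4 * B^4 + (8 * c4) * S4 m 0 i \<le> 8 * (2 * B^4 + C1 * B\<^sup>2 + C2) * (c4 * (real m)\<^sup>2)"
      proof -
        have "B^4 \<le> B^4 * (real m)\<^sup>2" using m2 by (simp add: mult_le_cancel_left1)
        moreover have "S4 m 0 i \<le> B^4 * (real m)\<^sup>2 + C1 * (B\<^sup>2 * (real m)\<^sup>2) + C2 * (real m)\<^sup>2"
        proof -
          have "(r i)^4 \<le> B^4 * (real m)\<^sup>2" using r4 calculation by linarith
          moreover have "real m * (r i)\<^sup>2 \<le> (real m)\<^sup>2 * B\<^sup>2" using m2 r2 by (intro mult_mono) auto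
          then have "C1 * (real m * (r i)\<^sup>2) \<le> C1 * ((real m)\<^sup>2 * B\<^sup>2)" using C12 by (intro mult_left_mono)
          ultimately show ?thesis by (simp add: S4_def Y0 mult_ac)
        qed
        ultimately have "B^4 + S4 m 0 i \<le> (2 * B^4 + C1 * B\<^sup>2 + C2) * (real m)\<^sup>2" by (simp add: algebra_simps)
        then have "(8 * c4) * (B^4 + S4 m 0 i) \<le> (8 * c4) * ((2 * B^4 + C1 * B\<^sup>2 + C2) * (real m)\<^sup>2)"
          using c4 by (intro mult_left_mono) auto
        then show ?thesis by (simp add: algebra_simps)
      qed
      have n: "\<bar>c1\<bar> / s \<ge> 0" "\<bar>c2\<bar> * s \<ge> 0" "c4 * (real m)\<^sup>2 \<ge> 0" using s c4 by auto
      have "W m 0 i = c0' + c1 * r i + (- c1 * u m i) + (k * V2 m 0 i + Q) + (8 * c4 * B^4 + (8 * c4) * S4 m 0 i)"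
        by (simp add: W_def Y0)
      also have "\<dots> \<le> c0' + c1 * r i + Cu * (\<bar>c1\<bar> / s) + (c2 * (nu * real m) + c * (\<bar>c2\<bar> * s))
          + 8 * (2 * B^4 + C1 * B\<^sup>2 + C2) * (c4 * (real m)\<^sup>2)"
        using t1 t2 t4 by linarith
      also have "\<dots> \<le> c0' + c1 * r i + C * (\<bar>c1\<bar> / s) + (c2 * (nu * real m) + C * (\<bar>c2\<bar> * s))
          + C * (c4 * (real m)\<^sup>2)"
        unfolding C_def using n c0 d0 Cu(1) by (intro add_mono mult_right_mono order_refl) linarith+
      finally show ?thesis by (simp add: algebra_simps)
    qed
    with main show "summable (\<lambda>b. ph m b i * f b)" "(\<Sum>b. ph m b i * f b) \<le> c0' + c1 * r i + c2 * (nu * real m)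
        + C * (\<bar>c1\<bar> / sqrt (real m) + \<bar>c2\<bar> * sqrt (real m) + c4 * (real m)\<^sup>2)"
      by (auto simp: s_def)
  qed
qed

text \<open>The constant 1 shows that the mass is at most 1. For the converse,
  \<open>e * S4 - 1\<close> is superharmonic, dominates -1 at the end and is nonnegative on a far
  barrier; letting \<open>e\<close> tend to 0 excludes a loss of mass to infinitely many right
  steps.\<close>

lemma ph_sums: "(\<lambda>b. ph m b i) sums 1"
proof -
  have s: "summable (\<lambda>b. ph m b i * 1)" and le: "(\<Sum>b. ph m b i * 1) \<le> 1"
    using ph_super[of "\<lambda>a b i. 1" m 0 "\<lambda>_. 1" i] harm_imp_super[OF harm_const] by auto
  obtain C1 C2 where C12: "C1 \<ge> 0" "C2 \<ge> 0"
    and S: "\<And>m. superharmonic (\<lambda>a b i. (Y m a b i)^4 + C1 * (real a * (Y m a b i)\<^sup>2) + C2 * (real a)\<^sup>2)"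
    using ex_quartic_super by blast
  define S4 where "S4 = (\<lambda>a b i. (Y m a b i)^4 + C1 * (real a * (Y m a b i)\<^sup>2) + C2 * (real a)\<^sup>2)"
  have S0: "S4 a b i \<ge> 0" for a b i using C12 by (simp add: S4_def)
  have "1 - e * S4 m 0 i \<le> (\<Sum>b. ph m b i)" if e: "e > 0" for e
  proof -
    define W where "W = (\<lambda>a b i. e * S4 a b i + (-1))"
    have W: "superharmonic W" unfolding W_def S4_def using e
      by (intro super_add super_cmult S harm_imp_super[OF harm_const]) auto
    define N where "N = m + nat \<lceil>r_bound + 1 + 1 / e\<rceil>"
    have pos: "W a N i \<ge> 0" if a: "a \<le> m" for a i
    proof -
      define y where "y = Y m a N i"
      have "r_bound + 1 + 1 / e \<le> real (nat \<lceil>r_bound + 1 + 1 / e\<rceil>)" by (rule real_nat_ceiling_ge)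
      then have y: "y \<ge> 1 + 1 / e" using r_bound(1)[of i] unfolding y_def Y_def N_def by simp
      moreover have y1: "y \<ge> 1" using y e by (smt (verit) divide_pos_pos)
      ultimately have "1 / e \<le> y^4" using self_le_power[of y 4] by linarith
      also have "\<dots> \<le> S4 a N i" using C12 by (simp add: S4_def y_def)
      finally show ?thesis using e by (simp add: W_def field_simps)
    qed
    have "- (\<Sum>b. ph m b i) \<le> - (\<Sum>b<N. ph m b i)"
      using s by (simp add: sum_le_suminf ph_nonneg)
    also have "\<dots> = (\<Sum>b<N. T m b (\<lambda>_. -1) i)" by (simp add: T_const sum_negf)
    also have "\<dots> \<le> (\<Sum>b<N. T m b (W 0 (0 + b)) i)"
      using S0 e by (intro sum_mono T_mono) (simp add: W_def)
    also have "\<dots> \<le> W m 0 i" by (rule sum_T_le_super[OF W pos]) auto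
    finally show ?thesis by (simp add: W_def)
  qed
  then have "1 \<le> (\<Sum>b. ph m b i) + e" if "e > 0" for e
  proof -
    have "e / (1 + S4 m 0 i) > 0" using S0[of m 0 i] that by simp
    from \<open>\<And>e. e > 0 \<Longrightarrow> 1 - e * S4 m 0 i \<le> (\<Sum>b. ph m b i)\<close>[OF this]
    have "1 \<le> (\<Sum>b. ph m b i) + e * (S4 m 0 i / (1 + S4 m 0 i))" by simp
    moreover have "e * (S4 m 0 i / (1 + S4 m 0 i)) \<le> e * 1"
      using S0[of m 0 i] that by (intro mult_left_mono) auto
    ultimately show ?thesis by simp
  qed
  then have "1 \<le> (\<Sum>b. ph m b i)" by (rule field_le_epsilon)
  with le s show ?thesis by (simp add: sums_iff)
qed

end

section \<open>Lyapunov functions\<close>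

lemma powr_taylor:
  fixes y \<beta> :: real
  assumes "y > 0" "n > 0"
  shows "\<exists>t>0. min 1 y \<le> t \<and> y powr \<beta> = (\<Sum>k<n. (\<Prod>i<k. \<beta> - real i) / fact k * (y - 1) ^ k)
           + (\<Prod>i<n. \<beta> - real i) * t powr (\<beta> - real n) / fact n * (y - 1) ^ n"
proof (cases "y = 1")
  case True
  have "(\<Sum>k<n. (\<Prod>i<k. \<beta> - real i) / fact k * 0 ^ k) = 1"
    using assms(2) by (subst sum.remove[of _ 0]) (auto simp: power_0_left intro!: sum.neutral)
  then show ?thesis using True assms by (intro exI[of _ 1]) auto
next
  case False
  define diff where "diff k z = (\<Prod>i<k. \<beta> - real i) * z powr (\<beta> - real k)" for k and z :: real
  have "\<exists>t. (if y < 1 then y < t \<and> t < 1 else 1 < t \<and> t < y) \<and>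
      y powr \<beta> = (\<Sum>k<n. diff k 1 / fact k * (y - 1) ^ k) + diff n t / fact n * (y - 1) ^ n"
  proof (rule Taylor[of n diff "\<lambda>z. z powr \<beta>" "min y 1" "max y 1"])
    show "\<forall>m t. m < n \<and> min y 1 \<le> t \<and> t \<le> max y 1 \<longrightarrow> DERIV (diff m) t :> diff (Suc m) t"
    proof (intro allI impI)
      fix m t assume "m < n \<and> min y 1 \<le> t \<and> t \<le> max y 1"
      then have t: "t > 0" using assms by auto
      have "DERIV (diff m) t :> (\<Prod>i<m. \<beta> - real i) * ((\<beta> - real m) * t powr (\<beta> - real m - 1))"
        unfolding diff_def using t by (intro DERIV_cmult has_real_derivative_powr)
      then show "DERIV (diff m) t :> diff (Suc m) t"
        by (simp add: diff_def algebra_simps)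
    qed
  qed (use assms False in \<open>auto simp: diff_def\<close>)
  then obtain t where "if y < 1 then y < t \<and> t < 1 else 1 < t \<and> t < y"
    "y powr \<beta> = (\<Sum>k<n. diff k 1 / fact k * (y - 1) ^ k) + diff n t / fact n * (y - 1) ^ n" by blast
  then show ?thesis using assms by (intro exI[of _ t]) (auto simp: diff_def split: if_splits)
qed

text \<open>The fourth derivative of the power is positive, so the cubic Taylor polynomial is a
  lower bound on all of \<open>x > -1\<close>.\<close>

lemma powr_neg_quarter_ge:
  fixes x :: real
  assumes "x > -1"
  shows "(1 + x) powr (-1/4) \<ge> 1 - x / 4 + 5 / 32 * x\<^sup>2 - 15 / 128 * x^3"
proof -
  obtain t where "t > 0" "(1 + x) powr (-1/4) = (\<Sum>k<4. (\<Prod>i<k. -1/4 - real i) / fact k * (1 + x - 1) ^ k)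
           + (\<Prod>i<4. -1/4 - real i) * t powr (-1/4 - real 4) / fact 4 * (1 + x - 1) ^ 4"
    using powr_taylor[of "1 + x" 4 "-1/4"] assms by auto
  moreover have "(\<Prod>i<4. -1/4 - real i) = 585 / 256" by (simp add: eval_nat_numeral)
  then have "(\<Prod>i<4. -1/4 - real i) * t powr (-1/4 - real 4) / fact 4 * x ^ 4 \<ge> 0" by simp
  ultimately show ?thesis
    by (simp add: eval_nat_numeral field_simps)
qed

text \<open>The fourth derivative of \<open>ln\<close> is negative, so the cubic Taylor polynomial
  is an upper bound all the way to the singularity.\<close>

lemma ln_add_one_le_cubic:
  fixes x :: real
  assumes "x > -1"
  shows "ln (1 + x) \<le> x - x\<^sup>2 / 2 + x^3 / 3"
proof (cases "x = 0")
  case False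
  define diff where "diff = (\<lambda>k z. [ln z, 1 / z, - 1 / z^2, 2 / z^3, - 6 / z^4] ! k :: real)"
  have "\<exists>t. (if 1 + x < 1 then 1 + x < t \<and> t < 1 else 1 < t \<and> t < 1 + x) \<and>
      ln (1 + x) = (\<Sum>k<4. diff k 1 / fact k * (1 + x - 1) ^ k) + diff 4 t / fact 4 * (1 + x - 1) ^ 4"
  proof (rule Taylor[of 4 diff ln "min (1 + x) 1" "max (1 + x) 1"])
    show "\<forall>m t. m < 4 \<and> min (1 + x) 1 \<le> t \<and> t \<le> max (1 + x) 1 \<longrightarrow> DERIV (diff m) t :> diff (Suc m) t"
    proof (intro allI impI)
      fix m :: nat and t assume mt: "m < 4 \<and> min (1 + x) 1 \<le> t \<and> t \<le> max (1 + x) 1"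
      then have t: "t > 0" using assms by auto
      from mt consider "m = 0" | "m = 1" | "m = 2" | "m = 3" by linarith
      then show "DERIV (diff m) t :> diff (Suc m) t"
      proof cases
        case 1 then show ?thesis using t unfolding diff_def by (auto intro!: derivative_eq_intros)
      next
        case 2 then show ?thesis using t unfolding diff_def
          by (auto intro!: derivative_eq_intros simp: power2_eq_square field_simps)
      next
        case 3 then show ?thesis using t unfolding diff_def
          by (auto intro!: derivative_eq_intros simp: eval_nat_numeral field_simps)
      next
        case 4 then show ?thesis using t unfolding diff_def
          by (auto intro!: derivative_eq_intros simp: eval_nat_numeral field_simps)
      qed
    qed
  qed (use assms False in \<open>auto simp: diff_def\<close>)
  then obtain t where "ln (1 + x) = (\<Sum>k<4. diff k 1 / fact k * (1 + x - 1) ^ k) + diff 4 t / fact 4 * (1 + x - 1) ^ 4"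
    by blast
  moreover have "diff 4 t / fact 4 * x ^ 4 \<le> 0"
    by (simp add: diff_def)
  ultimately show ?thesis by (simp add: diff_def eval_nat_numeral)
qed simp

text \<open>The power is singular at -1, so \<open>x\<close> is kept above -1/2. There the remainder
  is at most \<open>2 * 16 / 6 * \<bar>x\<bar>^3\<close>, which the factor 6 rounds up.\<close>

lemma powr_neg_le_quadratic:
  fixes x \<alpha> :: real
  assumes x: "x \<ge> -1/2" and a: "0 < \<alpha>" "\<alpha> \<le> 1/2"
  shows "(1 + x) powr (-\<alpha>) \<le> 1 - \<alpha> * x + \<alpha> * (\<alpha> + 1) / 2 * x\<^sup>2 + 6 * \<bar>x\<bar>^3"
proof -
  obtain t where t: "t > 0" "min 1 (1 + x) \<le> t" and eq: "(1 + x) powr (-\<alpha>) = (\<Sum>k<3. (\<Prod>i<k. -\<alpha> - real i) / fact k * (1 + x - 1) ^ k)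
           + (\<Prod>i<3. -\<alpha> - real i) * t powr (-\<alpha> - real 3) / fact 3 * (1 + x - 1) ^ 3"
    using powr_taylor[of "1 + x" 3 "-\<alpha>"] x by auto
  have t2: "t \<ge> 1/2" using t x by auto
  have "t powr (-\<alpha> - 3) \<le> (1/2) powr (-\<alpha> - 3)" using t2 a by (intro powr_mono2') auto
  also have "\<dots> \<le> (1/2) powr (-4)" using a by (intro powr_mono') auto
  also have "(1/2::real) powr (-4) = 16" by (simp add: powr_minus powr_numeral power_divide)
  finally have tp: "t powr (-\<alpha> - 3) \<le> 16" .
  define P where "P = \<alpha> * (\<alpha> + 1) * (\<alpha> + 2)"
  have P0: "P \<ge> 0" using a by (simp add: P_def)
  have "P \<le> (1/2) * (1/2 + 1) * (1/2 + 2)" unfolding P_def using a by (intro mult_mono add_mono) auto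
  then have P: "P \<le> 2" by simp
  have "- (P * t powr (-\<alpha> - 3) / 6 * x^3) \<le> P * t powr (-\<alpha> - 3) / 6 * \<bar>x\<bar>^3"
  proof -
    have "- (x^3) \<le> \<bar>x\<bar>^3" by (metis abs_ge_minus_self power_abs)
    then have "P * t powr (-\<alpha> - 3) / 6 * (- (x^3)) \<le> P * t powr (-\<alpha> - 3) / 6 * \<bar>x\<bar>^3"
      using P0 by (intro mult_left_mono) auto
    then show ?thesis by simp
  qed
  also have "\<dots> \<le> 6 * \<bar>x\<bar>^3"
  proof (intro mult_right_mono)
    have "P * t powr (-\<alpha> - 3) \<le> 2 * 16" using P P0 tp by (intro mult_mono) auto
    then show "P * t powr (-\<alpha> - 3) / 6 \<le> 6" by simp
  qed simp
  finally have "- (P * t powr (-\<alpha> - 3) / 6 * x^3) \<le> 6 * \<bar>x\<bar>^3" .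
  moreover have "(1 + x) powr (-\<alpha>) = 1 - \<alpha> * x + \<alpha> * (\<alpha> + 1) / 2 * x\<^sup>2 - P * t powr (-\<alpha> - 3) / 6 * x^3"
    unfolding eq P_def by (simp add: eval_nat_numeral field_simps)
  ultimately show ?thesis by linarith
qed

text \<open>The moment bound provides second and fourth powers; this splits a cubic remainder
  between them with a free scale \<open>s\<close>.\<close>

lemma abs_cube_le:
  fixes x s :: real
  assumes "s > 0"
  shows "\<bar>x\<bar>^3 \<le> (s * x\<^sup>2 + x^4 / s) / 2"
proof -
  have "0 \<le> (s * x\<^sup>2) * (1 - \<bar>x\<bar> / s)\<^sup>2" using assms by simp
  also have "\<dots> = s * x\<^sup>2 + x^4 / s - 2 * \<bar>x\<bar>^3"
    using assms by (simp add: power2_eq_square power3_eq_cube power4_eq_xxxx field_simps)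
  finally show ?thesis by simp
qed

locale cookie_stack = cookie_chain K p mu for K :: "real^'s::finite^'s" and p mu +
  fixes eta :: "real^'s"
  assumes eta: "prob_vector eta"
begin

lemma eta_nonneg: "eta$i \<ge> 0" and eta_sum: "(\<Sum>i\<in>UNIV. eta$i) = 1"
  using eta by (auto simp: prob_vector_def)

lemma ex_eta_pos: "\<exists>i. eta$i > 0"
  using eta_sum eta_nonneg by (metis less_le sum.neutral zero_neq_one)

text \<open>Law of the number of right steps before the \<open>m\<close>-th left step at a fresh site.\<close>
definition phi :: "nat \<Rightarrow> nat \<Rightarrow> real" where
  "phi m b = (\<Sum>i\<in>UNIV. eta$i * ph m b i)"

definition rho :: real where "rho = (\<Sum>i\<in>UNIV. eta$i * r i)"

lemma delta_eq: "delta_val K p mu eta = 2 * rho / nu"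
  by (simp add: delta_val_def nu_def r_def rho_def inner_vec_def)

lemma phi_nonneg: "phi m b \<ge> 0"
  unfolding phi_def by (intro sum_nonneg mult_nonneg_nonneg eta_nonneg ph_nonneg)

lemma phi_pos:
  assumes "\<And>i. ph m b i > 0" shows "phi m b > 0"
proof -
  obtain i where "eta$i > 0" using ex_eta_pos by blast
  then show ?thesis unfolding phi_def using assms eta_nonneg
    by (intro sum_UNIV_pos[of _ i]) (auto intro: mult_nonneg_nonneg less_imp_le)
qed

lemma phi_m0_pos: "phi m 0 > 0" and phi_1_pos: "phi 1 b > 0"
  by (rule phi_pos ph_m0_pos ph_1_pos)+

lemma phi_0: "phi 0 b = (if b = 0 then 1 else 0)"
  by (simp add: phi_def ph_0 eta_sum)

lemma phi_sums: "phi m sums 1"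
proof -
  have "(\<lambda>b. \<Sum>i\<in>UNIV. eta$i * ph m b i) sums (\<Sum>i\<in>UNIV. eta$i * 1)"
    by (intro sums_sum sums_mult ph_sums)
  then show ?thesis by (simp add: phi_def[abs_def] eta_sum)
qed

lemma ex_phi_moment_bound:
  "\<exists>C\<ge>0. \<forall>m\<ge>1. \<forall>c0 c1 c2 c4 f. c4 > 0 \<longrightarrow> (\<forall>b. 0 \<le> f b) \<longrightarrow>
     (\<forall>b. f b \<le> c0 + c1 * (real b - real m) + c2 * (real b - real m)\<^sup>2 + c4 * (real b - real m)^4) \<longrightarrow>
     summable (\<lambda>b. phi m b * f b) \<and>
     (\<Sum>b. phi m b * f b) \<le> c0 + c1 * rho + c2 * (nu * real m)
        + C * (\<bar>c1\<bar> / sqrt (real m) + \<bar>c2\<bar> * sqrt (real m) + c4 * (real m)\<^sup>2)"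
proof -
  obtain C where C: "C \<ge> 0" and CB: "\<forall>m\<ge>1. \<forall>c0 c1 c2 c4 f i. c4 > 0 \<longrightarrow> (\<forall>b. 0 \<le> f b) \<longrightarrow>
     (\<forall>b. f b \<le> c0 + c1 * (real b - real m) + c2 * (real b - real m)\<^sup>2 + c4 * (real b - real m)^4) \<longrightarrow>
     summable (\<lambda>b. ph m b i * f b) \<and>
     (\<Sum>b. ph m b i * f b) \<le> c0 + c1 * r i + c2 * (nu * real m)
        + C * (\<bar>c1\<bar> / sqrt (real m) + \<bar>c2\<bar> * sqrt (real m) + c4 * (real m)\<^sup>2)"
    using ex_moment_bound by blast
  show ?thesis
  proof (intro exI[of _ C] conjI[OF C] allI impI)
    fix m :: nat and c0 c1 c2 c4 :: real and f :: "nat \<Rightarrow> real"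
    let ?Z = "c2 * (nu * real m) + C * (\<bar>c1\<bar> / sqrt (real m) + \<bar>c2\<bar> * sqrt (real m) + c4 * (real m)\<^sup>2)"
    assume "1 \<le> m" "c4 > 0" and prm: "\<forall>b. 0 \<le> f b"
     "\<forall>b. f b \<le> c0 + c1 * (real b - real m) + c2 * (real b - real m)\<^sup>2 + c4 * (real b - real m)^4"
    have *: "summable (\<lambda>b. ph m b i * f b) \<and>
     (\<Sum>b. ph m b i * f b) \<le> c0 + c1 * r i + c2 * (nu * real m)
        + C * (\<bar>c1\<bar> / sqrt (real m) + \<bar>c2\<bar> * sqrt (real m) + c4 * (real m)\<^sup>2)" for i
      using CB \<open>1 \<le> m\<close> \<open>c4 > 0\<close> prm by blast
    have e: "phi m b * f b = (\<Sum>i\<in>UNIV. eta$i * (ph m b i * f b))" for b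
      by (simp add: phi_def sum_distrib_right mult.assoc)
    have "(\<lambda>b. phi m b * f b) sums (\<Sum>i\<in>UNIV. eta$i * (\<Sum>b. ph m b i * f b))"
      unfolding e by (intro sums_sum sums_mult summable_sums) (use * in auto)
    moreover have "(\<Sum>i\<in>UNIV. eta$i * (\<Sum>b. ph m b i * f b)) \<le> (\<Sum>i\<in>UNIV. eta$i * (c0 + c1 * r i + ?Z))"
      using * by (intro sum_mono mult_left_mono eta_nonneg) (simp add: add.assoc)
    moreover have "(\<Sum>i\<in>UNIV. eta$i * (c0 + c1 * r i + ?Z)) = (\<Sum>i\<in>UNIV. eta$i) * (c0 + ?Z) + c1 * rho"
      unfolding rho_def sum_distrib_left sum_distrib_right sum.distrib[symmetric]
      by (intro sum.cong) (auto simp: algebra_simps)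
    ultimately show "summable (\<lambda>b. phi m b * f b) \<and> (\<Sum>b. phi m b * f b) \<le> c0 + c1 * rho + c2 * (nu * real m)
        + C * (\<bar>c1\<bar> / sqrt (real m) + \<bar>c2\<bar> * sqrt (real m) + c4 * (real m)\<^sup>2)"
      by (simp_all add: sums_iff eta_sum)
  qed
qed

text \<open>The correction \<open>(m + 1) powr (-1/4)\<close> makes the logarithm strictly superharmonic even at the
  critical value \<open>rho = nu / 2\<close>.\<close>
definition lyap :: "nat \<Rightarrow> real" where
  "lyap m = ln (real m + 1) - (real m + 1) powr (-1/4) + 1"

lemma lyap_nonneg: "lyap m \<ge> 0"
proof -
  have "(real m + 1) powr (-1/4) \<le> (real m + 1) powr 0" by (intro powr_mono) auto
  moreover have "ln (real m + 1) \<ge> 0" "(real m + 1) powr 0 = 1" by simp_all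
  ultimately show ?thesis unfolding lyap_def by linarith
qed

lemma lyap_at_top: "filterlim lyap at_top sequentially"
  unfolding lyap_def by real_asymp

text \<open>Put \<open>v = (m + 1) powr (-1/4)\<close>. The logarithm contributes
  \<open>(rho - nu / 2) * v^4 \<le> 0\<close>, which is 0 at criticality. The correction contributes
  \<open>(rho / 4 - 5/32 * nu) * v^5 \<le> - nu / 32 * v^5\<close>, and all errors are of order
  \<open>v^6\<close>.\<close>

lemma lyap_superharmonic:
  assumes "rho \<le> nu / 2"
  shows "\<exists>m0. \<forall>m\<ge>m0. summable (\<lambda>b. phi m b * lyap b) \<and> (\<Sum>b. phi m b * lyap b) \<le> lyap m"
proof -
  obtain C where C: "C \<ge> 0" and CB: "\<forall>m\<ge>1. \<forall>c0 c1 c2 c4 f. c4 > 0 \<longrightarrow> (\<forall>b. 0 \<le> f b) \<longrightarrow>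
     (\<forall>b. f b \<le> c0 + c1 * (real b - real m) + c2 * (real b - real m)\<^sup>2 + c4 * (real b - real m)^4) \<longrightarrow>
     summable (\<lambda>b. phi m b * f b) \<and>
     (\<Sum>b. phi m b * f b) \<le> c0 + c1 * rho + c2 * (nu * real m)
        + C * (\<bar>c1\<bar> / sqrt (real m) + \<bar>c2\<bar> * sqrt (real m) + c4 * (real m)\<^sup>2)"
    using ex_phi_moment_bound by blast
  define w where "w m = (real m + 1) powr (-1/4)" for m :: nat
  \<comment> \<open>The threshold for \<open>v\<close> below which \<open>- nu / 32 * v^5\<close>
    absorbs the error \<open>(5/4 * nu + 6 * C) * v^6\<close>.\<close>
  define c where "c = nu / 32 / (5 / 4 * nu + 6 * C)"
  have c: "c > 0" unfolding c_def using nu_pos C by (intro divide_pos_pos add_pos_nonneg) auto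
  have "(w \<longlonglongrightarrow> 0)" unfolding w_def by real_asymp
  then have "eventually (\<lambda>m. w m < c) sequentially" using c by (rule order_tendstoD)
  then obtain m0 where m0: "\<And>m. m \<ge> m0 \<Longrightarrow> w m < c" by (auto simp: eventually_sequentially)
  show ?thesis
  proof (intro exI[of _ "max 1 m0"] allI impI)
    fix m assume "max 1 m0 \<le> m"
    then have m: "m \<ge> 1" "m \<ge> m0" by auto
    define v where "v = w m"
    define M where "M = real m + 1"
    have M: "M > 1" using m by (simp add: M_def)
    have v: "v > 0" "v < c" using M m0[OF m(2)] by (auto simp: v_def w_def M_def)
    have v1: "v \<le> 1"
    proof -
      have "M powr (-1/4) \<le> M powr 0" using M by (intro powr_mono) auto
      then show ?thesis using M by (simp add: v_def w_def M_def)
    qed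
    have vM: "v^4 * M = 1"
    proof -
      have "v^4 = M powr (-1)" unfolding v_def w_def M_def[symmetric] using M by (simp add: powr_power)
      then show ?thesis using M by (simp add: powr_minus)
    qed
    have mv: "real m = 1 / v^4 - 1" using vM v by (simp add: M_def field_simps)
    have sM: "sqrt M = 1 / v\<^sup>2"
    proof (rule real_sqrt_unique)
      show "(1 / v\<^sup>2)\<^sup>2 = M" using vM v by (simp add: eval_nat_numeral field_simps)
    qed simp
    have sm: "sqrt (real m) \<le> 1 / v\<^sup>2" unfolding sM[symmetric] by (simp add: M_def)
    have ism: "1 / sqrt (real m) \<le> 2 * v\<^sup>2"
    proof -
      have "sqrt M \<le> sqrt (4 * real m)" using m by (simp add: M_def)
      also have "\<dots> = 2 * sqrt (real m)" by (simp add: real_sqrt_mult)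
      finally have "1 / v\<^sup>2 \<le> 2 * sqrt (real m)" by (simp add: sM)
      then show ?thesis using m v by (simp add: field_simps)
    qed
    \<comment> \<open>Coefficients of the Taylor bounds in \<open>x = (b - m) / M\<close>, with
      \<open>1 / M = v^4\<close>. The term \<open>v^2 / 4\<close> in \<open>c2\<close> and all of
      \<open>c4\<close> come from the cubic remainder split at scale \<open>v^2\<close>.\<close>
    define c1 where "c1 = (1 + v / 4) * v^4"
    define c2 where "c2 = (-1/2 - 5/32 * v + v\<^sup>2 / 4) * v^8"
    define c4 where "c4 = v^14 / 4"
    have "lyap b \<le> lyap m + c1 * (real b - real m) + c2 * (real b - real m)\<^sup>2 + c4 * (real b - real m)^4" for b
    proof -
      define x where "x = (real b - real m) / M"
      have D: "real b - real m = M * x" using M by (simp add: x_def)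
      have b1: "real b + 1 = M * (1 + x)" using D by (simp add: M_def algebra_simps)
      have x: "x > -1" using b1 M by (smt (verit) of_nat_0_le_iff zero_less_mult_pos)
      have l: "ln (real b + 1) \<le> ln M + (x - x\<^sup>2 / 2 + x^3 / 3)"
        unfolding b1 using M x ln_add_one_le_cubic[OF x] by (simp add: ln_mult)
      have "v * (1 - x / 4 + 5 / 32 * x\<^sup>2 - 15 / 128 * x^3) \<le> v * (1 + x) powr (-1/4)"
        using v powr_neg_quarter_ge[OF x] by (intro mult_left_mono) auto
      also have "\<dots> = (real b + 1) powr (-1/4)" unfolding b1 v_def w_def M_def[symmetric]
        using M x by (simp add: powr_mult)
      finally have p: "v * (1 - x / 4 + 5 / 32 * x\<^sup>2 - 15 / 128 * x^3) \<le> (real b + 1) powr (-1/4)" .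
      have "(1/3 + 15/128 * v) * x^3 \<le> (1/2) * \<bar>x\<bar>^3"
      proof -
        have "(1/3 + 15/128 * v) * x^3 \<le> (1/3 + 15/128 * v) * \<bar>x\<bar>^3"
          using v by (intro mult_left_mono) (auto simp: power_abs[symmetric])
        also have "\<dots> \<le> (1/2) * \<bar>x\<bar>^3" using v1 by (intro mult_right_mono) auto
        finally show ?thesis .
      qed
      also have "\<dots> \<le> (1/2) * ((v\<^sup>2 * x\<^sup>2 + x^4 / v\<^sup>2) / 2)"
        using abs_cube_le[of "v\<^sup>2" x] v by (intro mult_left_mono) auto
      also have "\<dots> = v\<^sup>2 / 4 * x\<^sup>2 + x^4 / (4 * v\<^sup>2)" using v by (simp add: field_simps)
      finally have q: "(1/3 + 15/128 * v) * x^3 \<le> v\<^sup>2 / 4 * x\<^sup>2 + x^4 / (4 * v\<^sup>2)" .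
      have lm: "lyap m = ln M - v + 1" by (simp add: lyap_def v_def w_def M_def)
      have e1: "c1 * (real b - real m) = (1 + v / 4) * x * (v^4 * M)"
        by (simp add: c1_def D)
      have e2: "c2 * (real b - real m)\<^sup>2 = (-1/2 - 5/32 * v + v\<^sup>2 / 4) * x\<^sup>2 * (v^4 * M)\<^sup>2"
        by (simp add: c2_def D eval_nat_numeral)
      have e4: "c4 * (real b - real m)^4 = x^4 / (4 * v\<^sup>2) * (v^4 * M)^4"
        using v by (simp add: c4_def D eval_nat_numeral)
      show ?thesis unfolding e1 e2 e4 vM lm using l p q unfolding lyap_def
        by (simp add: algebra_simps)
    qed
    moreover have "c4 > 0" using v by (simp add: c4_def)
    ultimately have main: "summable (\<lambda>b. phi m b * lyap b)"
      "(\<Sum>b. phi m b * lyap b) \<le> lyap m + c1 * rho + c2 * (nu * real m)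
        + C * (\<bar>c1\<bar> / sqrt (real m) + \<bar>c2\<bar> * sqrt (real m) + c4 * (real m)\<^sup>2)"
      using CB[rule_format, of m c4 lyap "lyap m" c1 c2] m lyap_nonneg by auto
    have c1: "0 \<le> c1" "c1 \<le> 2 * v^4" using v v1 unfolding c1_def by (auto intro: mult_right_mono)
    have c2: "\<bar>c2\<bar> \<le> v^8"
    proof -
      have "v\<^sup>2 \<le> 1" using v v1 by (simp add: power_le_one)
      then have "\<bar>-1/2 - 5/32 * v + v\<^sup>2 / 4\<bar> \<le> 1" using v v1 zero_le_power2[of v] by linarith
      then have "\<bar>-1/2 - 5/32 * v + v\<^sup>2 / 4\<bar> * v^8 \<le> 1 * v^8" by (intro mult_right_mono) auto
      then show ?thesis by (simp add: c2_def abs_mult)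
    qed
    have s1: "\<bar>c1\<bar> / sqrt (real m) \<le> 4 * v^6"
    proof -
      have "c1 * (1 / sqrt (real m)) \<le> (2 * v^4) * (2 * v\<^sup>2)" using c1 ism by (intro mult_mono) auto
      also have "\<dots> = 4 * v^6" by (simp add: eval_nat_numeral)
      finally show ?thesis using c1 by simp
    qed
    have s2: "\<bar>c2\<bar> * sqrt (real m) \<le> v^6"
    proof -
      have "\<bar>c2\<bar> * sqrt (real m) \<le> v^8 * (1 / v\<^sup>2)" using c2 sm by (intro mult_mono) auto
      also have "\<dots> = v^6" using v by (simp add: eval_nat_numeral)
      finally show ?thesis .
    qed
    have s4: "c4 * (real m)\<^sup>2 \<le> v^6"
    proof -
      have "(real m)\<^sup>2 \<le> (1 / v^4)\<^sup>2" unfolding mv using m mv by (intro power_mono) auto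
      then have "c4 * (real m)\<^sup>2 \<le> v^14 / 4 * (1 / v^4)\<^sup>2" unfolding c4_def using v by (intro mult_left_mono) auto
      also have "\<dots> = v^6 / 4" using v by (simp add: eval_nat_numeral)
      also have "\<dots> \<le> v^6" using v by simp
      finally show ?thesis .
    qed
    have "c1 * rho + c2 * (nu * real m) \<le> - (nu / 32) * v^5 + (5/4 * nu) * v^6"
    proof -
      have "c1 * rho \<le> c1 * (nu / 2)" using c1 assms by (intro mult_left_mono)
      moreover have "c2 * (nu * real m) = nu * ((-1/2 - 5/32 * v + v\<^sup>2 / 4) * (v^4 - v^8))"
        proof -
        have "v^8 * (1 / v^4 - 1) = v^4 - v^8" using v by (simp add: eval_nat_numeral right_diff_distrib)
        moreover have "c2 * (nu * real m) = nu * ((-1/2 - 5/32 * v + v\<^sup>2 / 4) * (v^8 * (1 / v^4 - 1)))"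
          unfolding c2_def mv by (simp only: mult_ac)
        ultimately show ?thesis by simp
      qed
      moreover have "c1 * (nu / 2) + nu * ((-1/2 - 5/32 * v + v\<^sup>2 / 4) * (v^4 - v^8))
        = nu * (- (v^5) / 32 + v^6 / 4 + (1/2 + 5/32 * v - v\<^sup>2 / 4) * v^8)"
        by (simp add: c1_def algebra_simps eval_nat_numeral)
      moreover have "nu * (- (v^5) / 32 + v^6 / 4 + (1/2 + 5/32 * v - v\<^sup>2 / 4) * v^8)
         \<le> nu * (- (v^5) / 32 + v^6 / 4 + 1 * v^6)"
      proof (intro mult_left_mono add_mono order_refl)
        have "(1/2 + 5/32 * v - v\<^sup>2 / 4) * v^8 \<le> 1 * v^8"
        proof (intro mult_right_mono)
          show "1/2 + 5/32 * v - v\<^sup>2 / 4 \<le> 1" using v v1 zero_le_power2[of v] by linarith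
        qed (use v in auto)
        also have "\<dots> \<le> 1 * v^6" using v v1 by (simp add: power_decreasing)
        finally show "(1/2 + 5/32 * v - v\<^sup>2 / 4) * v^8 \<le> 1 * v^6" .
      qed (use nu_pos in auto)
      ultimately show ?thesis by (simp add: algebra_simps)
    qed
    moreover have "C * (\<bar>c1\<bar> / sqrt (real m) + \<bar>c2\<bar> * sqrt (real m) + c4 * (real m)\<^sup>2) \<le> C * (6 * v^6)"
      using s1 s2 s4 C by (intro mult_left_mono) auto
    moreover have "- (nu / 32) * v^5 + (5/4 * nu) * v^6 + C * (6 * v^6) \<le> 0"
    proof -
      have "5 / 4 * nu + 6 * C > 0" using nu_pos C by (intro add_pos_nonneg) auto
      then have "v * (5 / 4 * nu + 6 * C) \<le> nu / 32"
        using v(2)[unfolded c_def] by (simp only: pos_less_divide_eq less_imp_le)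
      then have "v^5 * (v * (5 / 4 * nu + 6 * C)) \<le> v^5 * (nu / 32)" using v by (intro mult_left_mono) auto
      then show ?thesis by (simp add: algebra_simps eval_nat_numeral)
    qed
    ultimately show "summable (\<lambda>b. phi m b * lyap b) \<and> (\<Sum>b. phi m b * lyap b) \<le> lyap m"
      using main by linarith
  qed
qed

text \<open>To leading order the relative change is
  \<open>\<alpha> * ((\<alpha> + 1) * nu / 2 - rho) / (m + 1)\<close>, negative for small
  \<open>\<alpha>\<close> because \<open>rho > nu / 2\<close>; the errors are smaller by a factor of
  order \<open>1 / sqrt m\<close>.\<close>

lemma powr_superharmonic:
  assumes "rho > nu / 2"
  shows "\<exists>\<alpha>>0. \<exists>m0. \<forall>m\<ge>m0. summable (\<lambda>b. phi m b * (real b + 1) powr (-\<alpha>)) \<and>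
    (\<Sum>b. phi m b * (real b + 1) powr (-\<alpha>)) \<le> (real m + 1) powr (-\<alpha>)"
proof -
  obtain C where C: "C \<ge> 0" and CB: "\<forall>m\<ge>1. \<forall>c0 c1 c2 c4 f. c4 > 0 \<longrightarrow> (\<forall>b. 0 \<le> f b) \<longrightarrow>
     (\<forall>b. f b \<le> c0 + c1 * (real b - real m) + c2 * (real b - real m)\<^sup>2 + c4 * (real b - real m)^4) \<longrightarrow>
     summable (\<lambda>b. phi m b * f b) \<and>
     (\<Sum>b. phi m b * f b) \<le> c0 + c1 * rho + c2 * (nu * real m)
        + C * (\<bar>c1\<bar> / sqrt (real m) + \<bar>c2\<bar> * sqrt (real m) + c4 * (real m)\<^sup>2)"
    using ex_phi_moment_bound by blast
  \<comment> \<open>The second bound gives \<open>(\<alpha> + 1) * nu / 2 < rho\<close>; the cap 1/2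
    meets the Taylor estimate and keeps \<open>M powr (-\<alpha>)\<close> at least
    \<open>1 / sqrt M\<close>.\<close>
  define \<alpha> where "\<alpha> = min (1/2) ((rho - nu / 2) / nu)"
  have "0 < (rho - nu / 2) / nu" using assms nu_pos by (intro divide_pos_pos) auto
  then have a: "0 < \<alpha>" "\<alpha> \<le> 1/2" by (simp_all only: \<alpha>_def min.cobounded1 min_less_iff_conj) simp
  have "\<alpha> \<le> (rho - nu / 2) / nu" unfolding \<alpha>_def by (rule min.cobounded2)
  then have "\<alpha> * nu \<le> rho - nu / 2" using nu_pos by (simp add: field_simps)
  moreover have "0 < \<alpha> * nu" using a nu_pos by simp
  ultimately have gap: "(\<alpha> + 1) * nu / 2 < rho" by (simp add: field_simps)
  define \<gamma> where "\<gamma> = \<alpha> * (rho - (\<alpha> + 1) * nu / 2)"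
  have g: "\<gamma> > 0" using gap a by (simp add: \<gamma>_def)
  define k where "k = 3 * nu + 40 * C"
  have k: "k > 0" using nu_pos C by (simp add: k_def add_pos_nonneg)
  define w where "w m = 1 / sqrt (real m + 1)" for m :: nat
  have "(w \<longlonglongrightarrow> 0)" unfolding w_def by real_asymp
  then have "eventually (\<lambda>m. w m < \<gamma> / k) sequentially" using g k by (intro order_tendstoD) auto
  then obtain m0 where m0: "\<And>m. m \<ge> m0 \<Longrightarrow> w m < \<gamma> / k" by (auto simp: eventually_sequentially)
  show ?thesis
  proof (intro exI[of _ \<alpha>] conjI[OF a(1)] exI[of _ "max 1 m0"] allI impI)
    fix m assume "max 1 m0 \<le> m"
    then have m: "m \<ge> 1" "m \<ge> m0" by auto
    define s where "s = w m"
    define M where "M = real m + 1"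
    have M: "M > 1" using m by (simp add: M_def)
    have s: "s > 0" "s < \<gamma> / k" "s \<le> 1" using M m0[OF m(2)] by (auto simp: s_def w_def M_def)
    have s2: "s\<^sup>2 = 1 / M" using M by (simp add: s_def w_def M_def power_divide)
    have sM: "s\<^sup>2 * M = 1" using M by (simp add: s2)
    have sqM: "sqrt M = 1 / s" by (simp add: s_def w_def M_def)
    have sm: "sqrt (real m) \<le> 1 / s" unfolding sqM[symmetric] by (simp add: M_def)
    have ism: "1 / sqrt (real m) \<le> 2 * s"
    proof -
      have "sqrt M \<le> sqrt (4 * real m)" using m by (simp add: M_def)
      also have "\<dots> = 2 * sqrt (real m)" by (simp add: real_sqrt_mult)
      finally have "1 / s \<le> 2 * sqrt (real m)" by (simp add: sqM)
      then show ?thesis using m s by (simp add: field_simps)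
    qed
    define \<theta> where "\<theta> = M powr (-\<alpha>)"
    have th: "\<theta> > 0" using M by (simp add: \<theta>_def)
    have ths: "1 \<le> \<theta> / s"
    proof -
      have "s = 1 / sqrt M" by (simp add: sqM)
      also have "\<dots> = M powr (- (1/2))" using M by (subst powr_minus_divide, subst powr_half_sqrt) auto
      also have "\<dots> \<le> \<theta>" unfolding \<theta>_def using M a by (intro powr_mono) auto
      finally show ?thesis using s by (simp add: field_simps)
    qed
    let ?f = "\<lambda>b::nat. (real b + 1) powr (-\<alpha>)"
    define c1 where "c1 = - (\<theta> * \<alpha> * s\<^sup>2)"
    define c2 where "c2 = \<theta> * (\<alpha> * (\<alpha> + 1) / 2 + 3 * s) * s^4"
    \<comment> \<open>19 is 3 from the cubic remainder split at scale \<open>s\<close>, plus 16 from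
      the region \<open>x < -1/2\<close>.\<close>
    define c4 where "c4 = \<theta> * 19 * s^7"
    have "?f b \<le> \<theta> + c1 * (real b - real m) + c2 * (real b - real m)\<^sup>2 + c4 * (real b - real m)^4" for b
    proof -
      define x where "x = (real b - real m) / M"
      have D: "real b - real m = M * x" using M by (simp add: x_def)
      have b1: "real b + 1 = M * (1 + x)" using D by (simp add: M_def algebra_simps)
      have x: "x > -1" using b1 M by (smt (verit) of_nat_0_le_iff zero_less_mult_pos)
      have fb: "?f b = \<theta> * (1 + x) powr (-\<alpha>)" unfolding b1 \<theta>_def using M x by (simp add: powr_mult)
      have e1: "c1 * (real b - real m) = - \<theta> * \<alpha> * x * (s\<^sup>2 * M)" by (simp add: c1_def D)
      have e2: "c2 * (real b - real m)\<^sup>2 = \<theta> * (\<alpha> * (\<alpha> + 1) / 2 + 3 * s) * x\<^sup>2 * (s\<^sup>2 * M)\<^sup>2"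
        by (simp add: c2_def D eval_nat_numeral)
      have e4: "c4 * (real b - real m)^4 = 19 * (\<theta> / s) * x^4 * (s\<^sup>2 * M)^4"
        using s by (simp add: c4_def D eval_nat_numeral)
      have c: "6 * \<bar>x\<bar>^3 \<le> 3 * s * x\<^sup>2 + 3 * x^4 / s" using abs_cube_le[OF s(1), of x] by simp
      have x4: "0 \<le> \<theta> / s * x^4" using th s by simp
      have "?f b \<le> \<theta> * (1 - \<alpha> * x + \<alpha> * (\<alpha> + 1) / 2 * x\<^sup>2 + (3 * s * x\<^sup>2 + 3 * x^4 / s)) + 16 * (\<theta> / s) * x^4"
      proof (cases "x \<ge> -1/2")
        case True
        have "?f b \<le> \<theta> * (1 - \<alpha> * x + \<alpha> * (\<alpha> + 1) / 2 * x\<^sup>2 + (3 * s * x\<^sup>2 + 3 * x^4 / s))"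
        proof -
          have "(1 + x) powr (-\<alpha>) \<le> 1 - \<alpha> * x + \<alpha> * (\<alpha> + 1) / 2 * x\<^sup>2 + (3 * s * x\<^sup>2 + 3 * x^4 / s)"
            using powr_neg_le_quadratic[OF True a] c by linarith
          from mult_left_mono[OF this less_imp_le[OF th]] show ?thesis by (simp only: fb)
        qed
        with x4 show ?thesis by linarith
      next
        case False
        have "?f b \<le> (real b + 1) powr 0" using a by (intro powr_mono) auto
        then have "?f b \<le> 1" by simp
        also have "1 \<le> 16 * x^4"
        proof -
          have "(1/2)^4 \<le> (- x)^4" using False by (intro power_mono) auto
          moreover have "(- x)^4 = x^4" by simp
          ultimately show ?thesis by (simp add: power_divide)
        qed
        also have "\<dots> \<le> 16 * (\<theta> / s) * x^4" using ths by (intro mult_right_mono) auto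
        finally have "?f b \<le> 16 * (\<theta> / s) * x^4" .
        moreover have "0 \<le> \<theta> * (1 - \<alpha> * x + \<alpha> * (\<alpha> + 1) / 2 * x\<^sup>2 + (3 * s * x\<^sup>2 + 3 * x^4 / s))"
        proof -
          have "\<alpha> * x \<le> 0" using a False by (intro mult_nonneg_nonpos) auto
          moreover have "0 \<le> \<alpha> * (\<alpha> + 1) / 2 * x\<^sup>2" using a by auto
          moreover have "0 \<le> 3 * s * x\<^sup>2 + 3 * x^4 / s" using s by auto
          ultimately show ?thesis using th by (intro mult_nonneg_nonneg) linarith+
        qed
        ultimately show ?thesis by linarith
      qed
      then show ?thesis unfolding e1 e2 e4 sM by (simp add: algebra_simps)
    qed
    moreover have "c4 > 0" using s th by (simp add: c4_def)
    ultimately have main: "summable (\<lambda>b. phi m b * ?f b)"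
      "(\<Sum>b. phi m b * ?f b) \<le> \<theta> + c1 * rho + c2 * (nu * real m)
        + C * (\<bar>c1\<bar> / sqrt (real m) + \<bar>c2\<bar> * sqrt (real m) + c4 * (real m)\<^sup>2)"
      using CB[rule_format, of m c4 ?f \<theta> c1 c2] m by auto
    have a1: "\<alpha> * (\<alpha> + 1) / 2 \<le> 1" "0 \<le> \<alpha> * (\<alpha> + 1) / 2"
    proof -
      have "\<alpha> * (\<alpha> + 1) \<le> 1/2 * (1/2 + 1)" using a by (intro mult_mono) auto
      then show "\<alpha> * (\<alpha> + 1) / 2 \<le> 1" by simp
    qed (use a in auto)
    have ac1: "\<bar>c1\<bar> = \<theta> * \<alpha> * s\<^sup>2" using th a by (simp add: c1_def)
    have s1: "\<bar>c1\<bar> / sqrt (real m) \<le> \<theta> * s\<^sup>2 * s"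
    proof -
      have "\<alpha> * (1 / sqrt (real m)) \<le> (1/2) * (2 * s)" using a ism by (intro mult_mono) auto
      then have "(\<theta> * s\<^sup>2) * (\<alpha> * (1 / sqrt (real m))) \<le> (\<theta> * s\<^sup>2) * s" using th by (intro mult_left_mono) auto
      then show ?thesis by (simp add: ac1 mult_ac)
    qed
    have s2': "\<bar>c2\<bar> * sqrt (real m) \<le> 4 * (\<theta> * s\<^sup>2 * s)"
    proof -
      have "c2 \<ge> 0" unfolding c2_def using th a1 s by auto
      moreover have "c2 \<le> \<theta> * 4 * s^4" unfolding c2_def using th a1 s by (intro mult_right_mono mult_left_mono) auto
      ultimately have "\<bar>c2\<bar> * sqrt (real m) \<le> (\<theta> * 4 * s^4) * (1 / s)" using sm s by (intro mult_mono) auto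
      also have "\<dots> = 4 * (\<theta> * s\<^sup>2 * s)" using s by (simp add: eval_nat_numeral)
      finally show ?thesis .
    qed
    have m2: "(real m)\<^sup>2 * s^4 \<le> 1"
    proof -
      have "real m * s\<^sup>2 \<le> M * s\<^sup>2" by (intro mult_right_mono) (auto simp: M_def)
      then have "real m * s\<^sup>2 \<le> 1" using sM by (simp add: mult.commute)
      then have "(real m * s\<^sup>2)\<^sup>2 \<le> 1\<^sup>2" by (intro power_mono) auto
      then show ?thesis by (simp add: eval_nat_numeral mult_ac)
    qed
    have s4: "c4 * (real m)\<^sup>2 \<le> 19 * (\<theta> * s\<^sup>2 * s)"
    proof -
      have "c4 * (real m)\<^sup>2 = (19 * (\<theta> * s\<^sup>2 * s)) * ((real m)\<^sup>2 * s^4)" by (simp add: c4_def eval_nat_numeral)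
      also have "\<dots> \<le> (19 * (\<theta> * s\<^sup>2 * s)) * 1" using m2 th s by (intro mult_left_mono) auto
      finally show ?thesis by simp
    qed
    have c2m: "c2 * (nu * real m) \<le> \<theta> * s\<^sup>2 * ((\<alpha> * (\<alpha> + 1) / 2 + 3 * s) * nu)"
    proof -
      have "c2 * (nu * real m) = (\<theta> * s\<^sup>2 * ((\<alpha> * (\<alpha> + 1) / 2 + 3 * s) * nu)) * (real m * s\<^sup>2)"
        by (simp add: c2_def eval_nat_numeral)
      also have "\<dots> \<le> (\<theta> * s\<^sup>2 * ((\<alpha> * (\<alpha> + 1) / 2 + 3 * s) * nu)) * 1"
      proof (intro mult_left_mono)
        have "real m * s\<^sup>2 \<le> M * s\<^sup>2" by (intro mult_right_mono) (auto simp: M_def)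
        then show "real m * s\<^sup>2 \<le> 1" using sM by (simp add: mult.commute)
      qed (use th a1 s nu_pos in auto)
      finally show ?thesis by simp
    qed
    have "C * (\<bar>c1\<bar> / sqrt (real m) + \<bar>c2\<bar> * sqrt (real m) + c4 * (real m)\<^sup>2) \<le> C * (40 * (\<theta> * s\<^sup>2 * s))"
    proof (intro mult_left_mono C)
      have "0 \<le> \<theta> * s\<^sup>2 * s" using th s by simp
      with s1 s2' s4 show "\<bar>c1\<bar> / sqrt (real m) + \<bar>c2\<bar> * sqrt (real m) + c4 * (real m)\<^sup>2 \<le> 40 * (\<theta> * s\<^sup>2 * s)"
        by linarith
    qed
    with main(2) c2m have "(\<Sum>b. phi m b * ?f b) \<le> \<theta> + c1 * rho + \<theta> * s\<^sup>2 * ((\<alpha> * (\<alpha> + 1) / 2 + 3 * s) * nu)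
        + C * (40 * (\<theta> * s\<^sup>2 * s))" by linarith
    also have "\<dots> = \<theta> + \<theta> * s\<^sup>2 * (s * k - \<gamma>)"
      by (simp add: c1_def k_def \<gamma>_def algebra_simps)
    also have "\<dots> \<le> \<theta>"
    proof -
      have "s * k \<le> \<gamma>" using s k by (simp add: field_simps)
      then show ?thesis using th by (simp add: mult_nonneg_nonpos)
    qed
    finally show "summable (\<lambda>b. phi m b * ?f b) \<and> (\<Sum>b. phi m b * ?f b) \<le> (real m + 1) powr (-\<alpha>)"
      using main(1) by (simp add: \<theta>_def M_def)
  qed
qed

end

section \<open>The branching process of right steps\<close>

lemma sums_if_eq: "(\<lambda>b::nat. if b = k then x else 0) sums (x::real)"
  using sums_single[of k "\<lambda>_. x"] by simp

context cookie_stack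
begin

lemma phi_summable_mult:
  assumes "\<And>b. 0 \<le> g b" "\<And>b. g b \<le> 1"
  shows "summable (\<lambda>b. phi m b * g b)"
proof (rule summable_comparison_test'[of "phi m" 0])
  show "summable (phi m)" using phi_sums sums_summable by blast
  show "norm (phi m b * g b) \<le> phi m b" for b
    using assms[of b] phi_nonneg[of m b] by (simp add: mult_left_le abs_mult)
qed

lemma phi_suminf: "(\<Sum>b. phi m b) = 1"
  using phi_sums by (simp add: sums_iff)

text \<open>\<open>extinct n m\<close>: probability that the branching process started from \<open>m\<close> is extinct after \<open>n\<close>
  generations.\<close>
fun extinct :: "nat \<Rightarrow> nat \<Rightarrow> real" where
  "extinct 0 m = (if m = 0 then 1 else 0)"
| "extinct (Suc n) m = (\<Sum>b. phi m b * extinct n b)"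

lemma extinct_bounds: "0 \<le> extinct n m \<and> extinct n m \<le> 1"
proof (induction n arbitrary: m)
  case (Suc n)
  have s: "summable (\<lambda>b. phi m b * extinct n b)" using Suc by (intro phi_summable_mult) auto
  have "(\<Sum>b. phi m b * extinct n b) \<le> (\<Sum>b. phi m b)"
    using Suc s phi_sums by (intro suminf_le) (auto simp: mult_left_le phi_nonneg sums_iff)
  moreover have "0 \<le> (\<Sum>b. phi m b * extinct n b)"
    using Suc s by (intro suminf_nonneg) (auto simp: phi_nonneg)
  ultimately show ?case by (simp add: phi_suminf)
qed auto

lemma extinct_summable: "summable (\<lambda>b. phi m b * extinct n b)"
  using extinct_bounds by (intro phi_summable_mult) auto

lemma extinct_at_0: "extinct n 0 = 1"
proof (induction n)
  case (Suc n)
  have "(\<Sum>b. phi 0 b * extinct n b) = (\<Sum>b\<in>{0}. phi 0 b * extinct n b)"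
    by (rule suminf_finite) (auto simp: phi_0)
  with Suc show ?case by (simp add: phi_0)
qed simp

lemma extinct_incseq: "extinct n m \<le> extinct (Suc n) m"
proof (induction n arbitrary: m)
  case 0
  show ?case
  proof (cases "m = 0")
    case True then show ?thesis using extinct_at_0[of "Suc 0"] by simp
  next
    case False then show ?thesis using extinct_bounds[of "Suc 0" m] by (simp only: extinct.simps(1) if_False)
  qed
next
  case (Suc n)
  have "(\<Sum>b. phi m b * extinct n b) \<le> (\<Sum>b. phi m b * extinct (Suc n) b)"
    by (intro suminf_le mult_left_mono Suc phi_nonneg extinct_summable)
  then show ?case by (simp only: extinct.simps(2))
qed

lemma extinct_convergent: "\<exists>l. (\<lambda>n. extinct n m) \<longlonglongrightarrow> l \<and> (\<forall>n. extinct n m \<le> l) \<and> 0 \<le> l \<and> l \<le> 1"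
proof -
  obtain l where l: "(\<lambda>n. extinct n m) \<longlonglongrightarrow> l" "\<forall>n. extinct n m \<le> l"
    using incseq_convergent[of "\<lambda>n. extinct n m" 1] extinct_incseq extinct_bounds by (metis incseq_SucI)
  moreover have "l \<le> 1" using l(1) extinct_bounds by (intro LIMSEQ_le_const2[OF l(1)]) auto
  moreover have "0 \<le> l" using l(2) extinct_bounds by (meson order_trans)
  ultimately show ?thesis by blast
qed

text \<open>The survival probability \<open>h\<close> is subharmonic, vanishes at 0 and, by
  comparison with the unbounded \<open>lyap\<close>, never exceeds its maximum \<open>H\<close> over
  \<open>{..m0}\<close>. At a point attaining \<open>H\<close> the chance of immediate extinction
  would lower the average, so \<open>H = 0\<close>.\<close>

lemma extinct_tendsto_1:
  assumes "rho \<le> nu / 2"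
  shows "(\<lambda>n. extinct n m) \<longlonglongrightarrow> 1"
proof -
  obtain l where l: "\<And>m. (\<lambda>n. extinct n m) \<longlonglongrightarrow> l m" "\<And>m n. extinct n m \<le> l m" "\<And>m. 0 \<le> l m" "\<And>m. l m \<le> 1"
    using extinct_convergent by metis
  define h where "h m = 1 - l m" for m
  have h: "0 \<le> h m" "h m \<le> 1" for m using l(3,4)[of m] by (auto simp: h_def)
  have h0: "h 0 = 0"
  proof -
    have "(\<lambda>n. extinct n 0) \<longlonglongrightarrow> 1" by (simp add: extinct_at_0)
    then have "l 0 = 1" using l(1) LIMSEQ_unique by blast
    then show ?thesis by (simp add: h_def)
  qed
  have hs: "summable (\<lambda>b. phi m b * h b)" for m by (rule phi_summable_mult) (use h in auto)
  have hP: "h m \<le> (\<Sum>b. phi m b * h b)" for m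
  proof -
    have ls: "summable (\<lambda>b. phi m b * l b)" by (rule phi_summable_mult) (use l in auto)
    have "(\<Sum>b. phi m b * l b) \<le> l m"
    proof (rule suminf_le_const[OF ls])
      \<comment> \<open>Finite partial sums pass to the limit in \<open>n\<close>, which gives the
        inequality for the series without exchanging limit and infinite sum.\<close>
      fix N
      have "(\<lambda>n. \<Sum>b<N. phi m b * extinct n b) \<longlonglongrightarrow> (\<Sum>b<N. phi m b * l b)"
        by (intro tendsto_intros l)
      moreover have "(\<Sum>b<N. phi m b * extinct n b) \<le> l m" for n
      proof -
        have "(\<Sum>b<N. phi m b * extinct n b) \<le> extinct (Suc n) m" unfolding extinct.simps
          using extinct_bounds by (intro sum_le_suminf extinct_summable) (auto intro!: mult_nonneg_nonneg phi_nonneg)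
        also have "\<dots> \<le> l m" by (rule l)
        finally show ?thesis .
      qed
      ultimately show "(\<Sum>b<N. phi m b * l b) \<le> l m" by (intro LIMSEQ_le_const2) auto
    qed
    moreover have "(\<Sum>b. phi m b * h b) = (\<Sum>b. phi m b) - (\<Sum>b. phi m b * l b)"
      unfolding h_def right_diff_distrib
      using ls phi_sums by (subst suminf_diff[symmetric]) (auto simp: sums_iff)
    ultimately show ?thesis by (simp add: phi_suminf h_def)
  qed
  obtain m0 where m0: "\<And>m. m \<ge> m0 \<Longrightarrow> summable (\<lambda>b. phi m b * lyap b) \<and> (\<Sum>b. phi m b * lyap b) \<le> lyap m"
    using lyap_superharmonic[OF assms] by blast
  define H where "H = Max (h ` {..m0})"
  have H: "h k \<le> H" if "k \<le> m0" for k unfolding H_def using that by (intro Max_ge) auto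
  have H0: "H \<ge> 0" using H[of 0] h0 by simp
  text \<open>Maximum principle: \<open>h - H - e * lyap\<close> is subharmonic beyond \<open>m0\<close> and tends to
    \<open>-\<infinity>\<close>, so it cannot attain a positive maximum.\<close>
  have step: "h m \<le> H + e * lyap m" if e: "e > 0" for e m
  proof (rule ccontr)
    define g where "g m = h m - H - e * lyap m" for m
    assume "\<not> h m \<le> H + e * lyap m"
    then have gm: "g m > 0" by (simp add: g_def)
    have "eventually (\<lambda>k. lyap k > 1 / e) sequentially"
      using lyap_at_top by (auto simp: filterlim_at_top_dense)
    then obtain N where N: "\<And>k. k \<ge> N \<Longrightarrow> lyap k > 1 / e" by (auto simp: eventually_sequentially)
    have gN: "g k < 0" if "k \<ge> N" for k
      using N[OF that] h(2)[of k] H0 e by (simp add: g_def field_simps)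
    have "m \<le> N" using gm gN by (meson less_asym' nle_le)
    define G where "G = Max (g ` {..N})"
    have "G \<in> g ` {..N}" unfolding G_def by (intro Max_in) auto
    then obtain m1 where m1: "g m1 = G" "m1 \<le> N" by auto
    have Gk: "g k \<le> G" if "k \<le> N" for k unfolding G_def using that by (intro Max_ge) auto
    have G0: "G > 0" using Gk[OF \<open>m \<le> N\<close>] gm by simp
    have GG: "g k \<le> G" for k using Gk[of k] gN[of k] G0 by (cases "k \<le> N") auto
    have "m1 > m0"
    proof (rule ccontr)
      assume "\<not> m1 > m0"
      moreover have "0 \<le> e * lyap m1" using e lyap_nonneg[of m1] by simp
      ultimately have "g m1 \<le> 0" using H[of m1] unfolding g_def by linarith
      then show False using m1 G0 by simp
    qed
    then have L: "summable (\<lambda>b. phi m1 b * lyap b)" "(\<Sum>b. phi m1 b * lyap b) \<le> lyap m1"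
      using m0[of m1] by auto
    have g0: "g 0 \<le> 0" using h0 H0 mult_nonneg_nonneg[OF less_imp_le[OF e] lyap_nonneg[of 0]] unfolding g_def by linarith
    have s1: "(\<lambda>b. phi m1 b * h b - H * phi m1 b - e * (phi m1 b * lyap b)) sums
        ((\<Sum>b. phi m1 b * h b) - H * 1 - e * (\<Sum>b. phi m1 b * lyap b))"
      by (intro sums_diff sums_mult phi_sums summable_sums hs L)
    have s2: "(\<lambda>b. G * phi m1 b - (if b = 0 then G * phi m1 0 else 0)) sums (G * 1 - G * phi m1 0)"
      by (intro sums_diff sums_mult phi_sums sums_if_eq)
    have "g m1 \<le> (\<Sum>b. phi m1 b * h b) - H * 1 - e * (\<Sum>b. phi m1 b * lyap b)"
      unfolding g_def using hP[of m1] mult_left_mono[OF L(2) less_imp_le[OF e]] by linarith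
    also have "\<dots> \<le> G * 1 - G * phi m1 0"
    proof (rule sums_le[OF _ s1 s2])
      fix b
      have "phi m1 b * h b - H * phi m1 b - e * (phi m1 b * lyap b) = phi m1 b * g b"
        by (simp add: g_def algebra_simps)
      also have "\<dots> \<le> G * phi m1 b - (if b = 0 then G * phi m1 0 else 0)"
        using mult_left_mono[OF GG[of b] phi_nonneg[of m1 b]] mult_left_mono[OF g0 phi_nonneg[of m1 0]]
        by (auto simp: mult.commute)
      finally show "phi m1 b * h b - H * phi m1 b - e * (phi m1 b * lyap b)
        \<le> G * phi m1 b - (if b = 0 then G * phi m1 0 else 0)" .
    qed
    finally have "G * phi m1 0 \<le> 0" using m1 by simp
    then show False using G0 phi_m0_pos[of m1] by (simp add: mult_le_0_iff)
  qed
  have hH: "h m \<le> H" for m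
  proof (rule field_le_epsilon)
    fix e :: real assume e: "e > 0"
    have "h m \<le> H + e / (1 + lyap m) * lyap m"
      using e lyap_nonneg[of m] by (intro step) (simp add: add_pos_nonneg)
    also have "e / (1 + lyap m) * lyap m \<le> e"
      using e lyap_nonneg[of m] by (simp add: field_simps)
    finally show "h m \<le> H + e" by simp
  qed
  have "H \<in> h ` {..m0}" unfolding H_def by (intro Max_in) auto
  then obtain k where k: "h k = H" by auto
  have s2: "(\<lambda>b. H * phi k b - (if b = 0 then H * phi k 0 else 0)) sums (H * 1 - H * phi k 0)"
    by (intro sums_diff sums_mult phi_sums sums_if_eq)
  have "H \<le> (\<Sum>b. phi k b * h b)" using hP[of k] k by simp
  also have "\<dots> \<le> H * 1 - H * phi k 0"
  proof (rule sums_le[OF _ summable_sums[OF hs] s2])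
    fix b show "phi k b * h b \<le> H * phi k b - (if b = 0 then H * phi k 0 else 0)"
      using mult_left_mono[OF hH[of b] phi_nonneg[of k b]] by (auto simp: mult.commute h0)
  qed
  finally have "H * phi k 0 \<le> 0" by simp
  then have "H \<le> 0" using phi_m0_pos[of k] by (simp add: mult_le_0_iff)
  then have "h m = 0" using hH[of m] h(1)[of m] by simp
  then show ?thesis using l(1)[of m] by (simp add: h_def)
qed

text \<open>The truncated power \<open>f\<close> is superharmonic at every size: up to
  \<open>m0\<close> it equals 1, its upper bound, and beyond \<open>m0\<close> both arguments of the
  minimum are superharmonic. It dominates \<open>extinct\<close> and falls below 1 at some
  \<open>k\<close>, which one generation from 1 reaches with positive probability.\<close>

lemma extinct_1_bounded:
  assumes "rho > nu / 2"
  shows "\<exists>c<1. \<forall>n. extinct n 1 \<le> c"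
proof -
  obtain \<alpha> m0 where a: "\<alpha> > 0" and m0: "\<And>m. m \<ge> m0 \<Longrightarrow> summable (\<lambda>b. phi m b * (real b + 1) powr (-\<alpha>)) \<and>
    (\<Sum>b. phi m b * (real b + 1) powr (-\<alpha>)) \<le> (real m + 1) powr (-\<alpha>)"
    using powr_superharmonic[OF assms] by blast
  define C where "C = (real m0 + 1) powr \<alpha>"
  define f where "f m = min 1 (C * (real m + 1) powr (-\<alpha>))" for m
  have C0: "C > 0" by (simp add: C_def)
  have f01: "0 \<le> f m" "f m \<le> 1" for m using C0 by (auto simp: f_def)
  have fsmall: "f m = 1" if "m \<le> m0" for m
  proof -
    have "(real m0 + 1) powr (-\<alpha>) \<le> (real m + 1) powr (-\<alpha>)" using that a by (intro powr_mono2') auto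
    then have "C * (real m0 + 1) powr (-\<alpha>) \<le> C * (real m + 1) powr (-\<alpha>)" using C0 by (intro mult_left_mono) auto
    moreover have "C * (real m0 + 1) powr (-\<alpha>) = 1" by (simp add: C_def flip: powr_add)
    ultimately show ?thesis by (simp add: f_def)
  qed
  have fs: "summable (\<lambda>b. phi m b * f b)" for m by (rule phi_summable_mult) (use f01 in auto)
  have Pf: "(\<Sum>b. phi m b * f b) \<le> f m" for m
  proof (cases "m \<ge> m0")
    case False
    have "(\<Sum>b. phi m b * f b) \<le> (\<Sum>b. phi m b)"
      using fs f01 phi_sums by (intro suminf_le) (auto simp: mult_left_le phi_nonneg sums_iff)
    then show ?thesis using fsmall False by (simp add: phi_suminf)
  next
    case True
    have 1: "(\<Sum>b. phi m b * f b) \<le> (\<Sum>b. phi m b)"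
      using fs f01 phi_sums by (intro suminf_le) (auto simp: mult_left_le phi_nonneg sums_iff)
    have "(\<Sum>b. phi m b * f b) \<le> (\<Sum>b. C * (phi m b * (real b + 1) powr (-\<alpha>)))"
    proof (intro suminf_le fs summable_mult)
      show "phi m b * f b \<le> C * (phi m b * (real b + 1) powr (-\<alpha>))" for b
        using mult_left_mono[of "f b" "C * (real b + 1) powr (-\<alpha>)" "phi m b"] phi_nonneg[of m b]
        by (simp add: f_def mult_ac)
    qed (use m0[OF True] in auto)
    also have "\<dots> = C * (\<Sum>b. phi m b * (real b + 1) powr (-\<alpha>))"
      using m0[OF True] by (intro suminf_mult) auto
    also have "\<dots> \<le> C * (real m + 1) powr (-\<alpha>)" using m0[OF True] C0 by (intro mult_left_mono) auto
    finally show ?thesis using 1 by (simp add: f_def phi_suminf)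
  qed
  have extf: "extinct n m \<le> f m" for n m
  proof (induction n arbitrary: m)
    case 0 show ?case using fsmall[of 0] f01[of m] by simp
  next
    case (Suc n)
    have "extinct (Suc n) m \<le> (\<Sum>b. phi m b * f b)" unfolding extinct.simps
      using Suc by (intro suminf_le extinct_summable fs mult_left_mono phi_nonneg)
    with Pf[of m] show ?case by simp
  qed
  have "((\<lambda>m::nat. C * (real m + 1) powr (-\<alpha>)) \<longlongrightarrow> C * 0) sequentially"
  proof (intro tendsto_mult tendsto_const tendsto_neg_powr)
    show "filterlim (\<lambda>m::nat. real m + 1) at_top sequentially" by real_asymp
  qed (use a in simp)
  then have "eventually (\<lambda>m::nat. C * (real m + 1) powr (-\<alpha>) < 1) sequentially"
    by (intro order_tendstoD) auto
  then obtain k where "C * (real k + 1) powr (-\<alpha>) < 1" unfolding eventually_sequentially by blast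
  then have k: "f k < 1" by (simp add: f_def)
  define c where "c = 1 - (1 - f k) * phi 1 k"
  have c: "c < 1" using k phi_1_pos[of k] by (simp add: c_def)
  have "extinct n 1 \<le> c" for n
  proof -
    have s2: "(\<lambda>b. phi 1 b - (if b = k then (1 - f k) * phi 1 k else 0)) sums c"
      unfolding c_def by (intro sums_diff phi_sums sums_if_eq)
    have "extinct n 1 \<le> extinct (Suc n) 1" by (rule extinct_incseq)
    also have "\<dots> \<le> c" unfolding extinct.simps
    proof (rule sums_le[OF _ summable_sums[OF extinct_summable] s2])
      fix b
      have "phi 1 b * extinct n b \<le> phi 1 b * (if b = k then f k else 1)"
        using extf[of n k] extinct_bounds[of n b] by (intro mult_left_mono phi_nonneg) auto
      then show "phi 1 b * extinct n b \<le> phi 1 b - (if b = k then (1 - f k) * phi 1 k else 0)"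
        by (auto simp: algebra_simps split: if_splits)
    qed
    finally show ?thesis .
  qed
  with c show ?thesis by blast
qed

end

section \<open>The walk driven by a fixed array of coins\<close>

primrec lefts :: "(nat \<Rightarrow> bool) \<Rightarrow> nat \<Rightarrow> nat" where
  "lefts c 0 = 0" | "lefts c (Suc n) = lefts c n + (if c n then 0 else 1)"

primrec rights :: "(nat \<Rightarrow> bool) \<Rightarrow> nat \<Rightarrow> nat" where
  "rights c 0 = 0" | "rights c (Suc n) = rights c n + (if c n then 1 else 0)"

lemma lefts_plus_rights: "lefts c n + rights c n = n"
  by (induction n) auto

lemma lefts_mono: "m \<le> n \<Longrightarrow> lefts c m \<le> lefts c n"
  by (rule lift_Suc_mono_le[of "lefts c"]) auto

lemma rights_mono: "m \<le> n \<Longrightarrow> rights c m \<le> rights c n"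
  by (rule lift_Suc_mono_le[of "rights c"]) auto

text \<open>The last of the \<open>m + b\<close> coins has to be left; this makes \<open>b\<close>
  unique and leaves \<open>b = 0\<close> as the only choice for \<open>m = 0\<close>.\<close>

definition rights_before :: "(nat \<Rightarrow> bool) \<Rightarrow> nat \<Rightarrow> nat \<Rightarrow> bool" where
  "rights_before c m b \<longleftrightarrow> lefts c (m + b) = m \<and> (0 < m + b \<longrightarrow> \<not> c (m + b - 1))"

lemma rights_before_unique:
  assumes "rights_before c m b" "rights_before c m b'" shows "b = b'"
proof -
  have False if "rights_before c m b" "rights_before c m b'" "b < b'" for b b'
  proof -
    have "lefts c (m + b') = lefts c (m + b' - 1) + 1"
      using that(2,3) unfolding rights_before_def by (cases "m + b'") auto
    moreover have "lefts c (m + b) \<le> lefts c (m + b' - 1)" using that(3) by (intro lefts_mono) auto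
    ultimately show False using that(1,2) by (simp add: rights_before_def)
  qed
  with assms show ?thesis by (meson linorder_neqE_nat)
qed

lemma rights_before_0: "rights_before c 0 b \<longleftrightarrow> b = 0"
proof
  assume b: "rights_before c 0 b"
  show "b = 0"
  proof (cases b)
    case (Suc n)
    then show ?thesis using b by (simp add: rights_before_def split: if_splits)
  qed
qed (simp add: rights_before_def)

text \<open>Sites play the role of generations: \<open>m\<close> left steps demanded at
  \<open>k\<close> yield \<open>b\<close> right steps there, which are the left steps demanded at
  \<open>k + 1\<close>. If the column at \<open>k\<close> has fewer than \<open>m\<close> left
  coins, no such \<open>b\<close> exists.\<close>

fun dies :: "(int \<Rightarrow> nat \<Rightarrow> bool) \<Rightarrow> int \<Rightarrow> nat \<Rightarrow> nat \<Rightarrow> bool" where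
  "dies c k 0 m \<longleftrightarrow> m = 0"
| "dies c k (Suc n) m \<longleftrightarrow> (\<exists>b. rights_before (c k) m b \<and> dies c (k + 1) n b)"

text \<open>State of the coin-driven walk: position and number of coins already used at each site.\<close>
primrec walk :: "(int \<Rightarrow> nat \<Rightarrow> bool) \<Rightarrow> int \<times> (int \<Rightarrow> nat) \<Rightarrow> nat \<Rightarrow> int \<times> (int \<Rightarrow> nat)" where
  "walk c s 0 = s"
| "walk c s (Suc n) = (let (x, L) = walk c s n in (if c x (L x) then x + 1 else x - 1, L(x := Suc (L x))))"

abbreviation "pos c s n \<equiv> fst (walk c s n)"
abbreviation "used c s n \<equiv> snd (walk c s n)"

section \<open>Edge crossings of the coin-driven walk\<close>

lemma pos_Suc: "pos c s (Suc n) = (if c (pos c s n) (used c s n (pos c s n)) then pos c s n + 1 else pos c s n - 1)"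
  by (simp add: Let_def split: prod.split)

lemma used_Suc: "used c s (Suc n) x = (if x = pos c s n then Suc (used c s n x) else used c s n x)"
  by (simp add: Let_def split: prod.split)

declare walk.simps(2) [simp del]

lemma walk_add: "walk c s (m + n) = walk c (walk c s m) n"
  by (induction n) (auto simp: walk.simps(2))

lemma abs_pos_diff: "\<bar>pos c s (Suc n) - pos c s n\<bar> = 1"
  by (simp add: pos_Suc)

text \<open>Conservation of crossings of the edge between \<open>x - 1\<close> and \<open>x\<close>.\<close>
lemma flow:
  assumes "snd s (x - 1) = 0" "snd s x = 0"
  shows "rights (c (x - 1)) (used c s n (x - 1)) + (if x \<le> fst s then 1 else 0)
    = lefts (c x) (used c s n x) + (if x \<le> pos c s n then 1 else 0)"
proof (induction n)
  case (Suc n)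
  consider "pos c s n = x - 1" | "pos c s n = x" | "pos c s n < x - 1" | "pos c s n > x" by linarith
  then show ?case using Suc by cases (auto simp: pos_Suc used_Suc)
qed (use assms in auto)

text \<open>As long as the walk has stayed at or above \<open>x\<close>, nothing enters
  \<open>x\<close> from the left, so the balance involves left steps from \<open>x\<close> alone.
  The range \<open>j < n\<close> admits a first step below \<open>x\<close> at time
  \<open>n\<close>.\<close>

lemma flow_boundary:
  assumes "snd s x = 0"
  shows "(\<forall>j<n. x \<le> pos c s j) \<Longrightarrow> (if x \<le> fst s then 1 else 0)
    = lefts (c x) (used c s n x) + (if x \<le> pos c s n then 1 else 0)"
proof (induction n)
  case (Suc n)
  then have "x \<le> pos c s n" by simp
  then consider "pos c s n = x" | "pos c s n > x" by linarith
  then show ?case using Suc by cases (auto simp: pos_Suc used_Suc)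
qed (use assms in auto)

text \<open>After its last departure from \<open>x\<close> the walk remains on the side chosen by
  the coin used there.\<close>

lemma last_coin:
  assumes "snd s x = 0"
  shows "used c s n x > 0 \<Longrightarrow> pos c s n \<noteq> x \<Longrightarrow> c x (used c s n x - 1) \<longleftrightarrow> pos c s n > x"
proof (induction n)
  case (Suc n)
  show ?case
  proof (cases "pos c s n = x")
    case True
    then show ?thesis using Suc.prems by (auto simp: pos_Suc used_Suc split: if_splits)
  next
    case False
    then have u: "used c s (Suc n) x = used c s n x" by (simp add: used_Suc)
    have "pos c s (Suc n) > x \<longleftrightarrow> pos c s n > x"
      using False Suc.prems(2) by (auto simp: pos_Suc split: if_splits)
    then show ?thesis using Suc.IH Suc.prems False u by simp
  qed
qed (use assms in simp)

lemma pos_le: "pos c s n \<le> fst s + int n"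
  by (induction n) (auto simp: pos_Suc split: if_splits)

lemma used_eq_0:
  assumes "snd s x = 0" "x > fst s + int n" shows "used c s n x = 0"
  using assms(2)
proof (induction n)
  case (Suc n)
  then show ?case using pos_le[of c s n] by (auto simp: used_Suc)
qed (use assms in simp)

text \<open>At the first visit to \<open>k - 1\<close>, right steps from \<open>x\<close> are
  matched by left steps from \<open>x + 1\<close>, and the last coin used at each visited
  \<open>x \<ge> k\<close> was left. The numbers of left steps thus follow the branching recursion,
  starting with 1 at \<open>k\<close>, and vanish at sites not yet reached.\<close>

lemma hits_left_imp_dies:
  assumes fresh: "\<And>y. y \<ge> k \<Longrightarrow> snd s y = 0" and start: "fst s = k" and hit: "pos c s n = k - 1"
  shows "\<exists>N. dies c k N 1"
proof -
  define T where "T = (LEAST n. pos c s n = k - 1)"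
  have T: "pos c s T = k - 1" unfolding T_def by (rule LeastI[of _ n]) (rule hit)
  have "pos c s j \<ge> k" if "j < T" for j using that
  proof (induction j)
    case (Suc j)
    moreover have "pos c s (Suc j) \<noteq> k - 1" using Suc.prems not_less_Least unfolding T_def by blast
    ultimately show ?case using abs_pos_diff[of c s j] by linarith
  qed (use start in simp)
  then have l1: "lefts (c k) (used c s T k) = 1"
    using flow_boundary[of s k T c] fresh start T by auto
  have lr: "rights (c (x - 1)) (used c s T (x - 1)) = lefts (c x) (used c s T x)" if "x > k" for x
    using flow[of s x c T] fresh that start T by auto
  have rb: "rights_before (c x) (lefts (c x) (used c s T x)) (rights (c x) (used c s T x))" if "x \<ge> k" for x
    using last_coin[of s x c T] fresh[OF that] that T unfolding rights_before_def lefts_plus_rights by auto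
  have "x \<ge> k \<Longrightarrow> x + int N > k + int T \<Longrightarrow> dies c x N (lefts (c x) (used c s T x))" for x N
  proof (induction N arbitrary: x)
    case 0
    then show ?case using used_eq_0[of s x T c] fresh start by simp
  next
    case (Suc N)
    have "dies c (x + 1) N (lefts (c (x + 1)) (used c s T (x + 1)))"
      using Suc.prems by (intro Suc.IH) auto
    then show ?case using rb[OF Suc.prems(1)] lr[of "x + 1"] Suc.prems(1) by auto
  qed
  from this[of k "T + 1"] have "dies c k (T + 1) 1" unfolding l1 by simp
  then show ?thesis by blast
qed

text \<open>\<open>D\<close> and \<open>S\<close> prescribe left and right steps at each site. A
  walk avoiding \<open>z\<close> never uses more than \<open>D x + S x\<close> coins at
  \<open>x\<close>, and these budgets have a finite total over the sites it can visit; but every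
  step uses a coin.\<close>

lemma extinct_imp_hits_left:
  fixes D S :: "int \<Rightarrow> nat"
  assumes fresh: "\<And>y. snd s y = 0" and z: "z < fst s"
    and rb: "\<And>x. x > z \<Longrightarrow> rights_before (c x) (D x) (S x)"
    and D1: "D (z + 1) = 1"
    and DS: "\<And>x. x > z \<Longrightarrow> D (x + 1) = S x + (if x + 1 \<le> fst s then 1 else 0)"
    and K: "\<And>x. x \<ge> K \<Longrightarrow> S x = 0" "K \<ge> fst s"
  shows "\<exists>n. pos c s n = z"
proof (rule ccontr)
  assume "\<nexists>n. pos c s n = z"
  then have nz: "pos c s n \<noteq> z" for n by blast
  have gt: "pos c s n > z" for n
  proof (induction n)
    case (Suc n)
    then show ?case using abs_pos_diff[of c s n] nz[of "Suc n"] by linarith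
  qed (use z in simp)
  have lD: "lefts (c x) (D x + S x) = D x" "rights (c x) (D x + S x) = S x" if "x > z" for x
    using rb[OF that] lefts_plus_rights[of "c x" "D x + S x"] by (auto simp: rights_before_def)
  have usedz: "used c s n z = 0" for n
    by (induction n) (use fresh nz in \<open>auto simp: used_Suc\<close>)
  have bound: "x > z \<Longrightarrow> used c s n x \<le> D x + S x" for n x
  proof (induction n arbitrary: x)
    case (Suc n)
    show ?case
    proof (cases "x = pos c s n \<and> used c s n x = D x + S x")
      case False
      then show ?thesis using Suc.IH[OF Suc.prems] by (auto simp: used_Suc)
    next
      \<comment> \<open>The walk stands at \<open>x\<close> with its budget spent. The flow identity
        then requires more arrivals from \<open>x - 1\<close> than \<open>S (x - 1)\<close> provides
        or, for \<open>x = z + 1\<close>, an arrival from \<open>z\<close>, which is never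
        visited.\<close>
      case True
      then have l: "lefts (c x) (used c s n x) = D x" using lD(1)[OF Suc.prems] by metis
      have f: "rights (c (x - 1)) (used c s n (x - 1)) + (if x \<le> fst s then 1 else 0) = D x + 1"
        using flow[of s x c n] fresh True l by simp
      show ?thesis
      proof (cases "x = z + 1")
        case True
        then show ?thesis using f usedz D1 by (simp split: if_splits)
      next
        case False
        then have x: "x - 1 > z" using Suc.prems by simp
        have "rights (c (x - 1)) (used c s n (x - 1)) \<le> S (x - 1)"
          using rights_mono[OF Suc.IH[OF x], of "c (x - 1)"] lD(2)[OF x] by simp
        then show ?thesis using f DS[OF x] by simp
      qed
    qed
  qed (use fresh in simp)
  have D0: "D x = 0" if "x > K" for x
    using DS[of "x - 1"] K that z by simp
  have le: "pos c s n \<le> K" for n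
  proof (rule ccontr)
    assume "\<not> pos c s n \<le> K"
    then have "used c s (Suc n) (pos c s n) = 0"
      using bound[of "pos c s n" "Suc n"] D0 K(1)[of "pos c s n"] gt[of n] by simp
    then show False by (simp add: used_Suc)
  qed
  \<comment> \<open>Each time step consumes exactly one coin, at a site in
    \<open>{z+1..K}\<close>.\<close>
  have sum: "(\<Sum>x\<in>{z+1..K}. used c s n x) = n" for n
  proof (induction n)
    case (Suc n)
    have "(\<Sum>x\<in>{z+1..K}. used c s (Suc n) x) = (\<Sum>x\<in>{z+1..K}. used c s n x + (if x = pos c s n then 1 else 0))"
      by (intro sum.cong) (auto simp: used_Suc)
    also have "\<dots> = Suc n" using Suc gt[of n] le[of n] by (simp add: sum.distrib)
    finally show ?case .
  qed (use fresh in simp)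
  have "(\<Sum>x\<in>{z+1..K}. used c s n x) \<le> (\<Sum>x\<in>{z+1..K}. D x + S x)" for n
    by (intro sum_mono bound) auto
  then have "n \<le> (\<Sum>x\<in>{z+1..K}. D x + S x)" for n by (simp only: sum)
  from this[of "Suc (\<Sum>x\<in>{z+1..K}. D x + S x)"] show False by simp
qed

abbreviation origin :: "int \<times> (int \<Rightarrow> nat)" where "origin \<equiv> (0, \<lambda>_. 0)"

text \<open>A profile is built from left to right, starting with a single left step at
  \<open>z + 1\<close>. Up to the origin one left step is added per site, because edges left of the
  start are crossed once more leftwards than rightwards; beyond it this is the pure branching
  process, which dies from any size.\<close>

lemma hits_negative:
  assumes total: "\<And>x m. \<exists>b. rights_before (c x) m b"
    and dies: "\<And>m. \<exists>N. dies c 1 N m"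
    and z: "z < 0"
  shows "\<exists>n. pos c origin n = z"
proof -
  obtain F where F: "\<And>x m. rights_before (c x) m (F x m)" using total by metis
  define Dn where "Dn = rec_nat 1 (\<lambda>n d. F (z + 1 + int n) d + (if z + 1 + int n + 1 \<le> 0 then 1 else 0 :: nat))"
  have Dn: "Dn 0 = 1" "Dn (Suc n) = F (z + 1 + int n) (Dn n) + (if z + 1 + int n + 1 \<le> 0 then 1 else 0)" for n
    by (auto simp: Dn_def)
  define D where "D x = Dn (nat (x - z - 1))" for x
  define S where "S x = F x (D x)" for x
  have DS: "D (x + 1) = S x + (if x + 1 \<le> 0 then 1 else 0)" if "x > z" for x
  proof -
    have "nat (x + 1 - z - 1) = Suc (nat (x - z - 1))" "z + 1 + int (nat (x - z - 1)) = x" using that by auto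
    then show ?thesis unfolding S_def D_def by (simp only: Dn)
  qed
  have rb: "rights_before (c x) (D x) (S x)" for x unfolding S_def by (rule F)
  have S0: "S x = 0" if "D x = 0" for x using rb[of x] that by (simp add: rights_before_0)
  obtain N where N: "dies c 1 N (D 1)" using dies by blast
  have "k \<ge> 1 \<Longrightarrow> dies c k N (D k) \<Longrightarrow> D (k + int N) = 0" for k N
  proof (induction N arbitrary: k)
    case (Suc N)
    then obtain b where b: "rights_before (c k) (D k) b" "dies c (k + 1) N b" by auto
    have "b = S k" using rights_before_unique[OF b(1) rb] .
    then have "b = D (k + 1)" using DS[of k] Suc.prems(1) z by simp
    then have "D (k + 1 + int N) = 0" using Suc.IH[of "k + 1"] b(2) Suc.prems(1) by simp
    then show ?case by (simp add: algebra_simps)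
  qed simp
  from this[OF _ N] have DN: "D (1 + int N) = 0" by simp
  have "D (1 + int N + int j) = 0" for j
  proof (induction j)
    case (Suc j)
    then have "S (1 + int N + int j) = 0" by (rule S0)
    then show ?case using DS[of "1 + int N + int j"] z by (simp add: algebra_simps)
  qed (use DN in simp)
  then have D0: "D x = 0" if "x \<ge> 1 + int N" for x
    using that zle_iff_zadd[of "1 + int N" x] by auto
  show ?thesis
  proof (rule extinct_imp_hits_left[where D = D and S = S and K = "1 + int N"])
    show "D (z + 1) = 1" by (simp add: D_def Dn)
    show "D (x + 1) = S x + (if x + 1 \<le> fst origin then 1 else 0)" if "x > z" for x
      unfolding fst_conv by (rule DS[OF that])
    show "S x = 0" if "1 + int N \<le> x" for x by (rule S0[OF D0[OF that]])
    show "z < fst origin" using z by simp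
  qed (simp_all add: rb)
qed

text \<open>At the first visit to a surviving level \<open>k\<close> all sites from \<open>k\<close>
  on are fresh, so a later visit to \<open>k - 1\<close> would mean extinction. The walk stays at or
  above \<open>k\<close>, and such \<open>k\<close> are arbitrarily large.\<close>

lemma transient_right:
  assumes hits: "\<And>k. k \<ge> 0 \<Longrightarrow> \<exists>n. pos c origin n = k"
    and survives: "\<And>B. \<exists>k\<ge>B. \<forall>N. \<not> dies c k N 1"
  shows "filterlim (pos c origin) at_top sequentially"
  unfolding filterlim_at_top
proof
  fix B :: int
  obtain k where k: "k \<ge> max B 0" "\<And>N. \<not> dies c k N 1" using survives[of "max B 0"] by auto
  define T where "T = (LEAST n. pos c origin n = k)"
  have T: "pos c origin T = k" unfolding T_def by (rule LeastI_ex[OF hits]) (use k(1) in simp)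
  have nk: "pos c origin j \<noteq> k" if "j < T" for j
    using not_less_Least[of j "\<lambda>n. pos c origin n = k"] that unfolding T_def by simp
  have before: "j < T \<Longrightarrow> pos c origin j < k" for j
  proof (induction j)
    case 0
    then show ?case using nk[OF 0] k(1) by simp
  next
    case (Suc j)
    then show ?case using nk[OF Suc.prems] abs_pos_diff[of c origin j] by linarith
  qed
  have fresh: "used c origin T y = 0" if y: "y \<ge> k" for y
  proof -
    have "j \<le> T \<Longrightarrow> used c origin j y = 0" for j
    proof (induction j)
      case (Suc j)
      then show ?case using before[of j] y by (simp add: used_Suc)
    qed simp
    then show ?thesis by simp
  qed
  have "pos c (walk c origin T) j \<ge> k" for j
  proof (induction j)
    case (Suc j)
    have "pos c (walk c origin T) (Suc j) \<noteq> k - 1"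
      using hits_left_imp_dies[of k "walk c origin T" c "Suc j"] fresh T k(2) by blast
    then show ?case using Suc abs_pos_diff[of c "walk c origin T" j] by linarith
  qed (use T in simp)
  then have "pos c origin n \<ge> B" if "n \<ge> T" for n
  proof -
    have "walk c origin n = walk c (walk c origin T) (n - T)"
      using walk_add[of c origin T "n - T"] that by simp
    then show ?thesis using \<open>\<And>j. pos c (walk c origin T) j \<ge> k\<close>[of "n - T"] k(1) by simp
  qed
  then show "\<forall>\<^sub>F n in sequentially. B \<le> pos c origin n"
    by (auto simp: eventually_sequentially)
qed

section \<open>Random coins\<close>

lemma (in product_prob_space) measure_PiM_Collect:
  assumes "J \<subseteq> I" "finite J" "\<And>i. i \<in> J \<Longrightarrow> X i \<in> sets (M i)"
  shows "measure (PiM I M) {x\<in>space (PiM I M). \<forall>i\<in>J. x i \<in> X i} = (\<Prod>i\<in>J. measure (M i) (X i))"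
proof -
  have "{x\<in>space (PiM I M). \<forall>i\<in>J. x i \<in> X i} = prod_emb I M J (PiE J X)"
    unfolding prod_emb_def using assms by (auto simp: space_PiM Pi_iff)
  with measure_PiM_emb[OF assms] show ?thesis by simp
qed

abbreviation coin_space :: "(nat \<Rightarrow> bool) measure" where
  "coin_space \<equiv> PiM UNIV (\<lambda>_. count_space UNIV)"

lemma space_PiM_UNIV: "space (PiM UNIV M) = UNIV" if "\<And>i. space (M i) = UNIV"
  using that by (auto simp: space_PiM PiE_UNIV_domain)

lemma space_coin_space: "space coin_space = UNIV"
  by (rule space_PiM_UNIV) simp

definition agree :: "(nat \<Rightarrow> bool) \<Rightarrow> bool list \<Rightarrow> bool" where
  "agree c l \<longleftrightarrow> (\<forall>j<length l. c j = l ! j)"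

lemma agree_Nil: "agree c []" by (simp add: agree_def)

lemma agree_snoc: "agree c (l @ [b]) \<longleftrightarrow> agree c l \<and> c (length l) = b"
  by (auto simp: agree_def nth_append less_Suc_eq)

lemma agree_iff_map: "agree c l \<longleftrightarrow> map c [0..<length l] = l"
  unfolding agree_def list_eq_iff_nth_eq by simp

lemma agree_sets: "{c. agree c l} \<in> sets coin_space"
proof -
  have "{c \<in> space coin_space. \<forall>j\<in>{..<length l}. c j = l ! j} \<in> sets coin_space"
  proof (intro sets.sets_Collect_finite_All)
    fix j
    show "{c \<in> space coin_space. c j = l ! j} \<in> sets coin_space"
      using measurable_sets[OF measurable_component_singleton[of j UNIV "\<lambda>_. count_space UNIV"], of "{l ! j}"]
      by (simp add: vimage_def Int_def conj_commute)
  qed simp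
  then show ?thesis by (simp add: space_coin_space agree_def Ball_def)
qed

lemma measure_uniform_lessThan:
  fixes t :: real
  assumes "0 \<le> t" "t \<le> 1"
  shows "measure (uniform_measure lborel {0..<1}) {..<t} = t"
proof -
  have "{0..<1} \<inter> {..<t} = {0..<t}" using assms by auto
  then show ?thesis using assms by simp
qed

text \<open>The coins are generated successively from independent uniform variables, each coin being
  compared with the conditional probability of \<open>True\<close> given the preceding coins.\<close>
lemma ex_coin_measure:
  fixes w :: "bool list \<Rightarrow> real"
  assumes w1: "w [] = 1" and w0: "\<And>l. w l \<ge> 0" and wadd: "\<And>l. w (l @ [True]) + w (l @ [False]) = w l"
  shows "\<exists>C. prob_space C \<and> sets C = sets coin_space \<and> (\<forall>l. measure C {c. agree c l} = w l)"
proof -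
  define U :: "real measure" where "U = uniform_measure lborel {0..<1}"
  have setsU: "sets U = sets borel" and spaceU: "space U = UNIV" by (simp_all add: U_def)
  interpret U: prob_space U unfolding U_def by (rule prob_space_uniform_measure) auto
  interpret P: product_prob_space "\<lambda>_::nat. U" UNIV by unfold_locales
  define PU where "PU = PiM (UNIV :: nat set) (\<lambda>_. U)"
  have spaceP: "space PU = UNIV" unfolding PU_def by (rule space_PiM_UNIV) (simp add: spaceU)
  interpret PU: prob_space PU unfolding PU_def by (rule P.prob_space_axioms)
  \<comment> \<open>If \<open>w l = 0\<close> the quotient is 0 by convention; both extensions of
    \<open>l\<close> then have weight 0 as well, so the product formula persists.\<close>
  define thr where "thr l = w (l @ [True]) / w l" for l
  define cl where "cl u = rec_nat [] (\<lambda>n l. l @ [u n < thr l])" for u :: "nat \<Rightarrow> real"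
  have cl: "cl u 0 = []" "cl u (Suc n) = cl u n @ [u n < thr (cl u n)]" for u n by (simp_all add: cl_def)
  define coin where "coin u n = (u n < thr (cl u n))" for u :: "nat \<Rightarrow> real" and n
  have clm: "cl u n = map (coin u) [0..<n]" for u n by (induction n) (auto simp: cl coin_def)
  have thr: "0 \<le> thr l" "thr l \<le> 1" for l
    using w0[of l] w0[of "l @ [True]"] w0[of "l @ [False]"] wadd[of l]
    by (auto simp: thr_def divide_le_eq_1)
  \<comment> \<open>The set in which the \<open>j\<close>-th uniform variable must lie for the coins
    to begin with \<open>l\<close>. Earlier coins enter only through \<open>l\<close> itself, so the
    event is a box.\<close>
  define I where "I l j = (if l ! j then {..<thr (take j l)} else {thr (take j l)..})" for l j
  have Isets: "I l j \<in> sets U" for l j by (simp add: I_def setsU)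
  have agree: "agree (coin u) l \<longleftrightarrow> (\<forall>j\<in>{..<length l}. u j \<in> I l j)" for u l
  proof (induction l rule: rev_induct)
    case (snoc b l)
    have "agree (coin u) (l @ [b]) \<longleftrightarrow> (\<forall>j\<in>{..<length l}. u j \<in> I l j) \<and> agree (coin u) l \<and> coin u (length l) = b"
      using snoc by (auto simp: agree_snoc)
    also have "\<dots> \<longleftrightarrow> (\<forall>j\<in>{..<length l}. u j \<in> I l j) \<and> agree (coin u) l \<and> u (length l) \<in> I (l @ [b]) (length l)"
      unfolding agree_iff_map clm[symmetric] coin_def I_def by (auto simp: nth_append)
    also have "(\<forall>j\<in>{..<length l}. u j \<in> I l j) \<longleftrightarrow> (\<forall>j\<in>{..<length l}. u j \<in> I (l @ [b]) j)"
      by (auto simp: I_def nth_append)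
    also have "\<dots> \<and> agree (coin u) l \<and> u (length l) \<in> I (l @ [b]) (length l)
       \<longleftrightarrow> (\<forall>j\<in>{..<length l}. u j \<in> I (l @ [b]) j) \<and> u (length l) \<in> I (l @ [b]) (length l)"
      using snoc by (auto simp: I_def nth_append)
    also have "\<dots> \<longleftrightarrow> (\<forall>j\<in>{..<length (l @ [b])}. u j \<in> I (l @ [b]) j)"
      by (auto simp: less_Suc_eq)
    finally show ?case .
  qed (simp add: agree_Nil)
  have mU: "w l * measure U (if b then {..<thr l} else {thr l..}) = w (l @ [b])" for l b
  proof -
    have t: "measure U {..<thr l} = thr l" using measure_uniform_lessThan[OF thr] by (simp add: U_def)
    have "{thr l..} = space U - {..<thr l}" by (auto simp: spaceU)
    then have t': "measure U {thr l..} = 1 - thr l" using t U.prob_compl[of "{..<thr l}"] by (simp add: setsU)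
    have m: "w l * thr l = w (l @ [True])"
      using w0[of l] w0[of "l @ [True]"] w0[of "l @ [False]"] wadd[of l] by (auto simp: thr_def)
    then have "w l * (1 - thr l) = w (l @ [False])" using wadd[of l] by (simp add: algebra_simps)
    with m show ?thesis by (cases b) (simp_all only: t t' if_True if_False)
  qed
  have prodI: "(\<Prod>j\<in>{..<length l}. measure U (I l j)) = w l" for l
  proof (induction l rule: rev_induct)
    case (snoc b l)
    have "(\<Prod>j\<in>{..<length l}. measure U (I (l @ [b]) j)) = (\<Prod>j\<in>{..<length l}. measure U (I l j))"
      by (intro prod.cong) (auto simp: I_def nth_append)
    moreover have "I (l @ [b]) (length l) = (if b then {..<thr l} else {thr l..})"
      by (simp add: I_def nth_append)
    ultimately show ?case using snoc mU[of l b] by simp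
  qed (simp add: w1)
  have box: "measure PU {u. agree (coin u) l} = w l" "{u. agree (coin u) l} \<in> sets PU" for l
  proof -
    have e: "{u. agree (coin u) l} = {u \<in> space PU. \<forall>j\<in>{..<length l}. u j \<in> I l j}"
      by (simp add: agree spaceP)
    show "measure PU {u. agree (coin u) l} = w l"
      unfolding e unfolding PU_def by (subst P.measure_PiM_Collect) (auto simp: Isets prodI)
    show "{u. agree (coin u) l} \<in> sets PU" unfolding e unfolding PU_def
    proof (intro sets.sets_Collect_finite_All)
      fix j assume "j \<in> {..<length l}"
      show "{u \<in> space (PiM UNIV (\<lambda>_. U)). u j \<in> I l j} \<in> sets (PiM UNIV (\<lambda>_. U))"
        using measurable_sets[OF measurable_component_singleton[of j UNIV "\<lambda>_. U"] Isets[of l j]]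
        by (simp add: vimage_def Int_def conj_commute)
    qed simp
  qed
  have meas: "coin \<in> measurable PU coin_space"
  proof (rule measurable_PiM_single')
    fix j :: nat
    show "(\<lambda>u. coin u j) \<in> measurable PU (count_space UNIV)"
    proof (rule measurableI)
      fix A :: "bool set"
      have "(\<lambda>u. coin u j) -` A \<inter> space PU = (\<Union>l\<in>{l. length l = Suc j \<and> l ! j \<in> A}. {u. agree (coin u) l})"
      proof (safe; simp add: spaceP)
        fix u assume "coin u j \<in> A"
        then show "\<exists>l. length l = Suc j \<and> l ! j \<in> A \<and> agree (coin u) l"
          by (intro exI[of _ "map (coin u) [0..<Suc j]"]) (auto simp: agree_def simp del: upt_Suc)
      qed (auto simp: agree_def)
      also have "\<dots> \<in> sets PU"
        by (intro sets.countable_UN') (auto simp: box(2))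
      finally show "(\<lambda>u. coin u j) -` A \<inter> space PU \<in> sets PU" .
    qed simp
  qed (auto simp: spaceP PiE_UNIV_domain)
  define C where "C = distr PU coin_space coin"
  have "prob_space C" unfolding C_def by (rule PU.prob_space_distr[OF meas])
  moreover have "sets C = sets coin_space" by (simp add: C_def)
  moreover have "measure C {c. agree c l} = w l" for l
    unfolding C_def using box(1)[of l]
    by (subst measure_distr[OF meas agree_sets]) (simp add: vimage_def spaceP)
  ultimately show ?thesis by blast
qed

context cookie_chain
begin

section \<open>Law of the coins at one site\<close>

fun wt :: "bool list \<Rightarrow> 's \<Rightarrow> real" where
  "wt [] = (\<lambda>i. 1)"
| "wt (c # l) = (\<lambda>i. (if c then p$i else 1 - p$i) * Kf (wt l) i)"

lemma wt_nonneg: "wt l i \<ge> 0"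
  by (induction l arbitrary: i) (auto intro!: mult_nonneg_nonneg Kf_nonneg simp: p_pos p_less less_imp_le)

lemma wt_snoc_sum: "wt (l @ [True]) i + wt (l @ [False]) i = wt l i"
proof (induction l arbitrary: i)
  case (Cons c l)
  have "Kf (wt (l @ [True])) i + Kf (wt (l @ [False])) i = Kf (wt l) i"
    by (simp only: Kf_add[symmetric] Cons)
  then show ?case by (simp flip: distrib_left)
qed (simp add: Kf_const)

definition coin_lists :: "nat \<Rightarrow> nat \<Rightarrow> bool list set" where
  "coin_lists m b = {l. length l = m + b \<and> count_list l False = m \<and> (l \<noteq> [] \<longrightarrow> \<not> last l)}"

lemma finite_coin_lists: "finite (coin_lists m b)"
  by (rule finite_subset[OF _ finite_lists_length_eq[of UNIV "m + b"]]) (auto simp: coin_lists_def)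

text \<open>Splitting off the first coin reproduces the recursion of \<open>T\<close>, so that
  summing \<open>wt\<close> over these lists is an induction over it.\<close>

lemma coin_lists_simps:
  "coin_lists 0 0 = {[]}" "coin_lists 0 (Suc b) = {}"
  "coin_lists (Suc a) 0 = (#) False ` coin_lists a 0"
  "coin_lists (Suc a) (Suc b) = (#) False ` coin_lists a (Suc b) \<union> (#) True ` coin_lists (Suc a) b"
proof -
  show "coin_lists 0 0 = {[]}" by (auto simp: coin_lists_def)
  show "coin_lists 0 (Suc b) = {}"
    by (auto simp: coin_lists_def count_list_0_iff) (metis last_in_set length_0_conv nat.distinct(1))
  show "coin_lists (Suc a) 0 = (#) False ` coin_lists a 0"
  proof (intro equalityI subsetI)
    fix l assume "l \<in> coin_lists (Suc a) 0"
    then obtain x l' where "l = x # l'" "length l' = a" "count_list l False = Suc a" "\<not> last l"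
      by (cases l) (auto simp: coin_lists_def)
    then show "l \<in> (#) False ` coin_lists a 0"
      using count_le_length[of l' False] by (cases x) (auto simp: coin_lists_def split: if_splits)
  qed (auto simp: coin_lists_def split: if_splits)
  show "coin_lists (Suc a) (Suc b) = (#) False ` coin_lists a (Suc b) \<union> (#) True ` coin_lists (Suc a) b"
  proof (intro equalityI subsetI)
    fix l assume "l \<in> coin_lists (Suc a) (Suc b)"
    then obtain x l' where "l = x # l'" "length l' = a + Suc b" "count_list l False = Suc a" "\<not> last l"
      by (cases l) (auto simp: coin_lists_def)
    then show "l \<in> (#) False ` coin_lists a (Suc b) \<union> (#) True ` coin_lists (Suc a) b"
      by (cases x) (auto simp: coin_lists_def)
  qed (auto simp: coin_lists_def split: if_splits)
qed

lemma sum_wt_coin_lists: "(\<Sum>l\<in>coin_lists a b. wt l i) = ph a b i"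
proof -
  have "(\<Sum>l\<in>coin_lists a b. wt l i) = T a b h i" if "h = (\<lambda>_. 1)" for h
    using that
  proof (induction a b h arbitrary: i rule: T.induct)
    case (3 a h)
    have "T a 0 h = (\<lambda>i. \<Sum>l\<in>coin_lists a 0. wt l i)" using 3 by auto
    then show ?case
      by (simp add: coin_lists_simps sum.reindex Kf_sum sum_distrib_left)
  next
    case (4 a b h)
    have "T a (Suc b) h = (\<lambda>i. \<Sum>l\<in>coin_lists a (Suc b). wt l i)"
      "T (Suc a) b h = (\<lambda>i. \<Sum>l\<in>coin_lists (Suc a) b. wt l i)" using 4 by auto
    moreover have "(\<Sum>l\<in>coin_lists (Suc a) (Suc b). wt l i)
        = (\<Sum>l\<in>coin_lists a (Suc b). wt (False # l) i) + (\<Sum>l\<in>coin_lists (Suc a) b. wt (True # l) i)"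
      unfolding coin_lists_simps(4) by (subst sum.union_disjoint) (auto simp: finite_coin_lists sum.reindex)
    ultimately show ?case
      by (simp add: Kf_sum sum_distrib_left)
  qed (simp_all add: coin_lists_simps)
  then show ?thesis by (simp add: ph_def)
qed

end

lemma count_list_map_upt: "count_list (map c [0..<n]) False = lefts c n"
  by (induction n) auto

lemma (in cookie_chain) rights_before_iff: "rights_before c m b \<longleftrightarrow> (\<exists>l\<in>coin_lists m b. agree c l)"
proof -
  have "rights_before c m b \<longleftrightarrow> map c [0..<m + b] \<in> coin_lists m b"
    unfolding rights_before_def coin_lists_def mem_Collect_eq count_list_map_upt
    by (auto simp: last_map)
  also have "\<dots> \<longleftrightarrow> (\<exists>l\<in>coin_lists m b. agree c l)"
    by (auto simp: agree_iff_map coin_lists_def)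
  finally show ?thesis .
qed

context cookie_stack
begin

definition W :: "bool list \<Rightarrow> real" where "W l = (\<Sum>i\<in>UNIV. eta$i * wt l i)"

lemma W_Nil: "W [] = 1" by (simp add: W_def eta_sum)

lemma W_nonneg: "W l \<ge> 0"
  unfolding W_def by (intro sum_nonneg mult_nonneg_nonneg eta_nonneg wt_nonneg)

lemma W_snoc_sum: "W (l @ [True]) + W (l @ [False]) = W l"
  unfolding W_def sum.distrib[symmetric] distrib_left[symmetric] wt_snoc_sum ..

lemma sum_W_coin_lists: "(\<Sum>l\<in>coin_lists m b. W l) = phi m b"
  unfolding W_def phi_def sum_wt_coin_lists[symmetric] sum_distrib_left by (rule sum.swap)

definition coinC :: "(nat \<Rightarrow> bool) measure" where
  "coinC = (SOME C. prob_space C \<and> sets C = sets coin_space \<and> (\<forall>l. measure C {c. agree c l} = W l))"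

lemma coinC: "prob_space coinC" "sets coinC = sets coin_space" "measure coinC {c. agree c l} = W l"
  using someI_ex[OF ex_coin_measure[OF W_Nil W_nonneg W_snoc_sum]] unfolding coinC_def by blast+

lemma space_coinC: "space coinC = UNIV"
  using sets_eq_imp_space_eq[OF coinC(2)] by (simp add: space_coin_space)

lemma rights_before_sets: "{c. rights_before c m b} \<in> sets coinC"
proof -
  have "{c. rights_before c m b} = (\<Union>l\<in>coin_lists m b. {c. agree c l})" by (auto simp: rights_before_iff)
  also have "\<dots> \<in> sets coinC" unfolding coinC(2) by (intro sets.finite_UN finite_coin_lists agree_sets)
  finally show ?thesis .
qed

lemma measure_rights_before: "measure coinC {c. rights_before c m b} = phi m b"
proof -
  interpret prob_space coinC by (rule coinC)
  have "{c. rights_before c m b} = (\<Union>l\<in>coin_lists m b. {c. agree c l})" by (auto simp: rights_before_iff)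
  also have "measure coinC \<dots> = (\<Sum>l\<in>coin_lists m b. measure coinC {c. agree c l})"
  proof (rule finite_measure_finite_Union[OF finite_coin_lists])
    show "disjoint_family_on (\<lambda>l. {c. agree c l}) (coin_lists m b)"
      unfolding disjoint_family_on_def by (auto simp: agree_iff_map coin_lists_def)
  qed (auto simp: coinC(2) agree_sets)
  also have "\<dots> = phi m b" by (simp add: coinC(3) sum_W_coin_lists)
  finally show ?thesis .
qed

section \<open>The i.i.d. array of coin columns\<close>

definition coins_law :: "(int \<Rightarrow> nat \<Rightarrow> bool) measure" where
  "coins_law = PiM UNIV (\<lambda>_. coinC)"

lemma space_coins_law: "space coins_law = UNIV"
  unfolding coins_law_def by (rule space_PiM_UNIV) (rule space_coinC)

lemma prob_space_coins_law: "prob_space coins_law"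
  unfolding coins_law_def by (intro prob_space_PiM coinC)

lemma coins_law_box:
  assumes "finite J" "\<And>x. x \<in> J \<Longrightarrow> A x \<in> sets coinC"
  shows "measure coins_law {c. \<forall>x\<in>J. c x \<in> A x} = (\<Prod>x\<in>J. measure coinC (A x))"
proof -
  interpret C: prob_space coinC by (rule coinC)
  interpret P: product_prob_space "\<lambda>_::int. coinC" UNIV by unfold_locales
  show ?thesis using P.measure_PiM_Collect[of J A] assms
    by (simp add: coins_law_def[symmetric] space_coins_law)
qed

lemma coins_law_coord_sets: "A \<in> sets coinC \<Longrightarrow> {c. c x \<in> A} \<in> sets coins_law"
  using measurable_sets[OF measurable_component_singleton[of x UNIV "\<lambda>_. coinC"], of A]
  by (simp add: coins_law_def[symmetric] space_coins_law vimage_def)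

lemma coins_law_box_sets:
  assumes "finite J" "\<And>x. x \<in> J \<Longrightarrow> A x \<in> sets coinC"
  shows "{c. \<forall>x\<in>J. c x \<in> A x} \<in> sets coins_law"
proof -
  have "{c \<in> space coins_law. \<forall>x\<in>J. c x \<in> A x} \<in> sets coins_law"
    by (intro sets.sets_Collect_finite_All assms(1))
       (use assms coins_law_coord_sets in \<open>auto simp: space_coins_law\<close>)
  then show ?thesis by (simp add: space_coins_law)
qed

end

text \<open>An arbitrary sigma-algebra on the full space is allowed, so that this serves both the
  product space and the sigma-algebra generated by the sites from some point on.\<close>

lemma dies_sets:
  assumes sp: "space S = UNIV"
    and rb: "\<And>x m b. x \<ge> k \<Longrightarrow> {c. rights_before (c x) m b} \<in> sets S"
  shows "{c. dies c k n m} \<in> sets S"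
  using rb
proof (induction n arbitrary: k m)
  case 0
  then show ?case using sets.top[of S] by (simp add: sp)
next
  case (Suc n)
  have "{c. dies c k (Suc n) m} = (\<Union>b. {c. rights_before (c k) m b} \<inter> {c. dies c (k + 1) n b})" by auto
  also have "\<dots> \<in> sets S"
    using Suc by (intro sets.countable_UN' sets.Int) auto
  finally show ?case .
qed

lemma dies_Suc: "dies c k n m \<Longrightarrow> dies c k (Suc n) m"
proof (induction n arbitrary: k m)
  case 0
  then show ?case using rights_before_0[of "c k" 0] by auto
next
  case (Suc n)
  then obtain b where "rights_before (c k) m b" "dies c (k + 1) n b" by auto
  with Suc.IH show ?case unfolding dies.simps(2)[of c k "Suc n"] by blast
qed

context cookie_stack
begin

lemma dies_sets_coins_law: "{c. dies c k n m} \<in> sets coins_law"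
  by (rule dies_sets) (use coins_law_coord_sets[OF rights_before_sets] in \<open>auto simp: space_coins_law\<close>)

text \<open>Carrying a box condition on sites left of \<open>k\<close> makes the induction close:
  the event that site \<open>k\<close> produces \<open>b\<close> right steps joins the box, and the
  remaining generations use only sites from \<open>k + 1\<close> on.\<close>

lemma box_dies:
  assumes "finite J" "J \<subseteq> {..<k}" "\<And>x. x \<in> J \<Longrightarrow> A x \<in> sets coinC"
  shows "measure coins_law {c. (\<forall>x\<in>J. c x \<in> A x) \<and> dies c k n m} = (\<Prod>x\<in>J. measure coinC (A x)) * extinct n m"
  using assms
proof (induction n arbitrary: k m J A)
  case 0
  then show ?case using coins_law_box[OF 0(1,3)] by simp
next
  case (Suc n)
  interpret prob_space coins_law by (rule prob_space_coins_law)
  define A' where "A' b = A(k := {c. rights_before c m b})" for b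
  define E where "E b = {c. (\<forall>x\<in>insert k J. c x \<in> A' b x) \<and> dies c (k + 1) n b}" for b
  have kJ: "k \<notin> J" using Suc.prems by auto
  have A': "A' b x = A x" if "x \<in> J" for b x using that kJ by (auto simp: A'_def)
  have A'k: "A' b k = {c. rights_before c m b}" for b by (simp add: A'_def)
  have A's: "A' b x \<in> sets coinC" if "x \<in> insert k J" for b x
    using that Suc.prems rights_before_sets by (auto simp: A'_def)
  have eq: "{c. (\<forall>x\<in>J. c x \<in> A x) \<and> dies c k (Suc n) m} = (\<Union>b. E b)"
    unfolding E_def using A' A'k by auto
  have sE: "E b \<in> sets coins_law" for b
  proof -
    have "E b = {c. \<forall>x\<in>insert k J. c x \<in> A' b x} \<inter> {c. dies c (k + 1) n b}" by (auto simp: E_def)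
    then show ?thesis using coins_law_box_sets[of "insert k J" "A' b"] A's Suc.prems(1) dies_sets_coins_law by auto
  qed
  have "disjoint_family E"
    unfolding disjoint_family_on_def E_def using A'k rights_before_unique by fastforce
  then have "(\<lambda>b. measure coins_law (E b)) sums measure coins_law (\<Union>b. E b)"
    using sE by (intro finite_measure_UNION) auto
  moreover have "measure coins_law (E b) = (\<Prod>x\<in>J. measure coinC (A x)) * (phi m b * extinct n b)" for b
  proof -
    have "measure coins_law (E b) = (\<Prod>x\<in>insert k J. measure coinC (A' b x)) * extinct n b"
      unfolding E_def using Suc.prems A's by (intro Suc.IH) auto
    also have "(\<Prod>x\<in>insert k J. measure coinC (A' b x)) = phi m b * (\<Prod>x\<in>J. measure coinC (A x))"
      using kJ Suc.prems(1) A' A'k by (simp add: measure_rights_before)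
    finally show ?thesis by (simp add: mult_ac)
  qed
  ultimately have "(\<lambda>b. (\<Prod>x\<in>J. measure coinC (A x)) * (phi m b * extinct n b)) sums measure coins_law (\<Union>b. E b)"
    by simp
  moreover have "(\<lambda>b. (\<Prod>x\<in>J. measure coinC (A x)) * (phi m b * extinct n b)) sums ((\<Prod>x\<in>J. measure coinC (A x)) * extinct (Suc n) m)"
    unfolding extinct.simps by (intro sums_mult summable_sums extinct_summable)
  ultimately show ?case unfolding eq by (rule sums_unique2)
qed

lemma measure_dies: "measure coins_law {c. dies c k n m} = extinct n m"
  using box_dies[of "{}" k "\<lambda>_. {}" n m] by simp

lemma AE_rights_before: "AE c in coins_law. \<forall>x m. \<exists>b. rights_before (c x) m b"
proof -
  interpret prob_space coins_law by (rule prob_space_coins_law)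
  have "AE c in coins_law. \<exists>b. rights_before (c x) m b" for x m
  proof -
    let ?E = "\<lambda>b. {c. c x \<in> {d. rights_before d m b}}"
    have "(\<lambda>b. measure coins_law (?E b)) sums measure coins_law (\<Union>b. ?E b)"
    proof (rule finite_measure_UNION)
      show "range ?E \<subseteq> sets coins_law" using coins_law_coord_sets[OF rights_before_sets] by auto
      show "disjoint_family ?E" unfolding disjoint_family_on_def by (auto dest: rights_before_unique)
    qed
    moreover have "(\<lambda>b. measure coins_law (?E b)) = phi m"
    proof
      fix b show "measure coins_law (?E b) = phi m b"
      using coins_law_box[of "{x}" "\<lambda>_. {d. rights_before d m b}"] rights_before_sets
      by (simp add: measure_rights_before)
    qed
    ultimately have "measure coins_law (\<Union>b. ?E b) = 1" using sums_unique2[OF _ phi_sums[of m]] by simp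
    then have "AE c in coins_law. c \<in> (\<Union>b. ?E b)" by (rule AE_prob_1)
    then show ?thesis by simp
  qed
  then show ?thesis by (simp add: AE_all_countable)
qed

lemma AE_hits_negative:
  assumes "rho \<le> nu / 2"
  shows "AE c in coins_law. \<forall>z<0. \<exists>n. pos c origin n = z"
proof -
  interpret prob_space coins_law by (rule prob_space_coins_law)
  have "AE c in coins_law. \<exists>N. dies c 1 N m" for m
  proof -
    let ?E = "\<Union>N. {c. dies c 1 N m}"
    have s: "?E \<in> sets coins_law" by (intro sets.countable_UN) (auto intro: dies_sets_coins_law)
    have "extinct N m \<le> measure coins_law ?E" for N
      unfolding measure_dies[of 1, symmetric] by (intro finite_measure_mono s) auto
    then have "1 \<le> measure coins_law ?E"
      using extinct_tendsto_1[OF assms, of m] by (intro LIMSEQ_le_const2) auto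
    then have "measure coins_law ?E = 1" using prob_le_1[of ?E] by simp
    then have "AE c in coins_law. c \<in> ?E" by (rule AE_prob_1)
    then show ?thesis by simp
  qed
  then have "AE c in coins_law. \<forall>m. \<exists>N. dies c 1 N m" by (simp add: AE_all_countable)
  with AE_rights_before show ?thesis
  proof eventually_elim
    case (elim c)
    then show ?case using hits_negative[of c] by blast
  qed
qed

text \<open>Survival events at different levels are dependent, but each has probability at least
  \<open>1 - d > 0\<close>, so their upper limit does too. Survival from \<open>k\<close> involves
  only sites from \<open>k\<close> on, which makes the upper limit a tail event.\<close>

lemma AE_survives_infinitely_often:
  assumes "rho > nu / 2"
  shows "AE c in coins_law. \<forall>B. \<exists>k\<ge>B. \<forall>N. \<not> dies c k N 1"
proof -
  interpret prob_space coins_law by (rule prob_space_coins_law)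
  obtain d where d: "d < 1" "\<And>n. extinct n 1 \<le> d" using extinct_1_bounded[OF assms] by blast
  define S where "S k = {c. \<forall>N. \<not> dies c (int k) N 1}" for k :: nat
  have Sc: "S k = UNIV - (\<Union>N. {c. dies c (int k) N 1})" for k by (auto simp: S_def)
  have ds: "(\<Union>N. {c. dies c (int k) N 1}) \<in> sets coins_law" for k
    by (intro sets.countable_UN) (auto intro: dies_sets_coins_law)
  have Ss: "S k \<in> sets coins_law" for k unfolding Sc using ds sets.compl_sets[of _ coins_law] by (simp add: space_coins_law)
  have pS: "prob (S k) \<ge> 1 - d" for k
  proof -
    have "(\<lambda>N. prob {c. dies c (int k) N 1}) \<longlonglongrightarrow> prob (\<Union>N. {c. dies c (int k) N 1})"
    proof (rule finite_Lim_measure_incseq)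
      show "incseq (\<lambda>N. {c. dies c (int k) N 1})"
        by (rule incseq_SucI) (use dies_Suc in blast)
    qed (use dies_sets_coins_law in auto)
    then have "prob (\<Union>N. {c. dies c (int k) N 1}) \<le> d"
      by (rule LIMSEQ_le_const2) (use d(2) in \<open>auto simp: measure_dies simp del: dies.simps\<close>)
    then show ?thesis using prob_compl[OF ds[of k]] unfolding Sc by (simp add: space_coins_law)
  qed
  define L where "L = (\<Inter>n. \<Union>k\<in>{n..}. S k)"
  have "prob L \<ge> 1 - d"
  proof -
    have "(\<lambda>n. prob (\<Union>k\<in>{n..}. S k)) \<longlonglongrightarrow> prob (\<Inter>n. \<Union>k\<in>{n..}. S k)"
    proof (rule finite_Lim_measure_decseq)
      show "range (\<lambda>n. \<Union>k\<in>{n..}. S k) \<subseteq> events" using Ss by auto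
      show "decseq (\<lambda>n. \<Union>k\<in>{n..}. S k)" by (intro decseq_SucI UN_mono) auto
    qed
    moreover have "1 - d \<le> prob (\<Union>k\<in>{n..}. S k)" for n
    proof -
      have "prob (S n) \<le> prob (\<Union>k\<in>{n..}. S k)" using Ss by (intro finite_measure_mono) auto
      with pS[of n] show ?thesis by simp
    qed
    ultimately show ?thesis unfolding L_def by (intro LIMSEQ_le_const) auto
  qed
  define F where "F i = {{c. c (int i) \<in> B} | B. B \<in> sets coinC}" for i :: nat
  have Fs: "F i \<subseteq> events" for i using coins_law_coord_sets by (auto simp: F_def)
  have "prob L = 0 \<or> prob L = 1"
  proof (rule kolmogorov_0_1_law[of F])
    show "sigma_algebra (space coins_law) (F i)" for i
    proof -
      have "F i = {(\<lambda>c. c (int i)) -` B \<inter> space coins_law | B. B \<in> sets coinC}"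
        by (auto simp: F_def space_coins_law vimage_def)
      also have "\<dots> = sets (vimage_algebra (space coins_law) (\<lambda>c. c (int i)) coinC)"
        by (subst sets_vimage_algebra2) (auto simp: space_coinC)
      finally have "F i = sets (vimage_algebra (space coins_law) (\<lambda>c. c (int i)) coinC)" .
      then show ?thesis using sets.sigma_algebra_axioms[of "vimage_algebra (space coins_law) (\<lambda>c. c (int i)) coinC"]
        by simp
    qed
    show "indep_sets F UNIV"
    proof (rule indep_setsI[OF Fs])
      fix A and J :: "nat set" assume J: "J \<noteq> {}" "finite J" and A: "\<forall>j\<in>J. A j \<in> F j"
      then obtain B where B: "\<And>j. j \<in> J \<Longrightarrow> A j = {c. c (int j) \<in> B j} \<and> B j \<in> sets coinC"
        unfolding F_def by (auto dest!: bchoice)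
      let ?B = "\<lambda>x. B (nat x)"
      have "(\<Inter>j\<in>J. A j) = {c. \<forall>x\<in>int ` J. c x \<in> ?B x}" using B by auto
      also have "prob \<dots> = (\<Prod>x\<in>int ` J. measure coinC (?B x))"
        using J B by (intro coins_law_box) auto
      also have "\<dots> = (\<Prod>j\<in>J. measure coinC (B j))" by (subst prod.reindex) auto
      also have "\<dots> = (\<Prod>j\<in>J. prob (A j))"
      proof (rule prod.cong[OF refl])
        fix j assume j: "j \<in> J"
        show "measure coinC (B j) = prob (A j)"
          using coins_law_box[of "{int j}" "\<lambda>_. B j"] B[OF j] by simp
      qed
      finally show "prob (\<Inter>j\<in>J. A j) = (\<Prod>j\<in>J. prob (A j))" .
    qed
    show "L \<in> tail_events F" unfolding tail_events_def
    proof
      fix n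
      let ?G = "\<Union> (F ` {n..})"
      have G: "?G \<subseteq> Pow UNIV" by simp
      have sp: "space (sigma UNIV ?G) = UNIV" by (rule space_measure_of) simp
      have ss: "sets (sigma UNIV ?G) = sigma_sets UNIV ?G" by (rule sets_measure_of) simp
      have rb: "{c. rights_before (c x) m b} \<in> sets (sigma UNIV ?G)" if "x \<ge> int n" for x m b
      proof -
        have "{c. c (int (nat x)) \<in> {d. rights_before d m b}} \<in> F (nat x)" unfolding F_def using rights_before_sets by blast
        then have "{c. rights_before (c x) m b} \<in> ?G" using that by (auto intro!: bexI[of _ "nat x"])
        then show ?thesis unfolding ss by (rule sigma_sets.Basic)
      qed
      have "S k \<in> sets (sigma UNIV ?G)" if "k \<ge> n" for k
      proof -
        have "(\<Union>N. {c. dies c (int k) N 1}) \<in> sets (sigma UNIV ?G)"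
          using that by (intro sets.countable_UN image_subsetI dies_sets[OF sp] rb) auto
        then show ?thesis unfolding Sc using sets.compl_sets[of _ "sigma UNIV ?G"] by (simp add: sp)
      qed
      then have "(\<Inter>n'\<in>{n..}. \<Union>k\<in>{n'..}. S k) \<in> sets (sigma UNIV ?G)"
        by (intro sets.countable_INT' sets.countable_UN' image_subsetI) auto
      \<comment> \<open>Starting the intersection at \<open>n\<close> changes nothing, because the
        unions decrease; now only sites from \<open>n\<close> on occur.\<close>
      moreover have "L = (\<Inter>n'\<in>{n..}. \<Union>k\<in>{n'..}. S k)"
      proof (intro equalityI)
        show "(\<Inter>n'\<in>{n..}. \<Union>k\<in>{n'..}. S k) \<subseteq> L" unfolding L_def
        proof (intro INT_greatest)
          fix n'
          have "(\<Inter>n'\<in>{n..}. \<Union>k\<in>{n'..}. S k) \<subseteq> (\<Union>k\<in>{max n n'..}. S k)" by (rule INT_lower) simp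
          also have "\<dots> \<subseteq> (\<Union>k\<in>{n'..}. S k)" by (rule UN_mono) auto
          finally show "(\<Inter>n'\<in>{n..}. \<Union>k\<in>{n'..}. S k) \<subseteq> (\<Union>k\<in>{n'..}. S k)" .
        qed
      qed (auto simp: L_def)
      ultimately show "L \<in> sigma_sets (space coins_law) ?G" unfolding ss space_coins_law by simp
    qed
  qed
  with \<open>prob L \<ge> 1 - d\<close> d(1) have "prob L = 1" by linarith
  then have "AE c in coins_law. c \<in> L" by (rule AE_prob_1)
  then show ?thesis
  proof eventually_elim
    case (elim c)
    show ?case
    proof
      fix B :: int
      have "c \<in> (\<Union>k\<in>{nat B..}. S k)" using elim unfolding L_def by blast
      then obtain k where "k \<ge> nat B" "\<forall>N. \<not> dies c (int k) N 1" unfolding S_def by blast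
      then show "\<exists>k\<ge>B. \<forall>N. \<not> dies c k N 1" by (intro exI[of _ "int k"]) auto
    qed
  qed
qed

end

section \<open>The averaged law\<close>

definition coins_at :: "(nat \<Rightarrow> int) \<Rightarrow> nat \<Rightarrow> int \<Rightarrow> bool list" where
  "coins_at h n x = map (\<lambda>k. h (Suc k) = h k + 1) (filter (\<lambda>k. h k = x) [0..<n])"

definition nn_path :: "(nat \<Rightarrow> int) \<Rightarrow> nat \<Rightarrow> bool" where
  "nn_path h n \<longleftrightarrow> h 0 = 0 \<and> (\<forall>k<n. \<bar>h (Suc k) - h k\<bar> = 1)"

lemma coins_at_0: "coins_at h 0 x = []"
  by (simp add: coins_at_def)

lemma coins_at_Suc:
  "coins_at h (Suc n) x = coins_at h n x @ (if h n = x then [h (Suc n) = h n + 1] else [])"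
  by (simp add: coins_at_def)

lemma coins_at_Nil: "x \<notin> h ` {..<n} \<Longrightarrow> coins_at h n x = []"
  by (auto simp: coins_at_def filter_empty_conv)

text \<open>Both claims are proved together: the number of coins already used at the current site
  tells which coin decides the next step.\<close>

lemma walk_path_iff:
  "nn_path h n \<Longrightarrow> ((\<forall>k\<le>n. pos c origin k = h k) \<longleftrightarrow> (\<forall>x. agree (c x) (coins_at h n x)))
    \<and> ((\<forall>k\<le>n. pos c origin k = h k) \<longrightarrow> (\<forall>x. used c origin n x = length (coins_at h n x)))"
proof (induction n)
  case 0
  then show ?case by (simp add: coins_at_0 agree_Nil nn_path_def)
next
  case (Suc n)
  have nn: "nn_path h n" using Suc.prems by (simp add: nn_path_def)
  have st: "h (Suc n) = h n + 1 \<or> h (Suc n) = h n - 1"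
    using Suc.prems unfolding nn_path_def by (smt (verit) lessI)
  let ?P = "\<forall>k\<le>n. pos c origin k = h k"
  have IH1: "?P \<longleftrightarrow> (\<forall>x. agree (c x) (coins_at h n x))"
    and IH2: "?P \<Longrightarrow> used c origin n x = length (coins_at h n x)" for x
    using Suc.IH[OF nn] by blast+
  have e1: "(\<forall>k\<le>Suc n. pos c origin k = h k) \<longleftrightarrow> ?P \<and> pos c origin (Suc n) = h (Suc n)"
    by (auto simp: le_Suc_eq)
  have e2: "?P \<Longrightarrow> pos c origin (Suc n) = h (Suc n) \<longleftrightarrow> c (h n) (length (coins_at h n (h n))) = (h (Suc n) = h n + 1)"
    using IH2[of "h n"] st by (auto simp: pos_Suc)
  have e3: "(\<forall>x. agree (c x) (coins_at h (Suc n) x)) \<longleftrightarrow>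
     (\<forall>x. agree (c x) (coins_at h n x)) \<and> c (h n) (length (coins_at h n (h n))) = (h (Suc n) = h n + 1)"
  proof -
    have "agree (c x) (coins_at h (Suc n) x) \<longleftrightarrow> agree (c x) (coins_at h n x)
       \<and> (h n = x \<longrightarrow> c x (length (coins_at h n x)) = (h (Suc n) = h n + 1))" for x
      by (auto simp: coins_at_Suc agree_snoc)
    then show ?thesis by auto
  qed
  show ?case
  proof
    show "(\<forall>k\<le>Suc n. pos c origin k = h k) = (\<forall>x. agree (c x) (coins_at h (Suc n) x))"
      unfolding e1 e3 using IH1 e2 by blast
    show "(\<forall>k\<le>Suc n. pos c origin k = h k) \<longrightarrow> (\<forall>x. used c origin (Suc n) x = length (coins_at h (Suc n) x))"
      unfolding e1 using IH2 by (auto simp: used_Suc coins_at_Suc)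
  qed
qed

context cookie_stack
begin

lemma coins_law_path:
  assumes "nn_path h n"
  shows "measure coins_law {c. \<forall>k\<le>n. pos c origin k = h k} = (\<Prod>x\<in>h ` {..<n}. W (coins_at h n x))"
    and "{c. \<forall>k\<le>n. pos c origin k = h k} \<in> sets coins_law"
proof -
  have e: "{c. \<forall>k\<le>n. pos c origin k = h k} = {c. \<forall>x\<in>h ` {..<n}. c x \<in> {d. agree d (coins_at h n x)}}"
  proof (intro Collect_cong)
    fix c
    have "(\<forall>k\<le>n. pos c origin k = h k) \<longleftrightarrow> (\<forall>x. agree (c x) (coins_at h n x))"
      using walk_path_iff[OF assms] by blast
    also have "\<dots> \<longleftrightarrow> (\<forall>x\<in>h ` {..<n}. agree (c x) (coins_at h n x))"
      using coins_at_Nil agree_Nil by metis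
    finally show "(\<forall>k\<le>n. pos c origin k = h k) \<longleftrightarrow> (\<forall>x\<in>h ` {..<n}. c x \<in> {d. agree d (coins_at h n x)})"
      by simp
  qed
  show "measure coins_law {c. \<forall>k\<le>n. pos c origin k = h k} = (\<Prod>x\<in>h ` {..<n}. W (coins_at h n x))"
    unfolding e by (subst coins_law_box) (auto simp: coinC(2,3) agree_sets)
  show "{c. \<forall>k\<le>n. pos c origin k = h k} \<in> sets coins_law"
    unfolding e by (intro coins_law_box_sets) (auto simp: coinC(2) agree_sets)
qed

end

section \<open>Path laws and their comparison\<close>

abbreviation path_space :: "(nat \<Rightarrow> int) measure" where
  "path_space \<equiv> PiM UNIV (\<lambda>_. count_space UNIV)"

definition path_cyl :: "(nat \<Rightarrow> int) \<Rightarrow> nat \<Rightarrow> (nat \<Rightarrow> int) set" where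
  "path_cyl h n = {f. \<forall>k\<le>n. f k = h k}"

lemma space_path_space: "space path_space = UNIV"
  by (rule space_PiM_UNIV) simp

lemma coord_path_sets: "{f. f j \<in> A} \<in> sets path_space"
  using measurable_sets[OF measurable_component_singleton[of j UNIV "\<lambda>_. count_space UNIV"], of A]
  by (simp add: vimage_def space_path_space)

lemma path_cyl_sets: "path_cyl h n \<in> sets path_space"
proof -
  have e: "path_cyl h n = (\<Inter>k\<in>{..n}. {f. f k \<in> {h k}})" by (auto simp: path_cyl_def)
  show ?thesis unfolding e by (intro sets.finite_INT coord_path_sets) auto
qed

text \<open>Paths are indexed by lists, of which there are only countably many.\<close>
lemma coord_eq_Union_path_cyl:
  "{f. f j \<in> A} = (\<Union>l\<in>{l :: int list. l ! j \<in> A}. path_cyl ((!) l) j)"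
proof (intro equalityI subsetI)
  fix f :: "nat \<Rightarrow> int" assume "f \<in> {f. f j \<in> A}"
  then show "f \<in> (\<Union>l\<in>{l :: int list. l ! j \<in> A}. path_cyl ((!) l) j)"
    by (intro UN_I[of "map f [0..<Suc j]"]) (auto simp: path_cyl_def simp del: upt_Suc)
qed (auto simp: path_cyl_def)

text \<open>The empty set joins the cylinders so that the generator becomes closed under
  intersection.\<close>

lemma sets_path_space: "sets path_space = sigma_sets UNIV (insert {} (range (\<lambda>(h, n). path_cyl h n)))"
  (is "_ = sigma_sets UNIV ?E")
proof
  show "sets path_space \<subseteq> sigma_sets UNIV ?E"
  proof -
    have *: "{f. f j \<in> A} \<in> sigma_sets UNIV ?E" for j A
      unfolding coord_eq_Union_path_cyl
      by (intro sigma_sets_UNION) (auto intro!: sigma_sets.Basic)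
    have "sets path_space = sigma_sets (\<Pi>\<^sub>E i\<in>UNIV. UNIV) {{f\<in>\<Pi>\<^sub>E i\<in>UNIV. UNIV. f i \<in> A} | i A. i \<in> UNIV \<and> A \<in> sets (count_space (UNIV :: int set))}"
      by (subst sets_PiM_single) simp
    also have "\<dots> = sigma_sets UNIV {{f. f i \<in> A} | i A. True}"
      by (simp add: PiE_UNIV_domain)
    also have "\<dots> \<subseteq> sigma_sets UNIV ?E"
      by (rule sigma_sets_mono) (use * in auto)
    finally show ?thesis .
  qed
  show "sigma_sets UNIV ?E \<subseteq> sets path_space"
  proof -
    have "?E \<subseteq> sets path_space" using path_cyl_sets by auto
    from sets.sigma_sets_subset[OF this] show ?thesis by (simp add: space_path_space)
  qed
qed

text \<open>Two path cylinders are disjoint or nested, so they form a generator stable under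
  intersection, and the values at time 0 give a countable cover.\<close>

lemma path_measure_eqI:
  assumes P: "prob_space P" "sets P = sets path_space" and Q: "prob_space Q" "sets Q = sets path_space"
    and eq: "\<And>h n. measure P (path_cyl h n) = measure Q (path_cyl h n)"
  shows "P = Q"
proof -
  interpret P: prob_space P by fact
  interpret Q: prob_space Q by fact
  let ?E = "insert {} (range (\<lambda>(h, n). path_cyl h n))"
  define A :: "nat \<Rightarrow> (nat \<Rightarrow> int) set" where "A i = path_cyl (\<lambda>_. from_nat i) 0" for i
  show ?thesis
  proof (rule measure_eqI_generator_eq[where E = ?E and \<Omega> = UNIV and A = A])
    show "Int_stable ?E"
    proof (rule Int_stableI)
      fix a b assume ab: "a \<in> ?E" "b \<in> ?E"
      show "a \<inter> b \<in> ?E"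
      proof (cases "a \<inter> b = {}")
        case False
        then obtain f where f: "f \<in> a" "f \<in> b" by blast
        with ab obtain h n h' n' where "a = path_cyl h n" "b = path_cyl h' n'" by auto
        with f have "a = path_cyl f n" "b = path_cyl f n'" by (auto simp: path_cyl_def)
        then have "a \<inter> b = path_cyl f (max n n')"
          by (auto simp: path_cyl_def) (metis le_max_iff_disj nle_le)
        then show ?thesis by auto
      qed simp
    qed
    show "range A \<subseteq> ?E" by (auto simp: A_def)
    show "(\<Union>i. A i) = UNIV"
    proof (intro equalityI subsetI)
      fix f :: "nat \<Rightarrow> int"
      have "f \<in> A (to_nat (f 0))" by (simp add: A_def path_cyl_def)
      then show "f \<in> (\<Union>i. A i)" by blast
    qed simp
  qed (use eq P Q sets_path_space in \<open>auto simp: P.emeasure_eq_measure Q.emeasure_eq_measure\<close>)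
qed

context cookie_stack
begin

lemma pos_measurable: "(\<lambda>c. pos c origin n) \<in> measurable coins_law (count_space UNIV)"
proof (rule measurableI)
  fix A :: "int set"
  have "{c. pos c origin n \<in> A} = (\<Union>l\<in>{l :: int list. nn_path ((!) l) n \<and> l ! n \<in> A}. {c. \<forall>k\<le>n. pos c origin k = l ! k})"
  proof (intro equalityI subsetI)
    fix c assume c: "c \<in> {c. pos c origin n \<in> A}"
    define l where "l = map (pos c origin) [0..<Suc n]"
    have l: "l ! k = pos c origin k" if "k \<le> n" for k
      using that unfolding l_def by (simp del: upt_Suc)
    then have "nn_path ((!) l) n" by (simp add: nn_path_def abs_pos_diff Suc_leI)
    then show "c \<in> (\<Union>l\<in>{l :: int list. nn_path ((!) l) n \<and> l ! n \<in> A}. {c. \<forall>k\<le>n. pos c origin k = l ! k})"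
      using c l by (intro UN_I[of l]) auto
  qed auto
  also have "\<dots> \<in> sets coins_law"
    by (intro sets.countable_UN) (auto intro: coins_law_path(2))
  finally show "(\<lambda>c. pos c origin n) -` A \<inter> space coins_law \<in> sets coins_law"
    by (simp add: space_coins_law vimage_def)
qed simp

lemma walk_measurable: "(\<lambda>c. pos c origin) \<in> measurable coins_law path_space"
  by (rule measurable_PiM_single') (auto simp: pos_measurable PiE_UNIV_domain)

text \<open>Records what the later arguments use of a walk: nearest-neighbour paths and the
  probabilities of finite paths. The original walk and the coin-driven walk are instances, and so,
  for the mirrored parameters, are their reflections.\<close>

definition averaged_path_law :: "'a measure \<Rightarrow> (nat \<Rightarrow> 'a \<Rightarrow> int) \<Rightarrow> bool" where
  "averaged_path_law M X \<longleftrightarrow> prob_space M \<and> (\<forall>n. X n \<in> measurable M (count_space UNIV)) \<and>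
     (\<forall>w\<in>space M. X 0 w = 0) \<and> (\<forall>w\<in>space M. \<forall>n. \<bar>X (Suc n) w - X n w\<bar> = 1) \<and>
     (\<forall>h n. nn_path h n \<longrightarrow> measure M {w \<in> space M. \<forall>k\<le>n. X k w = h k} = (\<Prod>x\<in>h ` {..<n}. W (coins_at h n x)))"

text \<open>Both processes give every path cylinder the same probability; paths that are not
  nearest-neighbour from 0 have probability 0 under both.\<close>

lemma AE_transfer:
  assumes X: "averaged_path_law M X" and S: "S \<in> sets path_space"
    and ae: "AE c in coins_law. pos c origin \<in> S"
  shows "AE w in M. (\<lambda>n. X n w) \<in> S"
proof -
  interpret M: prob_space M using X by (simp add: averaged_path_law_def)
  interpret C: prob_space coins_law by (rule prob_space_coins_law)
  have mX: "(\<lambda>w n. X n w) \<in> measurable M path_space"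
    by (rule measurable_PiM_single') (use X in \<open>auto simp: averaged_path_law_def PiE_UNIV_domain\<close>)
  have eq: "distr M path_space (\<lambda>w n. X n w) = distr coins_law path_space (\<lambda>c. pos c origin)"
  proof (rule path_measure_eqI)
    fix h n
    have m1: "measure (distr M path_space (\<lambda>w n. X n w)) (path_cyl h n) = measure M {w \<in> space M. \<forall>k\<le>n. X k w = h k}"
      by (subst measure_distr[OF mX path_cyl_sets]) (auto simp: path_cyl_def intro!: arg_cong[of _ _ "measure M"])
    have m2: "measure (distr coins_law path_space (\<lambda>c. pos c origin)) (path_cyl h n) = measure coins_law {c. \<forall>k\<le>n. pos c origin k = h k}"
      by (subst measure_distr[OF walk_measurable path_cyl_sets]) (auto simp: path_cyl_def space_coins_law intro!: arg_cong[of _ _ "measure coins_law"])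
    show "measure (distr M path_space (\<lambda>w n. X n w)) (path_cyl h n) = measure (distr coins_law path_space (\<lambda>c. pos c origin)) (path_cyl h n)"
    proof (cases "nn_path h n")
      case True
      then show ?thesis unfolding m1 m2 using X coins_law_path(1)[OF True] by (simp add: averaged_path_law_def)
    next
      case False
      have nnX: "nn_path (\<lambda>n. X n w) n" if "w \<in> space M" for w
        using X that by (auto simp: averaged_path_law_def nn_path_def)
      have nnp: "nn_path (pos c origin) n" for c by (auto simp: nn_path_def abs_pos_diff)
      have cong: "nn_path f n \<Longrightarrow> \<forall>k\<le>n. f k = h k \<Longrightarrow> nn_path h n" for f
        by (simp add: nn_path_def Suc_leI)
      have "{w \<in> space M. \<forall>k\<le>n. X k w = h k} = {}" using cong[OF nnX] False by blast
      moreover have "{c. \<forall>k\<le>n. pos c origin k = h k} = {}" using cong[OF nnp] False by blast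
      ultimately show ?thesis unfolding m1 m2 by (simp only: measure_empty)
    qed
  qed (auto intro: M.prob_space_distr[OF mX] C.prob_space_distr[OF walk_measurable])
  have "AE f in distr coins_law path_space (\<lambda>c. pos c origin). f \<in> S"
    using ae S by (subst AE_distr_iff[OF walk_measurable]) (auto simp: space_path_space)
  then have "AE f in distr M path_space (\<lambda>w n. X n w). f \<in> S" by (simp only: eq)
  then show ?thesis using S by (subst (asm) AE_distr_iff[OF mX]) (auto simp: space_path_space)
qed

end

section \<open>Averaging over cookie trajectories\<close>

lemma sum_lists_Suc:
  fixes f :: "'a::finite list \<Rightarrow> real"
  shows "(\<Sum>l\<in>{l. length l = Suc n}. f l) = (\<Sum>i\<in>UNIV. \<Sum>l\<in>{l. length l = n}. f (i # l))"
proof -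
  have "{l :: 'a list. length l = Suc n} = (\<lambda>(i, l). i # l) ` (UNIV \<times> {l. length l = n})"
    by (auto simp: length_Suc_conv image_iff)
  moreover have "inj_on (\<lambda>(i, l). i # l) (UNIV \<times> {l :: 'a list. length l = n})"
    by (auto simp: inj_on_def)
  ultimately show ?thesis
    by (simp add: sum.reindex sum.cartesian_product case_prod_unfold)
qed

lemma finite_lists_length: "finite {l :: 'a::finite list. length l = n}"
  using finite_lists_length_eq[of "UNIV :: 'a set" n] by simp

text \<open>The visit number includes the current visit, while \<open>coins_at\<close> lists the
  steps already taken from the site, hence the successor.\<close>

lemma visits_eq: "visits h n = Suc (length (coins_at h n (h n)))"
proof -
  have "{k. k \<le> n \<and> h k = h n} = insert n {k. k < n \<and> h k = h n}" by auto
  moreover have "card {k. k < n \<and> h k = h n} = length (filter (\<lambda>k. h k = h n) [0..<n])"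
    by (subst distinct_card[symmetric]) (auto intro!: arg_cong[of _ _ card])
  ultimately show ?thesis by (simp add: visits_def coins_at_def)
qed

lemma length_coins_at_mono: "k \<le> n \<Longrightarrow> length (coins_at h k x) \<le> length (coins_at h n x)"
  by (rule lift_Suc_mono_le[of "\<lambda>k. length (coins_at h k x)"]) (auto simp: coins_at_Suc)

lemma coins_at_less:
  assumes "k < n" shows "length (coins_at h k (h k)) < length (coins_at h n (h k))"
  using length_coins_at_mono[of "Suc k" n h "h k"] assms by (simp add: coins_at_Suc)

context cookie_chain
begin

definition traj :: "'s list \<Rightarrow> real" where
  "traj l = (\<Prod>j\<in>{1..<length l}. K$(l ! (j - 1))$(l ! j))"

definition coin_prob :: "bool list \<Rightarrow> 's list \<Rightarrow> real" where
  "coin_prob b l = (\<Prod>j<length b. if b ! j then p$(l ! j) else 1 - p$(l ! j))"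

lemma traj_Cons: "traj (i # i' # l) = K$i$i' * traj (i' # l)"
proof -
  have "traj (i # i' # l) = (\<Prod>j\<in>{Suc 0..<Suc (length (i' # l))}. K$((i # i' # l) ! (j - 1))$((i # i' # l) ! j))"
    by (simp add: traj_def)
  also have "\<dots> = (\<Prod>j\<in>{0..<length (i' # l)}. K$((i # i' # l) ! j)$((i' # l) ! j))"
    by (subst prod.shift_bounds_Suc_ivl) simp
  also have "\<dots> = K$i$i' * (\<Prod>j\<in>{1..<length (i' # l)}. K$((i # i' # l) ! j)$((i' # l) ! j))"
    by (subst prod.atLeast_Suc_lessThan) auto
  also have "(\<Prod>j\<in>{1..<length (i' # l)}. K$((i # i' # l) ! j)$((i' # l) ! j)) = traj (i' # l)"
    unfolding traj_def by (intro prod.cong) (auto simp: nth_Cons')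
  finally show ?thesis .
qed

lemma coin_prob_Cons: "coin_prob (c # b) (i # l) = (if c then p$i else 1 - p$i) * coin_prob b l"
  unfolding coin_prob_def by (simp add: prod.lessThan_Suc_shift del: prod.lessThan_Suc cong: if_cong)

lemma coin_prob_snoc: "coin_prob (b @ [c]) l = coin_prob b l * (if c then p$(l ! length b) else 1 - p$(l ! length b))"
proof -
  have "(\<Prod>j<length b. if (b @ [c]) ! j then p$(l ! j) else 1 - p$(l ! j)) = coin_prob b l"
    unfolding coin_prob_def by (intro prod.cong) (auto simp: nth_append)
  then show ?thesis by (simp add: coin_prob_def nth_append)
qed

text \<open>The cookie states are summed out one at a time. \<open>wt\<close> makes one further
  transition after the last coin; it contributes a row sum of \<open>K\<close>, that is 1.\<close>

lemma sum_traj_coin_prob: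
  "(\<Sum>l\<in>{l. length l = length b}. traj (i # l) * coin_prob (c # b) (i # l)) = wt (c # b) i"
proof (induction b arbitrary: c i)
  case Nil
  then show ?case by (simp add: traj_def coin_prob_def Kf_const)
next
  case (Cons c' b)
  have "(\<Sum>l\<in>{l. length l = length (c' # b)}. traj (i # l) * coin_prob (c # c' # b) (i # l))
    = (\<Sum>i'\<in>UNIV. \<Sum>l\<in>{l. length l = length b}. traj (i # i' # l) * coin_prob (c # c' # b) (i # i' # l))"
    by (simp add: sum_lists_Suc)
  also have "\<dots> = (\<Sum>i'\<in>UNIV. (if c then p$i else 1 - p$i) * K$i$i' *
      (\<Sum>l\<in>{l. length l = length b}. traj (i' # l) * coin_prob (c' # b) (i' # l)))"
    by (simp add: traj_Cons coin_prob_Cons[of c] sum_distrib_left mult_ac)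
  also have "\<dots> = (if c then p$i else 1 - p$i) * Kf (wt (c' # b)) i"
    unfolding Cons Kf_def by (simp add: sum_distrib_left mult_ac)
  finally show ?case by simp
qed

end

context cookie_stack
begin

lemma sum_traj_coin_prob_eta:
  assumes "b \<noteq> []"
  shows "(\<Sum>l\<in>{l. length l = length b}. eta$(l ! 0) * traj l * coin_prob b l) = W b"
proof -
  obtain c b' where b: "b = c # b'" using assms by (cases b) auto
  have "(\<Sum>l\<in>{l. length l = length b}. eta$(l ! 0) * traj l * coin_prob b l)
    = (\<Sum>i\<in>UNIV. eta$i * (\<Sum>l\<in>{l. length l = length b'}. traj (i # l) * coin_prob (c # b') (i # l)))"
    by (simp add: b sum_lists_Suc sum_distrib_left mult.assoc)
  then show ?thesis unfolding sum_traj_coin_prob W_def b .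
qed

text \<open>Independence of the stacks gives the product over sites. Cookies are numbered from 1 and
  list entries from 0, whence \<open>j - 1\<close>.\<close>

lemma env_trajectories:
  assumes M: "prob_space M" and env: "iid_markov_env M K eta R"
    and V: "finite V" and len: "\<And>x. x \<in> V \<Longrightarrow> length (s x) \<ge> 1"
  shows "measure M {w \<in> space M. \<forall>x\<in>V. \<forall>j\<in>{1..length (s x)}. R x j w = s x ! (j - 1)}
     = (\<Prod>x\<in>V. eta$(s x ! 0) * traj (s x))"
proof (cases "V = {}")
  case True
  then show ?thesis using M by (simp add: prob_space.prob_space)
next
  case False
  interpret prob_space M by fact
  let ?N = "\<lambda>_::int. PiM (UNIV::nat set) (\<lambda>j. count_space (UNIV::'s set))"
  define A where "A x = {f :: nat \<Rightarrow> 's. \<forall>j\<in>{1..length (s x)}. f j = s x ! (j - 1)}" for x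
  have spN: "space (?N x) = UNIV" for x by (rule space_PiM_UNIV) simp
  have As: "A x \<in> sets (?N x)" for x
  proof -
    have "{f \<in> space (?N x). \<forall>j\<in>{1..length (s x)}. f j = s x ! (j - 1)} \<in> sets (?N x)"
    proof (intro sets.sets_Collect_finite_All)
      fix j
      show "{f \<in> space (?N x). f j = s x ! (j - 1)} \<in> sets (?N x)"
        using measurable_sets[OF measurable_component_singleton[of j UNIV "\<lambda>_. count_space UNIV"], of "{s x ! (j - 1)}"]
        by (simp add: vimage_def Int_def conj_commute)
    qed simp
    then show ?thesis by (simp only: A_def spN UNIV_I simp_thms)
  qed
  have traj_prob: "\<forall>x n (s :: nat \<Rightarrow> 's). n \<ge> 1 \<longrightarrow> prob {w \<in> space M. \<forall>j\<in>{1..n}. R x j w = s j}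
      = eta $ s 1 * (\<Prod>j\<in>{1..<n}. K $ s j $ s (Suc j))"
    using env by (simp add: iid_markov_env_def)
  have ind: "indep_vars ?N (\<lambda>x w. \<lambda>j. R x j w) UNIV" using env by (simp add: iid_markov_env_def)
  have "{w \<in> space M. \<forall>x\<in>V. \<forall>j\<in>{1..length (s x)}. R x j w = s x ! (j - 1)}
    = (\<Inter>x\<in>V. (\<lambda>w. \<lambda>j. R x j w) -` A x \<inter> space M)"
    using False by (auto simp: A_def)
  also have "prob \<dots> = (\<Prod>x\<in>V. prob ((\<lambda>w. \<lambda>j. R x j w) -` A x \<inter> space M))"
    using indep_varsD[OF ind False V subset_UNIV As] .
  also have "\<dots> = (\<Prod>x\<in>V. eta$(s x ! 0) * traj (s x))"
  proof (rule prod.cong[OF refl])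
    fix x assume x: "x \<in> V"
    have "(\<lambda>w. \<lambda>j. R x j w) -` A x \<inter> space M = {w \<in> space M. \<forall>j\<in>{1..length (s x)}. R x j w = (\<lambda>j. s x ! (j - 1)) j}"
      by (auto simp: A_def)
    also have "prob \<dots> = eta $ (s x ! (1 - 1)) * (\<Prod>j\<in>{1..<length (s x)}. K $ (s x ! (j - 1)) $ (s x ! (Suc j - 1)))"
      by (rule traj_prob[rule_format, where s = "\<lambda>j. s x ! (j - 1)"]) (rule len[OF x])
    finally show "prob ((\<lambda>w. \<lambda>j. R x j w) -` A x \<inter> space M) = eta$(s x ! 0) * traj (s x)"
      by (simp add: traj_def)
  qed
  finally show ?thesis .
qed

lemma env_box_sets:
  assumes "finite V"
  shows "{f :: int \<Rightarrow> nat \<Rightarrow> 's. \<forall>x\<in>V. \<forall>j\<in>{1..m x}. f x j = g x j} \<in> sets env_measure"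
proof -
  have sp: "space (env_measure :: (int \<Rightarrow> nat \<Rightarrow> 's) measure) = UNIV"
    unfolding env_measure_def by (intro space_PiM_UNIV) simp
  have "{f \<in> space (env_measure :: (int \<Rightarrow> nat \<Rightarrow> 's) measure). \<forall>x\<in>V. \<forall>j\<in>{1..m x}. f x j = g x j} \<in> sets env_measure"
  proof (intro sets.sets_Collect_finite_All assms)
    fix x :: int and j :: nat
    have m1: "(\<lambda>f. f x) \<in> measurable env_measure (PiM UNIV (\<lambda>j. count_space (UNIV :: 's set)))"
      unfolding env_measure_def by (rule measurable_component_singleton) simp
    have m2: "(\<lambda>f. f j) \<in> measurable (PiM UNIV (\<lambda>j. count_space (UNIV :: 's set))) (count_space UNIV)"
      by (rule measurable_component_singleton) simp
    have "(\<lambda>f. f x j) \<in> measurable (env_measure :: (int \<Rightarrow> nat \<Rightarrow> 's) measure) (count_space UNIV)"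
      by (rule measurable_compose[OF m1 m2])
    from measurable_sets[OF this, of "{g x j}"]
    show "{f \<in> space (env_measure :: (int \<Rightarrow> nat \<Rightarrow> 's) measure). f x j = g x j} \<in> sets env_measure"
      by (simp add: vimage_def Int_def conj_commute)
  qed simp
  then show ?thesis by (simp only: sp UNIV_I simp_thms)
qed

end

lemma level_set_measurable:
  assumes "f \<in> measurable M (count_space UNIV)"
  shows "{w \<in> space M. f w = a} \<in> sets M"
proof -
  have "{w \<in> space M. f w = a} = f -` {a} \<inter> space M" by auto
  with measurable_sets[OF assms, of "{a}"] show ?thesis by simp
qed

context cookie_stack
begin

text \<open>Once the finitely many cookie states met by the path are fixed, every step has a known
  probability, and the path probability is a product over sites. Summing over these states then
  factorises, site by site, into the weights \<open>W\<close>.\<close>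

lemma averaged_path_law_excited_walk:
  assumes M: "prob_space M" and env: "iid_markov_env M K eta R" and walk: "excited_walk M (\<lambda>i. p$i) R X"
  shows "averaged_path_law M X"
  unfolding averaged_path_law_def
proof (intro conjI allI impI)
  interpret prob_space M by fact
  show "prob_space M" by fact
  have Xm: "X n \<in> measurable M (count_space UNIV)" for n
    by (rule walk[unfolded excited_walk_def, THEN conjunct1, rule_format])
  have X0: "X 0 w = 0" if "w \<in> space M" for w
    using walk[unfolded excited_walk_def, THEN conjunct2, THEN conjunct1] that by simp
  have X1: "\<bar>X (Suc n) w - X n w\<bar> = 1" if "w \<in> space M" for n w
    using walk[unfolded excited_walk_def, THEN conjunct2, THEN conjunct2, THEN conjunct1] that by simp
  show "\<And>n. X n \<in> measurable M (count_space UNIV)" by (rule Xm)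
  show "\<forall>w\<in>space M. X 0 w = 0" using X0 by blast
  show "\<forall>w\<in>space M. \<forall>n. \<bar>X (Suc n) w - X n w\<bar> = 1" using X1 by blast
  fix h n assume nn: "nn_path h n"
  define V where "V = h ` {..<n}"
  \<comment> \<open>Up to time \<open>n\<close> the path uses \<open>l x\<close> coins at
    \<open>x\<close>, so the cookies with index at most \<open>l x\<close> decide its
    probability.\<close>
  define l where "l x = length (coins_at h n x)" for x
  have V: "finite V" by (simp add: V_def)
  have l1: "l x \<ge> 1" if "x \<in> V" for x
  proof -
    obtain k where "k < n" "x = h k" using \<open>x \<in> V\<close> by (auto simp: V_def)
    with coins_at_less[of k n h] show ?thesis by (simp add: l_def)
  qed
  have Rm: "R x j \<in> measurable M (count_space UNIV)" for x j
  proof -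
    have "(\<lambda>w. \<lambda>j. R x j w) \<in> measurable M (PiM UNIV (\<lambda>j. count_space UNIV))"
      using env by (simp add: iid_markov_env_def)
    from measurable_compose[OF this measurable_component_singleton[of j UNIV]] show ?thesis by simp
  qed
  define Es where "Es s = {w \<in> space M. \<forall>x\<in>V. \<forall>j\<in>{1..l x}. R x j w = s x ! (j - 1)}" for s
  have Cs: "{w \<in> space M. \<forall>i\<le>k. X i w = h i} \<in> events" for k
  proof -
    have e: "{w \<in> space M. \<forall>i\<le>k. X i w = h i} = {w \<in> space M. \<forall>i\<in>{..k}. X i w = h i}" by auto
    show ?thesis unfolding e by (intro sets.sets_Collect_finite_All level_set_measurable Xm) simp
  qed
  have Ess: "Es s \<in> events" for s unfolding Es_def
  proof (intro sets.sets_Collect_finite_All V)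
    fix x j show "{w \<in> space M. R x j w = s x ! (j - 1)} \<in> events"
      by (rule level_set_measurable[OF Rm[of x j]])
  qed simp
  have step: "prob (Es s \<inter> {w \<in> space M. \<forall>i\<le>k. X i w = h i})
      = prob (Es s) * (\<Prod>x\<in>V. coin_prob (coins_at h k x) (s x))" if "k \<le> n" for s k
    using that
  proof (induction k)
    case 0
    have "{w \<in> space M. \<forall>i\<le>0. X i w = h i} = space M" using X0 nn by (auto simp: nn_path_def)
    then show ?case using sets.Int_space_eq2[OF Ess[of s]] by (simp add: coins_at_0 coin_prob_def)
  next
    case (Suc k)
    let ?C = "\<lambda>k. {w \<in> space M. \<forall>i\<le>k. X i w = h i}"
    \<comment> \<open>The walk hypothesis is applied with this box as the environment event; on it
      the success probability is the constant \<open>?q\<close>.\<close>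
    let ?E = "{f. \<forall>x\<in>V. \<forall>j\<in>{1..l x}. f x j = s x ! (j - 1)}"
    let ?q = "p$(s (h k) ! length (coins_at h k (h k)))"
    have kV: "h k \<in> V" using Suc.prems by (auto simp: V_def)
    have vis: "visits h k \<in> {1..l (h k)}" "visits h k - 1 = length (coins_at h k (h k))"
      using coins_at_less[of k n h] Suc.prems by (auto simp: visits_eq l_def)
    let ?D = "{w \<in> space M. (\<lambda>x j. R x j w) \<in> ?E \<and> (\<forall>i\<le>k. X i w = h i) \<and> X (Suc k) w = X k w + 1}"
    have D: "?D = Es s \<inter> ?C k \<inter> {w \<in> space M. X (Suc k) w = h k + 1}" by (auto simp: Es_def)
    have sD: "{w \<in> space M. X (Suc k) w = h k + 1} \<in> events"
      by (rule level_set_measurable[OF Xm[of "Suc k"]])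
    have ev: "Es s \<inter> ?C k \<in> events" by (intro sets.Int Ess Cs)
    have "prob ?D = (\<integral>w. indicator {w \<in> space M. (\<lambda>x j. R x j w) \<in> ?E \<and> (\<forall>i\<le>k. X i w = h i)} w
        * p$(R (h k) (visits h k) w) \<partial>M)"
      by (rule walk[unfolded excited_walk_def, THEN conjunct2, THEN conjunct2, THEN conjunct2,
            THEN spec[of _ k], THEN spec[of _ h], THEN spec[of _ ?E], THEN mp, OF env_box_sets[OF V]])
    also have "\<dots> = (\<integral>w. ?q * indicator (Es s \<inter> ?C k) w \<partial>M)"
    proof (rule Bochner_Integration.integral_cong[OF refl])
      fix w assume w: "w \<in> space M"
      show "indicator {w \<in> space M. (\<lambda>x j. R x j w) \<in> ?E \<and> (\<forall>i\<le>k. X i w = h i)} w * p$(R (h k) (visits h k) w)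
        = ?q * indicator (Es s \<inter> ?C k) w"
      proof (cases "w \<in> Es s \<inter> ?C k")
        case True
        then have "R (h k) (visits h k) w = s (h k) ! (visits h k - 1)" using kV vis(1) by (auto simp: Es_def)
        then show ?thesis using True vis(2) by (auto simp: Es_def)
      qed (auto simp: Es_def)
    qed
    also have "\<dots> = ?q * prob (Es s \<inter> ?C k)"
      by (simp only: integral_mult_right_zero Bochner_Integration.integral_indicator sets.Int_space_eq2[OF ev])
    finally have pD: "prob (Es s \<inter> ?C k \<inter> {w \<in> space M. X (Suc k) w = h k + 1}) = ?q * prob (Es s \<inter> ?C k)"
      unfolding D .
    have st: "h (Suc k) = h k + 1 \<or> h (Suc k) = h k - 1"
      using nn Suc.prems unfolding nn_path_def by (smt (verit) Suc_le_eq)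
    have IH: "prob (Es s \<inter> ?C k) = prob (Es s) * (\<Prod>x\<in>V. coin_prob (coins_at h k x) (s x))"
      using Suc by simp
    have main: "prob (Es s \<inter> ?C (Suc k)) = prob (Es s \<inter> ?C k) * (if h (Suc k) = h k + 1 then ?q else 1 - ?q)"
    proof (cases "h (Suc k) = h k + 1")
      case True
      then have "Es s \<inter> ?C (Suc k) = Es s \<inter> ?C k \<inter> {w \<in> space M. X (Suc k) w = h k + 1}"
        by (auto simp: le_Suc_eq)
      then show ?thesis using pD True by simp
    next
      case False
      then have hk: "h (Suc k) = h k - 1" using st by simp
      \<comment> \<open>A step to the left is the complement of a step to the right, because
        increments are 1 or -1.\<close>
      have "Es s \<inter> ?C (Suc k) = (Es s \<inter> ?C k) - (Es s \<inter> ?C k \<inter> {w \<in> space M. X (Suc k) w = h k + 1})"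
      proof (intro equalityI subsetI)
        fix w assume "w \<in> (Es s \<inter> ?C k) - (Es s \<inter> ?C k \<inter> {w \<in> space M. X (Suc k) w = h k + 1})"
        then have w: "w \<in> Es s" "w \<in> ?C k" "X (Suc k) w \<noteq> h k + 1" by auto
        then have "X (Suc k) w = h (Suc k)" using X1[of w k] hk by auto
        with w show "w \<in> Es s \<inter> ?C (Suc k)" by (auto simp: le_Suc_eq)
      qed (use hk in auto)
      then have "prob (Es s \<inter> ?C (Suc k)) = prob (Es s \<inter> ?C k) - prob (Es s \<inter> ?C k \<inter> {w \<in> space M. X (Suc k) w = h k + 1})"
        by (simp only:) (intro finite_measure_Diff ev sets.Int sD Int_lower1)
      then show ?thesis using pD False by (simp add: algebra_simps)
    qed
    have "(\<Prod>x\<in>V. coin_prob (coins_at h (Suc k) x) (s x))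
      = coin_prob (coins_at h (Suc k) (h k)) (s (h k)) * (\<Prod>x\<in>V - {h k}. coin_prob (coins_at h (Suc k) x) (s x))"
      by (rule prod.remove[OF V kV])
    also have "(\<Prod>x\<in>V - {h k}. coin_prob (coins_at h (Suc k) x) (s x)) = (\<Prod>x\<in>V - {h k}. coin_prob (coins_at h k x) (s x))"
      by (intro prod.cong) (auto simp: coins_at_Suc)
    also have "coin_prob (coins_at h (Suc k) (h k)) (s (h k))
      = coin_prob (coins_at h k (h k)) (s (h k)) * (if h (Suc k) = h k + 1 then ?q else 1 - ?q)"
      by (simp add: coins_at_Suc coin_prob_snoc)
    finally have "(\<Prod>x\<in>V. coin_prob (coins_at h (Suc k) x) (s x))
      = (\<Prod>x\<in>V. coin_prob (coins_at h k x) (s x)) * (if h (Suc k) = h k + 1 then ?q else 1 - ?q)"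
      using prod.remove[OF V kV, of "\<lambda>x. coin_prob (coins_at h k x) (s x)"] by (simp add: mult_ac)
    then show ?case unfolding main IH by (simp add: mult_ac)
  qed
  \<comment> \<open>Extensional functions on \<open>V\<close> make the family finite and the events
    \<open>Es s\<close> disjoint for different \<open>s\<close>.\<close>
  define SS where "SS = PiE V (\<lambda>x. {t :: 's list. length t = l x})"
  have fin: "finite SS" unfolding SS_def by (intro finite_PiE V finite_lists_length)
  let ?C = "{w \<in> space M. \<forall>i\<le>n. X i w = h i}"
  have cover: "?C = (\<Union>s\<in>SS. Es s \<inter> ?C)"
  proof (intro equalityI subsetI)
    fix w assume w: "w \<in> ?C"
    let ?s = "restrict (\<lambda>x. map (\<lambda>j. R x (Suc j) w) [0..<l x]) V"
    have "?s \<in> SS" by (auto simp: SS_def)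
    moreover have "w \<in> Es ?s" using w by (auto simp: Es_def)
    ultimately show "w \<in> (\<Union>s\<in>SS. Es s \<inter> ?C)" using w by blast
  qed auto
  have disj: "disjoint_family_on (\<lambda>s. Es s \<inter> ?C) SS"
    unfolding disjoint_family_on_def
  proof (intro ballI impI)
    fix s s' assume s: "s \<in> SS" "s' \<in> SS" "s \<noteq> s'"
    have "s = s'" if "w \<in> Es s" "w \<in> Es s'" for w
    proof (rule PiE_ext[OF s(1)[unfolded SS_def] s(2)[unfolded SS_def]])
      fix x assume x: "x \<in> V"
      have len: "length (s x) = l x" "length (s' x) = l x" using s x by (auto simp: SS_def)
      show "s x = s' x"
      proof (rule nth_equalityI)
        fix i assume "i < length (s x)"
        then have "Suc i \<in> {1..l x}" using len by simp
        then have "R x (Suc i) w = s x ! (Suc i - 1)" "R x (Suc i) w = s' x ! (Suc i - 1)"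
          using that x unfolding Es_def by blast+
        then show "s x ! i = s' x ! i" by simp
      qed (simp add: len)
    qed
    then show "(Es s \<inter> ?C) \<inter> (Es s' \<inter> ?C) = {}" using s(3) by blast
  qed
  have "prob ?C = prob (\<Union>s\<in>SS. Es s \<inter> ?C)" by (rule arg_cong[OF cover])
  also have "\<dots> = (\<Sum>s\<in>SS. prob (Es s \<inter> ?C))"
    by (intro finite_measure_finite_Union fin disj image_subsetI sets.Int Ess Cs)
  also have "\<dots> = (\<Sum>s\<in>SS. \<Prod>x\<in>V. eta$(s x ! 0) * traj (s x) * coin_prob (coins_at h n x) (s x))"
  proof (rule sum.cong[OF refl])
    fix s assume s: "s \<in> SS"
    have len: "length (s x) = l x" if "x \<in> V" for x using s that by (auto simp: SS_def)
    have "Es s = {w \<in> space M. \<forall>x\<in>V. \<forall>j\<in>{1..length (s x)}. R x j w = s x ! (j - 1)}"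
      unfolding Es_def using len by auto
    then have "prob (Es s) = (\<Prod>x\<in>V. eta$(s x ! 0) * traj (s x))"
      using env_trajectories[OF M env V, of s] len l1 by simp
    then show "prob (Es s \<inter> ?C) = (\<Prod>x\<in>V. eta$(s x ! 0) * traj (s x) * coin_prob (coins_at h n x) (s x))"
      using step[of n s] by (simp add: prod.distrib)
  qed
  also have "\<dots> = (\<Prod>x\<in>V. \<Sum>t\<in>{t. length t = l x}. eta$(t ! 0) * traj t * coin_prob (coins_at h n x) t)"
    unfolding SS_def by (rule prod_sum_PiE[symmetric, OF V finite_lists_length])
  also have "\<dots> = (\<Prod>x\<in>V. W (coins_at h n x))"
  proof (rule prod.cong[OF refl])
    fix x assume "x \<in> V"
    then have "coins_at h n x \<noteq> []" using l1[of x] by (auto simp: l_def)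
    then show "(\<Sum>t\<in>{t. length t = l x}. eta$(t ! 0) * traj t * coin_prob (coins_at h n x) t) = W (coins_at h n x)"
      unfolding l_def by (rule sum_traj_coin_prob_eta)
  qed
  finally show "prob ?C = (\<Prod>x\<in>h ` {..<n}. W (coins_at h n x))" by (simp add: V_def)
qed

section \<open>Reflection\<close>

lemma mirror_stack: "cookie_stack K (1 - p) mu eta"
  by (intro cookie_stack.intro cookie_stack_axioms.intro mirror eta)

lemma W_mirror: "cookie_stack.W K (1 - p) eta (map Not b) = W b"
proof -
  interpret m: cookie_stack K "1 - p" mu eta by (rule mirror_stack)
  have "m.wt (map Not b) = wt b" by (induction b) auto
  then show ?thesis by (simp add: m.W_def W_def)
qed

text \<open>A nearest-neighbour step that is not to the right is to the left, so reflection negates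
  every coin and swaps the sites \<open>x\<close> and \<open>- x\<close>.\<close>

lemma coins_at_uminus:
  assumes "nn_path h n"
  shows "coins_at (\<lambda>k. - h k) n x = map Not (coins_at h n (- x))"
proof -
  have step: "(- h (Suc k) = - h k + 1) \<longleftrightarrow> \<not> h (Suc k) = h k + 1" if "k < n" for k
  proof -
    have "\<bar>h (Suc k) - h k\<bar> = 1" using assms that by (simp add: nn_path_def)
    then show ?thesis by arith
  qed
  have "filter (\<lambda>k. - h k = x) [0..<n] = filter (\<lambda>k. h k = - x) [0..<n]"
    by (rule filter_cong) auto
  then show ?thesis unfolding coins_at_def map_map
  proof (rule map_cong)
    fix k assume "k \<in> set (filter (\<lambda>k. h k = - x) [0..<n])"
    then have "k < n" by simp
    then show "(- h (Suc k) = - h k + 1) = (Not \<circ> (\<lambda>k. h (Suc k) = h k + 1)) k"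
      unfolding comp_def by (rule step)
  qed
qed

text \<open>Negating all coins exchanges \<open>p\<close> and \<open>1 - p\<close>, so statements
  about one direction transfer to the other under the mirrored parameters.\<close>

lemma averaged_path_law_mirror:
  assumes X: "averaged_path_law M X"
  shows "cookie_stack.averaged_path_law K (1 - p) eta M (\<lambda>n w. - X n w)"
proof -
  interpret m: cookie_stack K "1 - p" mu eta by (rule mirror_stack)
  show ?thesis unfolding m.averaged_path_law_def
  proof (intro conjI allI impI)
    show "prob_space M" using X by (simp add: averaged_path_law_def)
    show "(\<lambda>w. - X n w) \<in> measurable M (count_space UNIV)" for n
      using X by (intro measurable_compose[of "X n" M "count_space UNIV" uminus]) (auto simp: averaged_path_law_def)
    show "\<forall>w\<in>space M. - X 0 w = 0" using X by (simp add: averaged_path_law_def)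
    show "\<forall>w\<in>space M. \<forall>n. \<bar>- X (Suc n) w - - X n w\<bar> = 1"
      using X unfolding averaged_path_law_def by (smt (verit))
    fix h n assume nn: "nn_path h n"
    have nn': "nn_path (\<lambda>k. - h k) n" using nn unfolding nn_path_def by (smt (verit))
    have "measure M {w \<in> space M. \<forall>k\<le>n. - X k w = h k} = measure M {w \<in> space M. \<forall>k\<le>n. X k w = - h k}"
      by (intro arg_cong[of _ _ "measure M"]) force
    also have "\<dots> = (\<Prod>x\<in>(\<lambda>k. - h k) ` {..<n}. W (coins_at (\<lambda>k. - h k) n x))"
      using X nn' by (simp add: averaged_path_law_def)
    also have "(\<lambda>k. - h k) ` {..<n} = uminus ` h ` {..<n}" by auto
    also have "(\<Prod>x\<in>uminus ` h ` {..<n}. W (coins_at (\<lambda>k. - h k) n x)) = (\<Prod>x\<in>h ` {..<n}. W (coins_at (\<lambda>k. - h k) n (- x)))"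
      by (subst prod.reindex) auto
    also have "\<dots> = (\<Prod>x\<in>h ` {..<n}. m.W (coins_at h n x))"
    proof (rule prod.cong[OF refl])
      fix x
      have "W (map Not (coins_at h n x)) = m.W (map Not (map Not (coins_at h n x)))" by (rule W_mirror[symmetric])
      also have "map Not (map Not (coins_at h n x)) = coins_at h n x" by (simp add: comp_def)
      finally show "W (coins_at (\<lambda>k. - h k) n (- x)) = m.W (coins_at h n x)"
        by (simp add: coins_at_uminus[OF nn])
    qed
    finally show "measure M {w \<in> space M. \<forall>k\<le>n. - X k w = h k} = (\<Prod>x\<in>h ` {..<n}. m.W (coins_at h n x))" .
  qed
qed

lemma AE_X_hits_negative:
  assumes X: "averaged_path_law M X" and rho: "rho \<le> nu / 2"
  shows "AE w in M. \<forall>z<0. \<exists>n. X n w = z"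
proof -
  have e: "{f. \<forall>z<0. \<exists>n. f n = z} = (\<Inter>z\<in>{..<0::int}. \<Union>n. {f. f n \<in> {z}})" by auto
  have "{f. \<forall>z<0::int. \<exists>n. f n = z} \<in> sets path_space"
    unfolding e by (intro sets.countable_INT' sets.countable_UN' image_subsetI coord_path_sets) (auto intro: exI[of _ "-1"])
  from AE_transfer[OF X this] AE_hits_negative[OF rho] show ?thesis by simp
qed

lemma averaged_path_law_coins: "averaged_path_law coins_law (\<lambda>n c. pos c origin n)"
  unfolding averaged_path_law_def
  using prob_space_coins_law pos_measurable abs_pos_diff coins_law_path(1) by (simp add: space_coins_law)

lemma AE_X_hits_positive:
  assumes X: "averaged_path_law M X"
    and rho: "cookie_stack.rho K (1 - p) mu eta \<le> cookie_chain.nu K (1 - p) mu / 2"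
  shows "AE w in M. \<forall>z>0. \<exists>n. X n w = z"
proof -
  interpret m: cookie_stack K "1 - p" mu eta by (rule mirror_stack)
  have "AE w in M. \<forall>z<0. \<exists>n. - X n w = z"
    by (rule m.AE_X_hits_negative[OF averaged_path_law_mirror[OF X] rho])
  then show ?thesis
  proof eventually_elim
    case (elim w)
    show ?case
    proof (intro allI impI)
      fix z :: int assume "z > 0"
      then obtain n where "- X n w = - z" using elim by (metis neg_less_0_iff_less)
      then show "\<exists>n. X n w = z" by auto
    qed
  qed
qed

lemma at_top_path_sets: "{f :: nat \<Rightarrow> int. filterlim f at_top sequentially} \<in> sets path_space"
proof -
  have "{f :: nat \<Rightarrow> int. filterlim f at_top sequentially} = (\<Inter>Z. \<Union>N. \<Inter>n\<in>{N..}. {f. f n \<in> {Z..}})"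
    unfolding set_eq_iff mem_Collect_eq filterlim_at_top eventually_sequentially
    by (simp only: mem_Collect_eq INT_iff UN_iff Ball_def Bex_def atLeast_iff UNIV_I simp_thms)
  also have "\<dots> \<in> sets path_space"
    by (intro sets.countable_INT' sets.countable_UN' image_subsetI coord_path_sets) auto
  finally show ?thesis .
qed

text \<open>The condition on the mirrored parameters makes the walk visit every positive level;
  survival at arbitrarily high levels then forbids returning. The argument is pathwise for the
  coin-driven walk and is transferred through the path law.\<close>

lemma AE_X_transient:
  assumes X: "averaged_path_law M X" and rho: "rho > nu / 2"
    and rho': "cookie_stack.rho K (1 - p) mu eta \<le> cookie_chain.nu K (1 - p) mu / 2"
  shows "AE w in M. filterlim (\<lambda>n. X n w) at_top sequentially"
proof -
  have "AE c in coins_law. filterlim (pos c origin) at_top sequentially"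
    using AE_X_hits_positive[OF averaged_path_law_coins rho'] AE_survives_infinitely_often[OF rho]
  proof eventually_elim
    case (elim c)
    have "\<exists>n. pos c origin n = k" if "k \<ge> 0" for k
      using elim(1) that by (cases "k = 0") (auto intro: exI[of _ 0])
    then show ?case using elim(2) by (intro transient_right) auto
  qed
  then show ?thesis using AE_transfer[OF X at_top_path_sets] by simp
qed

lemma delta_le_1_iff: "delta_val K p mu eta \<le> 1 \<longleftrightarrow> rho \<le> nu / 2"
  using nu_pos by (simp add: delta_eq field_simps)

end

section \<open>From visited levels to limits\<close>

lemma liminf_eq_MInf_if_hits:
  fixes f :: "nat \<Rightarrow> int"
  assumes "\<forall>z<0. \<exists>n. f n = z"
  shows "liminf (\<lambda>n. ereal (real_of_int (f n))) = -\<infinity>"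
proof (rule ccontr)
  assume "liminf (\<lambda>n. ereal (real_of_int (f n))) \<noteq> -\<infinity>"
  then obtain r where "ereal r < liminf (\<lambda>n. ereal (real_of_int (f n)))"
    by (metis ereal_bot less_eq_ereal_def linorder_not_le)
  then have "eventually (\<lambda>n. ereal r < ereal (real_of_int (f n))) sequentially"
    using le_Liminf_iff[of "liminf (\<lambda>n. ereal (real_of_int (f n)))" sequentially "\<lambda>n. ereal (real_of_int (f n))"] by blast
  then obtain N where N: "\<And>n. n \<ge> N \<Longrightarrow> r < real_of_int (f n)" by (auto simp: eventually_sequentially)
  \<comment> \<open>This level is below all values up to time \<open>N\<close>, so it can only be
    hit after \<open>N\<close>, where values exceed \<open>r\<close>; but it is also at most
    \<open>r\<close>.\<close>
  define z where "z = min (min (-1) \<lfloor>r\<rfloor>) (Min (f ` {..N}) - 1)"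
  have "z < 0" by (simp add: z_def)
  then obtain n where n: "f n = z" using assms by blast
  have "n > N"
  proof (rule ccontr)
    assume "\<not> n > N"
    then have "Min (f ` {..N}) \<le> f n" by (intro Min_le) auto
    then show False using n by (simp add: z_def)
  qed
  then have "r < real_of_int z" using N[of n] n by simp
  moreover have "real_of_int z \<le> r" unfolding le_floor_iff[symmetric] by (simp add: z_def)
  ultimately show False by simp
qed

lemma limsup_eq_PInf_if_hits:
  fixes f :: "nat \<Rightarrow> int"
  assumes "\<forall>z>0. \<exists>n. f n = z"
  shows "limsup (\<lambda>n. ereal (real_of_int (f n))) = \<infinity>"
proof -
  have "\<forall>z<0. \<exists>n. - f n = z"
  proof (intro allI impI)
    fix z :: int assume "z < 0"
    then obtain n where "f n = - z" using assms by (metis neg_0_less_iff_less)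
    then show "\<exists>n. - f n = z" by (intro exI[of _ n]) simp
  qed
  then have "liminf (\<lambda>n. ereal (real_of_int (- f n))) = -\<infinity>" by (rule liminf_eq_MInf_if_hits)
  then have "liminf (\<lambda>n. - ereal (real_of_int (f n))) = -\<infinity>" by (simp only: of_int_minus uminus_ereal.simps)
  then show ?thesis unfolding ereal_Liminf_uminus by simp
qed

lemma filterlim_uminus_at_top_int:
  fixes f :: "nat \<Rightarrow> int"
  shows "filterlim (\<lambda>n. - f n) at_top F \<longleftrightarrow> filterlim f at_bot F"
proof -
  have "(\<forall>Z. eventually (\<lambda>n. Z \<le> - f n) F) \<longleftrightarrow> (\<forall>Z. eventually (\<lambda>n. f n \<le> - Z) F)"
    by (simp add: le_minus_iff)
  also have "\<dots> \<longleftrightarrow> (\<forall>Z. eventually (\<lambda>n. f n \<le> Z) F)"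
  proof (intro iffI allI)
    fix Z assume "\<forall>Z. eventually (\<lambda>n. f n \<le> - Z) F"
    from this[THEN spec[of _ "- Z"]] show "eventually (\<lambda>n. f n \<le> Z) F" by simp
  qed blast
  finally show ?thesis unfolding filterlim_at_top filterlim_at_bot .
qed

theorem theorem1p3:
  fixes K :: "real^'s::finite^'s" and p :: "real^'s" and mu eta :: "real^'s"
    and M :: "'a measure" and R :: "int \<Rightarrow> nat \<Rightarrow> 'a \<Rightarrow> 's" and X :: "nat \<Rightarrow> 'a \<Rightarrow> int"
  assumes K_stoch: "stochastic_matrix K"
    and unique_class: "\<exists>!C. closed_set K C \<and> irreducible_set K C"
    and mu_stat: "stationary_dist K mu"
    and p_range: "\<forall>i. 0 < p$i \<and> p$i < 1"
    and eta_dist: "prob_vector eta"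
    and pbar: "mu \<bullet> p = 1/2"
    and M_prob: "prob_space M"
    and env: "iid_markov_env M K eta R"
    and walk: "excited_walk M (\<lambda>i. p$i) R X"
  shows "delta_val K p mu eta + deltat_val K p mu eta < 1
         \<and> (delta_val K p mu eta > 1 \<longrightarrow>
              measure M {w \<in> space M. filterlim (\<lambda>n. X n w) at_top sequentially} = 1)
         \<and> (deltat_val K p mu eta > 1 \<longrightarrow>
              measure M {w \<in> space M. filterlim (\<lambda>n. X n w) at_bot sequentially} = 1)
         \<and> (delta_val K p mu eta \<le> 1 \<and> deltat_val K p mu eta \<le> 1 \<longrightarrow>
              measure M {w \<in> space M. liminf (\<lambda>n. ereal (real_of_int (X n w))) = -\<infinity>
                                     \<and> limsup (\<lambda>n. ereal (real_of_int (X n w))) = \<infinity>} = 1)"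
proof -
  interpret cookie_chain K p mu
    using K_stoch unique_class mu_stat p_range pbar by (intro cookie_chain.intro) auto
  interpret cookie_stack K p mu eta
    by (intro cookie_stack.intro cookie_stack_axioms.intro cookie_chain_axioms eta_dist)
  interpret m: cookie_stack K "1 - p" mu eta by (rule mirror_stack)
  interpret prob_space M by (rule M_prob)
  have dt: "deltat_val K p mu eta = delta_val K (1 - p) mu eta"
    using deltat_val_mirror[of K p mu eta] by simp
  have pp: "1 - (1 - p) = p" by simp
  have law: "averaged_path_law M X"
    by (rule averaged_path_law_excited_walk[OF M_prob env walk])
  have mlaw: "m.averaged_path_law M (\<lambda>n w. - X n w)" by (rule averaged_path_law_mirror[OF law])
  have Xm: "X n \<in> measurable M (count_space UNIV)" for n
    using law by (simp add: averaged_path_law_def)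
  have top_meas: "{w \<in> space M. filterlim (\<lambda>n. Y n w) at_top sequentially} \<in> events"
    if "\<And>n. Y n \<in> measurable M (count_space UNIV)" for Y :: "nat \<Rightarrow> 'a \<Rightarrow> int"
  proof -
    have "(\<lambda>w n. Y n w) \<in> measurable M path_space"
      by (rule measurable_PiM_single') (use that in \<open>auto simp: PiE_UNIV_domain\<close>)
    from measurable_sets[OF this at_top_path_sets] show ?thesis
      by (rule back_subst[of "\<lambda>E. E \<in> events"]) auto
  qed
  have sum: "delta_val K p mu eta + deltat_val K p mu eta < 1"
    unfolding dt by (rule delta_sum_less[OF eta_dist])
  moreover have "prob {w \<in> space M. filterlim (\<lambda>n. X n w) at_top sequentially} = 1"
    if "delta_val K p mu eta > 1"
  proof -
    have "rho > nu / 2" using that delta_le_1_iff by linarith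
    \<comment> \<open>\<open>delta > 1\<close> and the sum below 1 make the mirrored parameter
      negative, so the mirrored process is in the extinction regime.\<close>
    moreover have "m.rho \<le> m.nu / 2" using that sum dt m.delta_le_1_iff by linarith
    ultimately show ?thesis
      using AE_X_transient[OF law] by (subst prob_Collect_eq_1[OF top_meas[OF Xm]]) auto
  qed
  moreover have "prob {w \<in> space M. filterlim (\<lambda>n. X n w) at_bot sequentially} = 1"
    if "deltat_val K p mu eta > 1"
  proof -
    have "m.rho > m.nu / 2" using that dt m.delta_le_1_iff by linarith
    moreover have "rho \<le> nu / 2" using that sum delta_le_1_iff by linarith
    \<comment> \<open>Reflecting twice restores \<open>p\<close>, so the transient case applies to
      the reflected walk.\<close>
    ultimately have "AE w in M. filterlim (\<lambda>n. - X n w) at_top sequentially"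
      using m.AE_X_transient[OF mlaw] by (simp only: pp)
    moreover have "{w \<in> space M. filterlim (\<lambda>n. - X n w) at_top sequentially} \<in> events"
    proof (rule top_meas)
      show "(\<lambda>w. - X n w) \<in> measurable M (count_space UNIV)" for n
        by (rule measurable_compose[OF Xm]) simp
    qed
    ultimately have "prob {w \<in> space M. filterlim (\<lambda>n. - X n w) at_top sequentially} = 1"
      by (subst prob_Collect_eq_1) auto
    then show ?thesis by (simp only: filterlim_uminus_at_top_int)
  qed
  moreover have "prob {w \<in> space M. liminf (\<lambda>n. ereal (real_of_int (X n w))) = -\<infinity>
        \<and> limsup (\<lambda>n. ereal (real_of_int (X n w))) = \<infinity>} = 1"
    if "delta_val K p mu eta \<le> 1" "deltat_val K p mu eta \<le> 1"
  proof -
    have "rho \<le> nu / 2" "m.rho \<le> m.nu / 2" using that dt delta_le_1_iff m.delta_le_1_iff by auto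
    then have "AE w in M. \<forall>z<0. \<exists>n. X n w = z" "AE w in M. \<forall>z>0. \<exists>n. X n w = z"
      using AE_X_hits_negative[OF law] AE_X_hits_positive[OF law] by auto
    then have ae: "AE w in M. liminf (\<lambda>n. ereal (real_of_int (X n w))) = -\<infinity>
        \<and> limsup (\<lambda>n. ereal (real_of_int (X n w))) = \<infinity>"
      by eventually_elim (auto intro: liminf_eq_MInf_if_hits limsup_eq_PInf_if_hits)
    have rm: "(\<lambda>w. ereal (real_of_int (X n w))) \<in> borel_measurable M" for n
      by (rule measurable_compose[OF Xm]) simp
    have "(\<lambda>w. liminf (\<lambda>n. ereal (real_of_int (X n w)))) \<in> borel_measurable M"
      "(\<lambda>w. limsup (\<lambda>n. ereal (real_of_int (X n w)))) \<in> borel_measurable M"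
      by (intro borel_measurable_liminf borel_measurable_limsup rm)+
    then have "{w \<in> space M. liminf (\<lambda>n. ereal (real_of_int (X n w))) = -\<infinity>
        \<and> limsup (\<lambda>n. ereal (real_of_int (X n w))) = \<infinity>} \<in> events"
      by measurable
    from prob_Collect_eq_1[OF this] ae show ?thesis by blast
  qed
  ultimately show ?thesis by blast
qed

end
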